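(* Let $0<a<b$ and let $m\ge 2$ be an integer. Let $g$ be a function on $[0,1]$ such that $0\le g(x)\le 1$ for $0\le x\le 1$, $g$ is $m$-times differentiable on $(0,1)$, $g^{(k)}(0)=g^{(k)}(1)=0$ for all $k=1,\dots,m$, and there are positive constants $a_k$ with $|g^{(k)}(x)|\le a_k$ for all $0<x<1$ and $k=1,\dots,m$. Define $f(x)=1$ for $0\le x\le a$, $f(x)=0$ for $x\ge b$, and $f(x)=g\left(\frac{x-a}{b-a}\right)$ for $a\le x\le b$, and let $F$ be the Mellin transform of $f$, $F(s)=\int_0^\infty f(t)t^{s-1}dt$, meromorphically continued to $\mathbb{C}$ (its only pole being at $s=0$). For $x>1$ let $\mathscr{S}(x)=\sum_{n\ge1}\Lambda(n)f(n/x)$. Then \[ \mathscr{S}(x)=xF(1)-\sum_{\rho}x^{\rho}F(\rho)-\frac{\zeta'}{\zeta}(0)-\sum_{n=1}^{\infty}x^{-2n}F(-2n), \] where $\rho=\beta+i\gamma$ runs through all non-trivial zeros of the Riemann zeta function $\zeta$ (the sum over $\rho$ being taken as the limit as $T\to\infty$ of the sum over $|\gamma|<T$).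
   Context: $\Lambda$ is the von Mangoldt function: $\Lambda(n)=\log p$ if $n=p^k$ with $p$ prime and $k\ge1$, and $\Lambda(n)=0$ otherwise.
   Formalization: The series over the trivial zeros can diverge when ax<1 (e.g. g decreasing, bx<1), so the formula is proved for those x>1 for which that series converges; its convergence is proved whenever ax≥1. *)

theory Defs
  imports "HOL-Complex_Analysis.Complex_Analysis" "HOL-Number_Theory.Number_Theory"
begin

text \<open>
  The meromorphic function on the whole plane that extends \<open>h\<close> from \<open>U\<close>. Requiring \<open>H\<close> to be
  nicely meromorphic removes all removable singularities and fixes the value at poles to be \<open>0\<close>,
  so that there is at most one such \<open>H\<close> when \<open>U\<close> is open and nonempty
  (lemma \<open>meromorphic_continuation_unique\<close> below).
\<close>

definition is_meromorphic_continuation ::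
    "(complex \<Rightarrow> complex) \<Rightarrow> (complex \<Rightarrow> complex) \<Rightarrow> complex set \<Rightarrow> bool" where
  "is_meromorphic_continuation H h U \<longleftrightarrow> H nicely_meromorphic_on UNIV \<and> (\<forall>s\<in>U. H s = h s)"

definition meromorphic_continuation ::
    "(complex \<Rightarrow> complex) \<Rightarrow> complex set \<Rightarrow> complex \<Rightarrow> complex" where
  "meromorphic_continuation h U = (THE H. is_meromorphic_continuation H h U)"

lemma meromorphic_continuation_unique:
  assumes "is_meromorphic_continuation G h U" "is_meromorphic_continuation H h U"
    and "open U" "U \<noteq> {}"
  shows "G = H"
proof -
  have GH: "G nicely_meromorphic_on UNIV" "H nicely_meromorphic_on UNIV"
    and eqU: "\<And>s. s \<in> U \<Longrightarrow> G s = H s"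
    using assms by (auto simp: is_meromorphic_continuation_def)
  have mero: "G meromorphic_on UNIV" "H meromorphic_on UNIV"
    using GH by (auto simp: nicely_meromorphic_on_def)
  obtain z0 where z0: "z0 \<in> U" using assms by auto
  define D where "D = remove_sings (\<lambda>s. G s - H s)"
  have mD: "(\<lambda>s. G s - H s) meromorphic_on UNIV"
    using mero by (intro meromorphic_intros)
  hence nD: "D nicely_meromorphic_on UNIV"
    unfolding D_def by (rule remove_sings_nicely_meromorphic)
  have ev_D: "\<forall>\<^sub>F s in at z. D s = G s - H s" for z
    unfolding D_def
    by (rule eventually_remove_sings_eq_at)
       (use mD meromorphic_at_iff meromorphic_on_subset in blast)
  have "\<forall>\<^sub>F s in at z0. s \<in> U"
    using assms(3) z0 by (simp add: eventually_at_in_open')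
  hence "\<forall>\<^sub>F s in at z0. G s - H s = 0"
    by eventually_elim (simp add: eqU)
  moreover have "\<forall>\<^sub>F s in at z0. D s = G s - H s"
    by (rule ev_D)
  ultimately have "\<forall>\<^sub>F s in at z0. D s = 0"
    by eventually_elim simp
  hence freq: "\<exists>\<^sub>F s in at z0. D s = 0"
    by (intro eventually_frequently) auto
  have D0: "D s = 0" for s
    using nicely_meromorphic_imp_constant_or_avoid[OF nD open_UNIV connected_UNIV, of 0]
  proof
    assume "\<forall>\<^sub>\<approx>z\<in>UNIV. D z \<noteq> 0"
    hence "\<forall>\<^sub>F z in at z0. D z \<noteq> 0"
      by (simp add: eventually_cosparse_open_eq)
    thus ?thesis using freq by (simp add: frequently_def)
  qed auto
  show ?thesis
  proof
    fix s
    have "\<forall>\<^sub>F w in at s. D w = G w - H w"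
      by (rule ev_D)
    hence ev: "\<forall>\<^sub>F w in at s. G w = H w"
      by eventually_elim (simp add: D0)
    hence poles: "is_pole G s \<longleftrightarrow> is_pole H s"
      by (intro is_pole_cong) auto
    show "G s = H s"
    proof (cases "is_pole G s")
      case True
      hence "\<not> G \<midarrow>s\<rightarrow> G s" "\<not> H \<midarrow>s\<rightarrow> H s"
        using poles not_tendsto_and_filterlim_at_infinity[OF at_neq_bot] 
        unfolding is_pole_def by blast+
      hence "G s = 0" "H s = 0"
        using GH unfolding nicely_meromorphic_on_def by blast+
      thus ?thesis by simp
    next
      case False
      hence "G \<midarrow>s\<rightarrow> G s" "H \<midarrow>s\<rightarrow> H s"
        using GH poles by (auto simp: nicely_meromorphic_on_def)
      moreover have "H \<midarrow>s\<rightarrow> G s"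
        using \<open>G \<midarrow>s\<rightarrow> G s\<close> ev tendsto_cong by blast
      ultimately show ?thesis
        using LIM_unique by blast
    qed
  qed
qed

definition riemann_zeta :: "complex \<Rightarrow> complex" where
  "riemann_zeta =
     meromorphic_continuation (\<lambda>s. \<Sum>n. 1 / of_nat (Suc n) powr s) {s. 1 < Re s}"

text \<open>
  The point \<open>1\<close> has to be excluded explicitly, because the value of \<open>riemann_zeta\<close>
  at its pole is \<open>0\<close> by convention.
\<close>

definition nontrivial_zeta_zeros :: "complex set" where
  "nontrivial_zeta_zeros =
     {\<rho>. riemann_zeta \<rho> = 0 \<and> \<rho> \<noteq> 1 \<and> (\<forall>n\<ge>1. \<rho> \<noteq> - 2 * of_nat n)}"

definition mellin_integral :: "(real \<Rightarrow> real) \<Rightarrow> complex \<Rightarrow> complex" where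
  "mellin_integral f s =
     set_lebesgue_integral lborel {0<..}
       (\<lambda>t. complex_of_real (f t) * complex_of_real t powr (s - 1))"

text \<open>
  Continued from the half-plane \<open>Re s > 0\<close>, which is where the integral converges when \<open>f\<close> is
  bounded and measurable with bounded support.
\<close>

definition mellin_transform :: "(real \<Rightarrow> real) \<Rightarrow> complex \<Rightarrow> complex" where
  "mellin_transform f = meromorphic_continuation (mellin_integral f) {s. 0 < Re s}"

definition smoothed_chebyshev :: "(real \<Rightarrow> real) \<Rightarrow> real \<Rightarrow> real" where
  "smoothed_chebyshev f x = (\<Sum>n. mangoldt (Suc n) * f (real (Suc n) / x))"

text \<open>Zeros are counted with multiplicity.\<close>

definition zeta_zero_sum :: "(complex \<Rightarrow> complex) \<Rightarrow> real \<Rightarrow> real \<Rightarrow> complex" where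
  "zeta_zero_sum F x T =
     (\<Sum>\<rho> | \<rho> \<in> nontrivial_zeta_zeros \<and> \<bar>Im \<rho>\<bar> < T.
        of_int (zorder riemann_zeta \<rho>) * (complex_of_real x powr \<rho> * F \<rho>))"

definition trivial_zero_term :: "(complex \<Rightarrow> complex) \<Rightarrow> real \<Rightarrow> nat \<Rightarrow> complex" where
  "trivial_zero_term F x n = complex_of_real x powr (- 2 * of_nat n) * F (- 2 * of_nat n)"

text \<open>
  \<open>G k\<close> is the \<open>k\<close>-th derivative of \<open>g\<close> on \<open>[0,1]\<close>, where the derivatives at the two endpoints
  are one-sided.
\<close>

definition derivatives_upto :: "nat \<Rightarrow> (real \<Rightarrow> real) \<Rightarrow> (nat \<Rightarrow> real \<Rightarrow> real) \<Rightarrow> bool" where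
  "derivatives_upto m g G \<longleftrightarrow>
     G 0 = g \<and>
     (\<forall>k<m. \<forall>y\<in>{0..1}. (G k has_real_derivative G (Suc k) y) (at y within {0..1}))"

end

theory Submission
  imports Defs "HOL-Real_Asymp.Real_Asymp"
begin

text \<open>
  No contour is shifted. The function \<open>(s - 1) \<zeta>(s)\<close> is entire of order one, so
  Borel--Caratheodory applied after dividing out the zeros in a large disc gives the partial
  fraction expansion of \<open>\<zeta>'/\<zeta>\<close> over all zeros, trivial ones included. Divided by \<open>s (s + 1)\<close>, both
  sides are moments (at integers \<open>s\<close>) of continuous functions: on one side
  \<open>\<psi>\<^sub>1(y) = \<Sum> \<Lambda>(n) max 0 (y - n)\<close>, on the other the absolutely convergent sum of the
  \<open>(y powr (\<rho> + 1) - 1) / (\<rho> (\<rho> + 1))\<close>. Moments determine a continuous function, which is the explicit formula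
  for \<open>\<psi>\<^sub>1\<close>. Integrating it against \<open>f''(y/x)\<close> gives the result provided \<open>f' = 0\<close> on \<open>[0, 1/x]\<close>. If \<open>a x < 1\<close>,
  boundedness of the terms of the trivial zeros, which are moments of \<open>f'\<close>, forces exactly this.
\<close>

subsection \<open>Moments and termwise integration\<close>

text \<open>Everything is tuned to a crude growth bound. The Gamma factor makes
  \<open>entire_zeta\<close> as large as exp (C R ln R), and the exponent 3/2 stands for any number
  strictly between 1 and 2: above 1 it absorbs the logarithm, below 2 it makes the sum of
  |\<rho>|^-2 converge and the error of the partial fractions vanish. That sum is also why
  \<open>\<psi>\<^sub>1\<close> is treated instead of \<psi>: its weights 1 / (\<rho> (\<rho> + 1))
  are absolutely summable, at the price of two derivatives of f, which m >= 2 provides. For m = 2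
  the second derivative may be discontinuous, so its integrals come from the fundamental theorem of
  calculus for the gauge integral.

  The obstacle is y < 1, where y powr (\<rho> + 1) grows exponentially along the trivial zeros and
  the formula for \<open>\<psi>\<^sub>1\<close> breaks down. With y = x t this is the range t < 1 /
  x, and f' has to vanish there.

  A single lemma on moments, \<open>moments_vanish\<close>, gives both the uniqueness that yields
  the formula for \<open>\<psi>\<^sub>1\<close> and the vanishing of f' when a x < 1.\<close>

lemma moments_exp_series:
  fixes w :: "real \<Rightarrow> complex" and x :: "real \<Rightarrow> real"
  assumes w: "continuous_on {\<alpha>..\<beta>} w" and x: "continuous_on {\<alpha>..\<beta>} x"
  shows "(\<lambda>k. integral {\<alpha>..\<beta>} (\<lambda>t. w t * of_real (x t ^ k)) * ((-1) ^ k / fact k)) sums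
    integral {\<alpha>..\<beta>} (\<lambda>t. w t * of_real (exp (- x t)))"
proof -
  have "bounded (x ` {\<alpha>..\<beta>})" "bounded (w ` {\<alpha>..\<beta>})"
    using x w by (auto intro!: compact_imp_bounded compact_continuous_image)
  then obtain B K where BK: "\<forall>y\<in>x ` {\<alpha>..\<beta>}. norm y \<le> B" "\<forall>y\<in>w ` {\<alpha>..\<beta>}. norm y \<le> K"
    unfolding bounded_iff by blast
  have B: "\<bar>x t\<bar> \<le> B" and K: "norm (w t) \<le> K" if "t \<in> {\<alpha>..\<beta>}" for t
    using BK that by auto
  define e where "e = (\<lambda>k t. w t * of_real (x t ^ k) * ((-1) ^ k / fact k))"
  have e_le: "norm (e k t) \<le> K * (inverse (fact k) * B ^ k)" if "t \<in> {\<alpha>..\<beta>}" for k t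
  proof -
    have "\<bar>x t\<bar> ^ k \<le> B ^ k" using B[OF that] by (intro power_mono) auto
    hence "norm (w t) * (\<bar>x t\<bar> ^ k / fact k) \<le> K * (B ^ k / fact k)"
      using K[OF that] by (intro mult_mono divide_right_mono) (auto intro: order.trans[OF norm_ge_zero])
    thus ?thesis by (simp add: e_def norm_mult norm_divide norm_power power_abs field_simps)
  qed
  have "uniform_limit {\<alpha>..\<beta>} (\<lambda>n t. \<Sum>k<n. e k t) (\<lambda>t. \<Sum>k. e k t) sequentially"
    by (rule Weierstrass_m_test[OF e_le]) (auto intro!: summable_mult summable_exp)
  moreover have "continuous_on {\<alpha>..\<beta>} (\<lambda>t. \<Sum>k<n. e k t)" for n
    unfolding e_def by (intro continuous_intros w x)
  ultimately obtain I J where IJ: "\<And>n. ((\<lambda>t. \<Sum>k<n. e k t) has_integral I n) {\<alpha>..\<beta>}"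
     "((\<lambda>t. \<Sum>k. e k t) has_integral J) {\<alpha>..\<beta>}" "I \<longlonglongrightarrow> J"
    by (rule uniform_limit_integral) auto
  have int: "(\<lambda>t. w t * of_real (x t ^ k)) integrable_on {\<alpha>..\<beta>}" for k
    by (intro integrable_continuous_interval continuous_intros w x)
  have "I n = (\<Sum>k<n. integral {\<alpha>..\<beta>} (\<lambda>t. w t * of_real (x t ^ k)) * ((-1) ^ k / fact k))" for n
  proof -
    have "I n = integral {\<alpha>..\<beta>} (\<lambda>t. \<Sum>k<n. e k t)" by (rule integral_unique[OF IJ(1), symmetric])
    also have "\<dots> = (\<Sum>k<n. integral {\<alpha>..\<beta>} (e k))"
      unfolding e_def by (intro integral_sum integrable_on_mult_left int) auto
    finally show ?thesis unfolding e_def by (simp only: integral_mult_left)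
  qed
  hence "I = (\<lambda>n. \<Sum>k<n. integral {\<alpha>..\<beta>} (\<lambda>t. w t * of_real (x t ^ k)) * ((-1) ^ k / fact k))" by blast
  with IJ(3) have "(\<lambda>k. integral {\<alpha>..\<beta>} (\<lambda>t. w t * of_real (x t ^ k)) * ((-1) ^ k / fact k)) sums J"
    unfolding sums_def by simp
  also have "J = integral {\<alpha>..\<beta>} (\<lambda>t. \<Sum>k. e k t)" using IJ(2) by (simp add: integral_unique)
  also have "(\<lambda>t. \<Sum>k. e k t) = (\<lambda>t. w t * of_real (exp (- x t)))"
  proof
    fix t
    have es: "(\<lambda>k. w t * ((- of_real (x t)) ^ k /\<^sub>R fact k)) sums (w t * exp (- of_real (x t)))"
      by (intro sums_mult exp_converges)
    have "e k t = w t * ((- of_real (x t)) ^ k /\<^sub>R fact k)" for k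
      by (simp add: e_def scaleR_conv_of_real power_minus[of "of_real _"] field_simps)
    with es show "(\<Sum>k. e k t) = w t * of_real (exp (- x t))"
      by (simp add: sums_iff exp_of_real[symmetric])
  qed
  finally show ?thesis .
qed

text \<open>As n grows, 1 - exp (-(v / c)^n) tends to the indicator of v > c, and it is constantly 1
  - 1/e where v = c. Expanding the exponential expresses its integral against w through the moments
  of order n, 2n, 3n, ..., which are of size n k q^(n k) with q = \<sigma> / c < 1, so the integral
  tends to 0. With \<sigma> = 0 this shows that moments determine a function; with \<sigma> = 1 it
  shows that moments of linear growth leave integral 0 over v > c for c > 1, up to the level set v =
  c.\<close>

lemma moments_vanish:
  fixes w :: "real \<Rightarrow> complex" and v :: "real \<Rightarrow> real" and \<sigma> c M :: real
  assumes w: "continuous_on {\<alpha>..\<beta>} w" and v: "continuous_on {\<alpha>..\<beta>} v"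
    and v0: "\<And>t. t \<in> {\<alpha>..\<beta>} \<Longrightarrow> v t \<ge> 0" and c: "0 \<le> \<sigma>" "\<sigma> < c"
    and M: "\<And>n. n \<ge> 1 \<Longrightarrow> norm (integral {\<alpha>..\<beta>} (\<lambda>t. w t * of_real (v t ^ n))) \<le> M * n * \<sigma> ^ n"
  shows "integral {\<alpha>..\<beta>} (\<lambda>t. w t * of_real (if v t > c then 1 else if v t = c then 1 - exp (-1) else 0)) = 0"
proof -
  define q where "q = \<sigma> / c"
  have q: "0 \<le> q" "q < 1" using c by (auto simp: q_def)
  \<comment> \<open>If \<sigma> = 0, the hypothesis says nothing about the sign of M. Only M * q is
    known to be nonnegative, so one factor q is kept next to M in the estimates below.\<close>
  have M0: "M * q \<ge> 0"
  proof -
    have "0 \<le> M * \<sigma>" using order.trans[OF norm_ge_zero M[of 1]] by simp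
    hence "0 \<le> M * \<sigma> / c" using c by (intro divide_nonneg_pos) auto
    thus ?thesis by (simp add: q_def)
  qed
  define I where "I = (\<lambda>n. integral {\<alpha>..\<beta>} (\<lambda>t. w t * of_real (1 - exp (- ((v t / c) ^ n)))))"
  have bound: "norm (I n) \<le> M * n * q ^ n * exp 1" if n: "n \<ge> 1" for n
  proof -
    define m where "m = (\<lambda>k. integral {\<alpha>..\<beta>} (\<lambda>t. w t * of_real (((v t / c) ^ n) ^ k)))"
    have cx: "continuous_on {\<alpha>..\<beta>} (\<lambda>t. (v t / c) ^ n)" using c by (intro continuous_intros v) auto
    have sums: "(\<lambda>k. m k * ((-1) ^ k / fact k)) sums integral {\<alpha>..\<beta>} (\<lambda>t. w t * of_real (exp (- ((v t / c) ^ n))))"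
      unfolding m_def by (rule moments_exp_series[OF w cx])
    \<comment> \<open>The zeroth moment, for which there is no bound, cancels because 1 - exp (-u)
      has no constant term.\<close>
    have "(\<lambda>k. m (Suc k) * ((-1) ^ Suc k / fact (Suc k))) sums
        (integral {\<alpha>..\<beta>} (\<lambda>t. w t * of_real (exp (- ((v t / c) ^ n)))) - m 0)"
      using sums by (subst sums_Suc_iff) simp
    moreover have "I n = m 0 - integral {\<alpha>..\<beta>} (\<lambda>t. w t * of_real (exp (- ((v t / c) ^ n))))"
      unfolding I_def m_def
      by (subst integral_diff[symmetric])
         (use c in \<open>auto intro!: integrable_continuous_interval continuous_intros w v simp: algebra_simps\<close>)
    ultimately have s: "(\<lambda>k. m (Suc k) * ((-1) ^ Suc k / fact (Suc k))) sums (- I n)" by simp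
    have mk: "norm (m k) \<le> M * real (n * k) * q ^ (n * k)" if "k \<ge> 1" for k
    proof -
      have "m k = integral {\<alpha>..\<beta>} (\<lambda>t. w t * of_real (v t ^ (n * k)) * of_real (1 / c ^ (n * k)))"
        unfolding m_def by (simp add: power_divide power_mult[symmetric])
      also have "\<dots> = integral {\<alpha>..\<beta>} (\<lambda>t. w t * of_real (v t ^ (n * k))) * of_real (1 / c ^ (n * k))"
        by (rule integral_mult_left)
      also have "norm \<dots> = norm (integral {\<alpha>..\<beta>} (\<lambda>t. w t * of_real (v t ^ (n * k)))) / c ^ (n * k)"
        using c by (simp add: norm_mult norm_divide norm_power)
      also have "\<dots> \<le> (M * real (n * k) * \<sigma> ^ (n * k)) / c ^ (n * k)"
        using c n that by (intro divide_right_mono M) auto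
      finally show ?thesis by (simp add: q_def power_divide)
    qed
    \<comment> \<open>The factor \<open>Suc k\<close> of the moment bound turns
      \<open>fact (Suc k)\<close> into \<open>fact k\<close>, and q^(n (k + 1)) is at most q^n; what
      remains is n q^n times the exponential series at 1.\<close>
    have e: "norm (m (Suc k) * ((-1) ^ Suc k / fact (Suc k))) \<le> M * n * q ^ n * (1 ^ k /\<^sub>R fact k)" for k
    proof -
      have "norm (m (Suc k) * ((-1) ^ Suc k / fact (Suc k))) = norm (m (Suc k)) / fact (Suc k)"
        by (simp add: norm_mult norm_divide norm_power del: fact_Suc power_Suc)
      also have "\<dots> \<le> (M * real (n * Suc k) * q ^ (n * Suc k)) / fact (Suc k)"
        by (intro divide_right_mono mk) auto
      also have "q ^ (n * Suc k) = q * q ^ (n * Suc k - 1)"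
        using n by (simp add: power_Suc[symmetric] del: power_Suc)
      also have "(M * real (n * Suc k) * (q * q ^ (n * Suc k - 1))) / fact (Suc k) = (M * q) * (n / fact k) * q ^ (n * Suc k - 1)"
        by (simp add: divide_simps) (simp add: algebra_simps)
      also have "\<dots> \<le> (M * q) * (n / fact k) * q ^ (n - 1)"
        using q by (intro mult_left_mono power_decreasing mult_nonneg_nonneg[OF M0]) auto
      also have "\<dots> = M * n * (q * q ^ (n - 1)) * (1 ^ k /\<^sub>R fact k)" by (simp add: field_simps)
      also have "q * q ^ (n - 1) = q ^ n" using n by (cases n) auto
      finally show ?thesis .
    qed
    have "norm (I n) = norm (\<Sum>k. m (Suc k) * ((-1) ^ Suc k / fact (Suc k)))"
      using s by (simp add: sums_iff del: fact_Suc power_Suc)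
    also have "\<dots> \<le> (\<Sum>k. M * n * q ^ n * (1 ^ k /\<^sub>R fact k))"
      by (rule norm_suminf_le[OF e], rule summable_mult) (use exp_converges[of "1::real"] in \<open>auto simp: sums_iff\<close>)
    also have "\<dots> = M * n * q ^ n * exp 1"
      by (subst suminf_mult) (use exp_converges[of "1::real"] in \<open>auto simp: sums_iff\<close>)
    finally show ?thesis .
  qed
  have "I \<longlonglongrightarrow> 0"
  proof (rule Lim_null_comparison)
    show "eventually (\<lambda>n. norm (I n) \<le> M * n * q ^ n * exp 1) sequentially"
      using eventually_ge_at_top[of 1] by eventually_elim (rule bound)
    have "(\<lambda>n. real n * q ^ n) \<longlonglongrightarrow> 0" using q by (intro powser_times_n_limit_0) auto
    from tendsto_mult[OF tendsto_const[of "M * exp 1"] this]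
    show "(\<lambda>n. M * real n * q ^ n * exp 1) \<longlonglongrightarrow> 0" by (simp add: mult_ac)
  qed
  moreover have "I \<longlonglongrightarrow> integral {\<alpha>..\<beta>} (\<lambda>t. w t * of_real (if v t > c then 1 else if v t = c then 1 - exp (-1) else 0))"
    unfolding I_def
  proof (rule dominated_convergence(2))
    show "(\<lambda>t. w t * of_real (1 - exp (- ((v t / c) ^ n)))) integrable_on {\<alpha>..\<beta>}" for n
      using c by (intro integrable_continuous_interval continuous_intros w v) auto
    show "(\<lambda>t. norm (w t)) integrable_on {\<alpha>..\<beta>}"
      by (intro integrable_continuous_interval continuous_intros w)
    show "norm (w t * of_real (1 - exp (- ((v t / c) ^ n)))) \<le> norm (w t)" if "t \<in> {\<alpha>..\<beta>}" for n t
    proof -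
      have "0 \<le> (v t / c) ^ n" using v0[OF that] c by (intro zero_le_power divide_nonneg_pos) auto
      hence "norm (of_real (1 - exp (- ((v t / c) ^ n))) :: complex) \<le> 1"
        unfolding norm_of_real by auto
      thus ?thesis by (simp add: norm_mult mult_left_le)
    qed
    show "(\<lambda>n. w t * of_real (1 - exp (- ((v t / c) ^ n)))) \<longlonglongrightarrow>
        w t * of_real (if v t > c then 1 else if v t = c then 1 - exp (-1) else 0)" if t: "t \<in> {\<alpha>..\<beta>}" for t
    proof (intro tendsto_intros)
      define y where "y = v t / c"
      have "(\<lambda>n. 1 - exp (- (y ^ n))) \<longlonglongrightarrow> (if y > 1 then 1 else if y = 1 then 1 - exp (-1) else 0)"
      proof -
        consider "y > 1" | "y = 1" | "0 \<le> y" "y < 1" using v0[OF t] c by (fastforce simp: y_def)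
        thus ?thesis
        proof cases
          case 1
          hence "filterlim (\<lambda>n. y ^ n) at_infinity sequentially" by (intro filterlim_realpow_sequentially_gt1) auto
          hence "filterlim (\<lambda>n. y ^ n) at_top sequentially"
            by (rule filterlim_at_infinity_imp_filterlim_at_top) (use 1 in auto)
          hence "(\<lambda>n. exp (- (y ^ n))) \<longlonglongrightarrow> 0"
            by (intro filterlim_compose[OF exp_at_bot] filterlim_compose[OF filterlim_uminus_at_bot_at_top])
          from tendsto_diff[OF tendsto_const[of 1] this] 1 show ?thesis by simp
        next
          case 3
          hence "(\<lambda>n. 1 - exp (- (y ^ n))) \<longlonglongrightarrow> 1 - exp (- 0)"
            by (intro tendsto_intros LIMSEQ_realpow_zero) auto
          with 3 show ?thesis by simp
        qed simp
      qed
      moreover have "y > 1 \<longleftrightarrow> v t > c" "y = 1 \<longleftrightarrow> v t = c" using c by (auto simp: y_def field_simps)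
      ultimately show "(\<lambda>n. 1 - exp (- ((v t / c) ^ n))) \<longlonglongrightarrow> (if v t > c then 1 else if v t = c then 1 - exp (-1) else 0)"
        by (simp only: y_def[symmetric])
    qed
  qed
  ultimately show ?thesis by (intro LIMSEQ_unique)
qed

section \<open>Unordered sums of functions: continuity and termwise integration\<close>

lemma continuous_on_infsum:
  fixes e :: "'i \<Rightarrow> real \<Rightarrow> complex"
  assumes "\<And>i. i \<in> X \<Longrightarrow> continuous_on S (e i)"
    and "\<And>i t. i \<in> X \<Longrightarrow> t \<in> S \<Longrightarrow> norm (e i t) \<le> B i" and "B summable_on X"
  shows "continuous_on S (\<lambda>t. \<Sum>\<^sub>\<infinity>i\<in>X. e i t)"
proof (rule uniform_limit_theorem[OF _ Weierstrass_m_test_general[OF assms(2,3)]])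
  show "\<forall>\<^sub>F Y in finite_subsets_at_top X. continuous_on S (\<lambda>t. \<Sum>i\<in>Y. e i t)"
    by (intro eventually_finite_subsets_at_top_weakI continuous_on_sum assms(1)) auto
qed auto

text \<open>The weight w will be f'', a bounded derivative that may be discontinuous. Integrability
  is therefore assumed for each product only, and it passes to the sum by uniform
  convergence.\<close>

lemma has_sum_integral:
  fixes e :: "'i \<Rightarrow> real \<Rightarrow> complex" and w :: "real \<Rightarrow> complex"
  assumes "\<alpha> \<le> \<beta>" and int: "\<And>i. i \<in> X \<Longrightarrow> (\<lambda>t. w t * e i t) integrable_on {\<alpha>..\<beta>}"
    and e: "\<And>i t. i \<in> X \<Longrightarrow> t \<in> {\<alpha>..\<beta>} \<Longrightarrow> norm (e i t) \<le> B i" and B: "B summable_on X"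
    and K: "\<And>t. t \<in> {\<alpha>..\<beta>} \<Longrightarrow> norm (w t) \<le> K"
  shows "(\<lambda>t. w t * (\<Sum>\<^sub>\<infinity>i\<in>X. e i t)) integrable_on {\<alpha>..\<beta>}"
    "((\<lambda>i. integral {\<alpha>..\<beta>} (\<lambda>t. w t * e i t)) has_sum
        integral {\<alpha>..\<beta>} (\<lambda>t. w t * (\<Sum>\<^sub>\<infinity>i\<in>X. e i t))) X"
proof -
  let ?s = "\<lambda>t. \<Sum>\<^sub>\<infinity>i\<in>X. e i t"
  have K0: "K \<ge> 0" using order.trans[OF norm_ge_zero K[of \<alpha>]] assms(1) by auto
  have ul: "uniform_limit {\<alpha>..\<beta>} (\<lambda>Y t. \<Sum>i\<in>Y. e i t) ?s (finite_subsets_at_top X)"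
    using e B by (rule Weierstrass_m_test_general)
  have ev: "eventually (\<lambda>Y. finite Y \<and> Y \<subseteq> X \<and> (\<forall>t\<in>{\<alpha>..\<beta>}. norm (w t * (\<Sum>i\<in>Y. e i t) - w t * ?s t) \<le> \<epsilon>))
      (finite_subsets_at_top X)" if \<epsilon>: "\<epsilon> > 0" for \<epsilon>
  proof -
    have "\<epsilon> / (K + 1) > 0" using \<epsilon> K0 by simp
    from uniform_limitD[OF ul this]
    have "eventually (\<lambda>Y. \<forall>t\<in>{\<alpha>..\<beta>}. dist (\<Sum>i\<in>Y. e i t) (?s t) < \<epsilon> / (K + 1)) (finite_subsets_at_top X)" .
    moreover have "eventually (\<lambda>Y. finite Y \<and> Y \<subseteq> X) (finite_subsets_at_top X)"
      by (simp add: eventually_finite_subsets_at_top_weakI)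
    ultimately show ?thesis
    proof eventually_elim
      case (elim Y)
      have "norm (w t * (\<Sum>i\<in>Y. e i t) - w t * ?s t) \<le> \<epsilon>" if t: "t \<in> {\<alpha>..\<beta>}" for t
      proof -
        have "norm (w t * (\<Sum>i\<in>Y. e i t) - w t * ?s t) = norm (w t) * dist (\<Sum>i\<in>Y. e i t) (?s t)"
          by (simp add: right_diff_distrib[symmetric] norm_mult dist_norm)
        also have "\<dots> \<le> (K + 1) * (\<epsilon> / (K + 1))"
          using K[OF t] K0 elim(1) t by (intro mult_mono) (auto intro: less_imp_le)
        finally show ?thesis using K0 by simp
      qed
      thus ?case using elim by auto
    qed
  qed
  have intY: "(\<lambda>t. w t * (\<Sum>i\<in>Y. e i t)) integrable_on {\<alpha>..\<beta>}" if "finite Y" "Y \<subseteq> X" for Y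
    unfolding sum_distrib_left using that by (intro integrable_sum int) auto
  show intl: "(\<lambda>t. w t * ?s t) integrable_on {\<alpha>..\<beta>}"
    unfolding cbox_interval[symmetric]
  proof (rule integrable_uniform_limit)
    fix \<epsilon> :: real assume "\<epsilon> > 0"
    from eventually_happens'[OF finite_subsets_at_top_neq_bot ev[OF this]] obtain Y where
      "finite Y" "Y \<subseteq> X" "\<forall>t\<in>{\<alpha>..\<beta>}. norm (w t * (\<Sum>i\<in>Y. e i t) - w t * ?s t) \<le> \<epsilon>" by blast
    thus "\<exists>g. (\<forall>x\<in>cbox \<alpha> \<beta>. norm (w x * ?s x - g x) \<le> \<epsilon>) \<and> g integrable_on cbox \<alpha> \<beta>"
      using intY[of Y] by (intro exI[of _ "\<lambda>t. w t * (\<Sum>i\<in>Y. e i t)"]) (auto simp: norm_minus_commute)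
  qed
  show "((\<lambda>i. integral {\<alpha>..\<beta>} (\<lambda>t. w t * e i t)) has_sum integral {\<alpha>..\<beta>} (\<lambda>t. w t * ?s t)) X"
    unfolding has_sum_def tendsto_iff
  proof (intro allI impI)
    fix \<epsilon> :: real assume \<epsilon>: "\<epsilon> > 0"
    define \<delta> where "\<delta> = \<epsilon> / (\<beta> - \<alpha> + 1)"
    have \<delta>: "\<delta> > 0" using \<epsilon> assms(1) by (simp add: \<delta>_def)
    show "eventually (\<lambda>Y. dist (\<Sum>i\<in>Y. integral {\<alpha>..\<beta>} (\<lambda>t. w t * e i t)) (integral {\<alpha>..\<beta>} (\<lambda>t. w t * ?s t)) < \<epsilon>)
       (finite_subsets_at_top X)"
      using ev[OF \<delta>]
    proof eventually_elim
      case (elim Y)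
      have "(\<Sum>i\<in>Y. integral {\<alpha>..\<beta>} (\<lambda>t. w t * e i t)) = integral {\<alpha>..\<beta>} (\<lambda>t. w t * (\<Sum>i\<in>Y. e i t))"
        unfolding sum_distrib_left using elim by (intro integral_sum[symmetric] int) auto
      hence "dist (\<Sum>i\<in>Y. integral {\<alpha>..\<beta>} (\<lambda>t. w t * e i t)) (integral {\<alpha>..\<beta>} (\<lambda>t. w t * ?s t))
        = norm (integral {\<alpha>..\<beta>} (\<lambda>t. w t * (\<Sum>i\<in>Y. e i t) - w t * ?s t))"
        using elim by (subst integral_diff) (auto simp: dist_norm intro: intY intl)
      also have "\<dots> \<le> integral {\<alpha>..\<beta>} (\<lambda>t. \<delta>)"
        using elim by (intro integral_norm_bound_integral integrable_diff intY intl) auto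
      also have "\<dots> = \<delta> * (\<beta> - \<alpha>)" using assms(1) by simp
      also have "\<dots> < \<epsilon>" using \<epsilon> assms(1) by (simp add: \<delta>_def field_simps)
      finally show ?case .
    qed
  qed
qed

subsection \<open>The logarithmic derivative of an entire function\<close>

lemma ln_leI: "0 < (x::real) \<Longrightarrow> x \<le> exp y \<Longrightarrow> ln x \<le> y"
  by (metis exp_gt_zero ln_exp ln_le_cancel_iff)

text \<open>The map u -> u / (2 A - u) carries the half plane Re u < A into the unit disc and fixes
  0, so the Schwarz lemma applies to its composition with h, rescaled to the unit disc. Solving for
  h gives the bound.\<close>

lemma borel_caratheodory:
  fixes h :: "complex \<Rightarrow> complex"
  assumes holo: "h holomorphic_on ball 0 R" and h0: "h 0 = 0" and R: "R > 0" and A: "A > 0"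
    and le: "\<And>z. norm z < R \<Longrightarrow> Re (h z) < A" and z: "norm z < R"
  shows "norm (h z) \<le> 2 * norm z * A / (R - norm z)"
proof -
  define w where "w = (\<lambda>\<zeta>. h (of_real R * \<zeta>) / (of_real (2 * A) - h (of_real R * \<zeta>)))"
  have nR: "norm (of_real R * \<zeta> :: complex) < R" if "norm \<zeta> < 1" for \<zeta>
    using that R by (simp add: norm_mult)
  have ne: "of_real (2 * A) - h (of_real R * \<zeta>) \<noteq> 0" if "norm \<zeta> < 1" for \<zeta>
  proof
    assume "of_real (2 * A) - h (of_real R * \<zeta>) = 0"
    hence "h (of_real R * \<zeta>) = of_real (2 * A)" by simp
    with le[OF nR[OF that]] A show False by simp
  qed
  have comp: "(\<lambda>\<zeta>. h (of_real R * \<zeta>)) holomorphic_on ball 0 1"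
    by (rule holomorphic_on_compose_gen[of _ _ h "ball 0 R", unfolded o_def])
       (use holo nR in \<open>auto intro!: holomorphic_intros\<close>)
  have w_holo: "w holomorphic_on ball 0 1"
    unfolding w_def using ne by (intro holomorphic_intros comp) auto
  have w0: "w 0 = 0" by (simp add: w_def h0)
  have w1: "norm (w \<zeta>) < 1" if "norm \<zeta> < 1" for \<zeta>
  proof -
    define u where "u = h (of_real R * \<zeta>)"
    have "Re u < A" using le[OF nR[OF that]] by (simp add: u_def)
    have "(norm u)\<^sup>2 < (norm (of_real (2 * A) - u))\<^sup>2"
      unfolding cmod_power2 using \<open>Re u < A\<close> A by (simp add: power2_eq_square algebra_simps)
    hence "norm u < norm (of_real (2 * A) - u)" by (rule power_less_imp_less_base) auto
    thus ?thesis using ne[OF that] by (simp add: w_def u_def[symmetric] norm_divide divide_less_eq)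
  qed
  define \<zeta> where "\<zeta> = z / of_real R"
  have \<zeta>: "norm \<zeta> < 1" "norm \<zeta> = norm z / R" using z R by (auto simp: \<zeta>_def norm_divide)
  have wz: "norm (w \<zeta>) \<le> norm \<zeta>" by (rule Schwarz_Lemma(1)[OF w_holo w0 w1 \<zeta>(1)])
  have hz: "of_real R * \<zeta> = z" using R by (simp add: \<zeta>_def)
  have eq: "h z * (1 + w \<zeta>) = of_real (2 * A) * w \<zeta>"
    using ne[OF \<zeta>(1)] unfolding w_def hz by (simp add: field_simps)
  have "norm (h z) * (1 - norm \<zeta>) \<le> norm (h z) * norm (1 + w \<zeta>)"
    using wz norm_triangle_ineq2[of 1 "- w \<zeta>"] by (intro mult_left_mono) auto
  also have "\<dots> = 2 * A * norm (w \<zeta>)" 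
    using arg_cong[OF eq, of norm] A by (simp add: norm_mult)
  also have "\<dots> \<le> 2 * A * norm \<zeta>" using A wz by (intro mult_left_mono) auto
  finally have "norm (h z) * (1 - norm z / R) \<le> 2 * A * (norm z / R)" unfolding \<zeta>(2) .
  hence "R * (norm (h z) * (1 - norm z / R)) \<le> R * (2 * A * (norm z / R))"
    using R by (intro mult_left_mono) auto
  hence "norm (h z) * (R - norm z) \<le> 2 * norm z * A"
    using R by (simp add: algebra_simps)
  thus ?thesis using z by (simp add: pos_le_divide_eq)
qed

section \<open>Dividing out zeros\<close>

text \<open>The factor is normalised to 1 - z / q, so that dividing out zeros leaves the value at 0
  unchanged. If q is no zero of g, the exponent is 0 and h agrees with g.\<close>

lemma factor_out_zero:
  fixes g :: "complex \<Rightarrow> complex"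
  assumes holo: "g holomorphic_on UNIV" and nz: "g z0 \<noteq> 0" and q: "q \<noteq> 0"
  obtains h where "h holomorphic_on UNIV" "h q \<noteq> 0"
    "\<And>z. g z = h z * (1 - z / q) ^ nat (zorder g q)"
proof -
  define n where "n = nat (zorder g q)"
  obtain r where r: "r > 0" "zor_poly g q holomorphic_on cball q r"
    "\<forall>w\<in>cball q r. g w = zor_poly g q w * (w - q) ^ n \<and> zor_poly g q w \<noteq> 0"
    using zorder_exist_zero[OF holo, of q] nz by (auto simp: n_def)
  define h where "h = (\<lambda>z. if z = q then zor_poly g q z * (- q) ^ n else g z / (1 - z / q) ^ n)"
  have lin: "(z - q) = (1 - z / q) * (- q)" for z using q by (simp add: field_simps)
  have near: "h z = zor_poly g q z * (- q) ^ n" if "z \<in> ball q r" for z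
  proof (cases "z = q")
    case False
    hence "1 - z / q \<noteq> 0" using q by (auto simp: field_simps)
    moreover have "g z = zor_poly g q z * (z - q) ^ n" using r that by auto
    hence "g z = zor_poly g q z * (1 - z / q) ^ n * (- q) ^ n" 
      by (subst (asm) lin) (simp only: power_mult_distrib mult_ac)
    ultimately show ?thesis using False by (simp add: h_def)
  qed (simp add: h_def)
  have "h holomorphic_on ball q r \<union> (- {q})"
  proof (intro holomorphic_on_Un)
    have "(\<lambda>z. zor_poly g q z * (- q) ^ n) holomorphic_on ball q r"
      using r(2) by (intro holomorphic_intros) (auto intro: holomorphic_on_subset)
    thus "h holomorphic_on ball q r" using near by (subst holomorphic_cong[OF refl]) auto
    have "(\<lambda>z. g z / (1 - z / q) ^ n) holomorphic_on - {q}"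
      using q holo by (intro holomorphic_intros) (auto intro: holomorphic_on_subset simp: field_simps)
    thus "h holomorphic_on - {q}" by (subst holomorphic_cong[OF refl]) (auto simp: h_def)
  qed auto
  moreover have "ball q r \<union> (- {q}) = UNIV" using r(1) by auto
  ultimately have "h holomorphic_on UNIV" by simp
  moreover have "h q \<noteq> 0" using r q by (auto simp: h_def)
  moreover have "g z = h z * (1 - z / q) ^ n" for z
  proof (cases "z = q")
    case True
    have "g q = zor_poly g q q * (q - q) ^ n" using r by auto
    thus ?thesis using True q by (cases "n = 0") (auto simp: h_def)
  qed (use q in \<open>auto simp: h_def field_simps\<close>)
  ultimately show ?thesis using that unfolding n_def by blast
qed

lemma factor_out_zeros:
  fixes f :: "complex \<Rightarrow> complex"
  assumes holo: "f holomorphic_on UNIV" and f0: "f 0 \<noteq> 0" and "finite P" "0 \<notin> P"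
  shows "\<exists>g. g holomorphic_on UNIV \<and> (\<forall>q\<in>P. g q \<noteq> 0) \<and>
    (\<forall>z. f z = g z * (\<Prod>q\<in>P. (1 - z / q) ^ nat (zorder f q)))"
  using assms(3,4)
proof (induction P rule: finite_induct)
  case empty
  show ?case by (intro exI[of _ f]) (use holo in auto)
next
  case (insert q P)
  then obtain g where g: "g holomorphic_on UNIV" "\<forall>q\<in>P. g q \<noteq> 0"
    "\<And>z. f z = g z * (\<Prod>q\<in>P. (1 - z / q) ^ nat (zorder f q))" by auto
  have q0: "q \<noteq> 0" using insert by auto
  have g0: "g 0 \<noteq> 0" using f0 g(3)[of 0] by auto
  define p where "p = (\<lambda>z. \<Prod>q\<in>P. (1 - z / q) ^ nat (zorder f q))"
  have p_ana: "p analytic_on {q}" unfolding p_def using insert by (intro analytic_intros) auto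
  have pq: "p q \<noteq> 0" using insert unfolding p_def by auto
  have g_ana: "g analytic_on {q}" using g(1) by (auto simp: analytic_on_holomorphic)
  have f_ana: "f analytic_on {q}" using holo by (auto simp: analytic_on_holomorphic)
  have "eventually (\<lambda>z. f z \<noteq> 0) (at q)"
    using non_zero_neighbour_alt[OF holo open_UNIV connected_UNIV _ _ f0] by auto
  \<comment> \<open>The factors already removed do not vanish at q, so the order at q is still that
    of f.\<close>
  hence "zorder f q = zorder (\<lambda>z. g z * p z) q"
    using g(3) by (intro zorder_cong) (auto simp: p_def)
  also have "\<dots> = zorder g q + zorder p q"
    using \<open>eventually (\<lambda>z. f z \<noteq> 0) (at q)\<close>
    by (intro zorder_times_analytic g_ana p_ana) (simp add: g(3) p_def)
  also have "zorder p q = 0" by (rule zorder_eq_0I[OF p_ana pq])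
  finally have zo: "zorder f q = zorder g q" by simp
  obtain h where h: "h holomorphic_on UNIV" "h q \<noteq> 0"
    "\<And>z. g z = h z * (1 - z / q) ^ nat (zorder g q)"
    by (rule factor_out_zero[OF g(1) g0 q0]) blast
  have "h q' \<noteq> 0" if "q' \<in> P" for q' using g(2) h(3)[of q'] that by auto
  moreover have "f z = h z * (\<Prod>q\<in>insert q P. (1 - z / q) ^ nat (zorder f q))" for z
    using insert by (simp add: g(3)[of z] h(3)[of z] zo mult_ac)
  ultimately show ?case using h(1,2) by (intro exI[of _ h] conjI) blast+
qed

lemma finite_zeros_cball:
  fixes f :: "complex \<Rightarrow> complex"
  assumes holo: "f holomorphic_on UNIV" and f0: "f 0 \<noteq> 0"
  shows "finite {z. f z = 0 \<and> norm z \<le> r}"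
proof (cases "f constant_on UNIV")
  case True
  then obtain c where "\<And>z. f z = c" unfolding constant_on_def by blast
  with f0 show ?thesis by simp
next
  case False
  have "finite {z\<in>cball 0 r. f z = 0}"
    by (rule holomorphic_compact_finite_zeros[of f UNIV]) (use holo False in auto)
  moreover have "{z\<in>cball 0 r. f z = 0} = {z. f z = 0 \<and> norm z \<le> r}" by auto
  ultimately show ?thesis by simp
qed

text \<open>This replaces Jensen's formula. On |w| = 4 r a factor 1 - w / q has modulus at least 3
  if |q| <= r and at least 1 if |q| <= 2 r. So |g| <= M / 3^n there, n being the number of zeros in
  |q| <= r, and by the maximum principle also inside; at 0, where g = f, this bounds n.\<close>

lemma factor_bound:
  fixes f :: "complex \<Rightarrow> complex"
  assumes holo: "f holomorphic_on UNIV" and f0: "f 0 \<noteq> 0" and r: "r > 0"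
    and M: "\<And>z. norm z = 4 * r \<Longrightarrow> norm (f z) \<le> M"
    and P: "P = {z. f z = 0 \<and> norm z \<le> 2 * r}"
    and g: "g holomorphic_on UNIV" 
      "\<And>z. f z = g z * (\<Prod>q\<in>P. (1 - z / q) ^ nat (zorder f q))"
    and z: "norm z \<le> 4 * r"
  shows "norm (g z) \<le> M" "norm (f 0) * 3 ^ (\<Sum>q | f q = 0 \<and> norm q \<le> r. nat (zorder f q)) \<le> M"
proof -
  define Q where "Q = {z. f z = 0 \<and> norm z \<le> r}"
  define n where "n = (\<Sum>q\<in>Q. nat (zorder f q))"
  have fin: "finite P" "finite Q" unfolding P Q_def by (rule finite_zeros_cball[OF holo f0])+
  have QP: "Q \<subseteq> P" using r unfolding Q_def P by auto
  have P0: "q \<noteq> 0" if "q \<in> P" for q using that f0 by (auto simp: P)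
  have ge: "norm (1 - w / q) \<ge> c - 1" if "norm w = 4 * r" "q \<in> P" "c * norm q \<le> 4 * r" for w q c
  proof -
    have "c \<le> norm (w / q)" using that P0[OF that(2)] by (simp add: norm_divide field_simps)
    thus ?thesis using norm_triangle_ineq2[of "w / q" 1] by (simp add: norm_minus_commute)
  qed
  have bnd: "norm (g w) \<le> M / 3 ^ n" if w: "norm w = 4 * r" for w
  proof -
    have "3 ^ n = (\<Prod>q\<in>Q. 3 ^ nat (zorder f q) :: real)" by (simp add: n_def power_sum)
    also have "\<dots> = (\<Prod>q\<in>P. (if q \<in> Q then 3 else 1) ^ nat (zorder f q))"
      using QP fin by (intro prod.mono_neutral_cong_left) auto
    also have "\<dots> \<le> (\<Prod>q\<in>P. norm ((1 - w / q) ^ nat (zorder f q)))"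
    proof (intro prod_mono conjI)
      fix q assume q: "q \<in> P"
      have "(if q \<in> Q then 3 else 1) \<le> norm (1 - w / q)"
        using ge[OF w q, of 4] ge[OF w q, of 2] q by (auto simp: Q_def P)
      thus "(if q \<in> Q then 3 else 1) ^ nat (zorder f q) \<le> norm ((1 - w / q) ^ nat (zorder f q))"
        unfolding norm_power by (intro power_mono) auto
    qed auto
    finally have p: "3 ^ n \<le> norm (\<Prod>q\<in>P. (1 - w / q) ^ nat (zorder f q))"
      by (simp add: prod_norm)
    have "norm (g w) * 3 ^ n \<le> norm (g w) * norm (\<Prod>q\<in>P. (1 - w / q) ^ nat (zorder f q))"
      using p by (intro mult_left_mono) auto
    also have "\<dots> = norm (f w)" by (simp add: g(2) norm_mult)
    also have "\<dots> \<le> M" by (rule M[OF w])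
    finally show ?thesis by (simp add: field_simps)
  qed
  have all: "norm (g w) \<le> M / 3 ^ n" if "norm w \<le> 4 * r" for w
    by (rule maximum_modulus_frontier[of g "cball 0 (4 * r)"])
       (use r g(1) that bnd in \<open>auto intro: holomorphic_on_subset holomorphic_on_imp_continuous_on\<close>)
  have "g 0 = f 0" by (simp add: g(2))
  with all[of 0] r have "norm (f 0) \<le> M / 3 ^ n" by auto
  thus *: "norm (f 0) * 3 ^ (\<Sum>q | f q = 0 \<and> norm q \<le> r. nat (zorder f q)) \<le> M"
    by (simp add: field_simps n_def Q_def)
  have "0 < norm (f 0) * 3 ^ n" using f0 by simp
  with * have "M \<ge> 0" by (simp add: n_def Q_def)
  have "M / 3 ^ n \<le> M / 1" using \<open>M \<ge> 0\<close> by (intro divide_left_mono) auto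
  with all[OF z] show "norm (g z) \<le> M" by simp
qed


section \<open>Counting the zeros of an entire function\<close>

lemma zorder_entire_pos:
  fixes f :: "complex \<Rightarrow> complex"
  assumes holo: "f holomorphic_on UNIV" and f0: "f 0 \<noteq> 0" and z: "f z = 0"
  shows "zorder f z > 0"
proof -
  have "eventually (\<lambda>z. f z \<noteq> 0) (at z)"
    using non_zero_neighbour_alt[OF holo open_UNIV connected_UNIV _ _ f0] by auto
  hence *: "frequently (\<lambda>z. f z \<noteq> 0) (at z)" by (intro eventually_frequently) auto
  show ?thesis using zorder_pos_iff[OF holo open_UNIV _ *] z by auto
qed

lemma zero_counting_bound:
  fixes f :: "complex \<Rightarrow> complex"
  assumes holo: "f holomorphic_on UNIV" and f0: "f 0 \<noteq> 0"
    and C: "C \<ge> 0" "\<And>z. norm (f z) \<le> exp (C * (1 + norm z) powr (3/2))"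
  obtains K where "K \<ge> 0"
    "\<And>r. r \<ge> 1 \<Longrightarrow> real_of_int (\<Sum>q | f q = 0 \<and> norm q \<le> r. zorder f q) \<le> K * r powr (3/2)"
proof
  define K where "K = C * 5 powr (3/2) + \<bar>ln (norm (f 0))\<bar>"
  show "K \<ge> 0" using C by (simp add: K_def)
  fix r :: real assume r: "r \<ge> 1"
  define n where "n = (\<Sum>q | f q = 0 \<and> norm q \<le> r. nat (zorder f q))"
  define P where "P = {z. f z = 0 \<and> norm z \<le> 2 * r}"
  have fin: "finite P" unfolding P_def by (rule finite_zeros_cball[OF holo f0])
  obtain g where g: "g holomorphic_on UNIV" 
      "\<And>z. f z = g z * (\<Prod>q\<in>P. (1 - z / q) ^ nat (zorder f q))"
    using factor_out_zeros[OF holo f0 fin] f0 by (auto simp: P_def)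
  have "norm (f 0) * 3 ^ n \<le> exp (C * (1 + 4 * r) powr (3/2))"
    unfolding n_def
  proof (rule factor_bound(2)[OF holo f0 _ _ P_def g, of _ 0])
    show "norm (f z) \<le> exp (C * (1 + 4 * r) powr (3/2))" if "norm z = 4 * r" for z
      using C(2)[of z] that by simp
  qed (use r in auto)
  hence "ln (norm (f 0) * 3 ^ n) \<le> C * (1 + 4 * r) powr (3/2)"
    using f0 by (intro ln_leI) auto
  hence 1: "ln (norm (f 0)) + n * ln 3 \<le> C * (1 + 4 * r) powr (3/2)"
    using f0 by (simp add: ln_mult ln_realpow)
  have "(1 + 4 * r) powr (3/2) \<le> (5 * r) powr (3/2)" using r by (intro powr_mono2) auto
  also have "\<dots> = 5 powr (3/2) * r powr (3/2)" using r by (simp add: powr_mult)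
  finally have 2: "C * (1 + 4 * r) powr (3/2) \<le> C * 5 powr (3/2) * r powr (3/2)"
    using C(1) by (metis mult.assoc mult_left_mono)
  have "1 \<le> ln (3::real)" using exp_le by (subst ln_ge_iff) auto
  hence "real n * 1 \<le> real n * ln 3" by (intro mult_left_mono) auto
  also have "\<dots> \<le> C * 5 powr (3/2) * r powr (3/2) + \<bar>ln (norm (f 0))\<bar> * 1"
    using 1 2 by linarith
  also have "\<dots> \<le> C * 5 powr (3/2) * r powr (3/2) + \<bar>ln (norm (f 0))\<bar> * r powr (3/2)"
    using r by (intro add_left_mono mult_left_mono ge_one_powr_ge_zero) auto
  finally have "n \<le> K * r powr (3/2)" by (simp add: K_def algebra_simps)
  moreover have "int n = (\<Sum>q | f q = 0 \<and> norm q \<le> r. zorder f q)"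
    unfolding n_def of_nat_sum 
    using zorder_entire_pos[OF holo f0] by (intro sum.cong) (auto simp: less_imp_le)
  ultimately show "real_of_int (\<Sum>q | f q = 0 \<and> norm q \<le> r. zorder f q) \<le> K * r powr (3/2)"
    by (metis of_int_of_nat_eq)
qed

text \<open>The zeros are sorted into dyadic shells 2^k < |q| <= 2^(k + 1). By the counting bound a
  shell contributes at most K (2^(k + 1)) powr (3/2) / 4^k, a geometric sequence with ratio 2 powr
  (3/2) / 4 < 1.\<close>

lemma summable_on_inverse_zeros_squared:
  fixes f :: "complex \<Rightarrow> complex"
  assumes holo: "f holomorphic_on UNIV" and f0: "f 0 \<noteq> 0"
    and C: "C \<ge> 0" "\<And>z. norm (f z) \<le> exp (C * (1 + norm z) powr (3/2))"
  shows "(\<lambda>q. real_of_int (zorder f q) / (norm q)\<^sup>2) summable_on {z. f z = 0}"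
proof -
  obtain K where K: "K \<ge> 0" "\<And>r. r \<ge> 1 \<Longrightarrow>
      real_of_int (\<Sum>q | f q = 0 \<and> norm q \<le> r. zorder f q) \<le> K * r powr (3/2)"
    using zero_counting_bound[OF assms] by blast
  define Z where "Z = (\<lambda>r. {q. f q = 0 \<and> norm q \<le> r})"
  have fin: "finite (Z r)" for r unfolding Z_def by (rule finite_zeros_cball[OF holo f0])
  define F where "F = (\<lambda>q. real_of_int (zorder f q) / (norm q)\<^sup>2)"
  have zo: "zorder f q > 0" if "f q = 0" for q by (rule zorder_entire_pos[OF holo f0 that])
  have F_nonneg: "F q \<ge> 0" if "f q = 0" for q using zo[OF that] by (simp add: F_def)
  define Q :: real where "Q = 2 powr (3/2) / 4"
  define c where "c = K * 2 powr (3/2)"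
  have "2 powr (3/2) < 2 powr (2::real)" by (subst powr_less_cancel_iff) auto
  hence Q: "0 \<le> Q" "Q < 1" by (auto simp: Q_def powr_numeral)
  have c: "c \<ge> 0" using K by (simp add: c_def)
  have step: "(\<Sum>q\<in>Z (2^k). F q) \<le> (\<Sum>q\<in>Z 1. F q) + c * (\<Sum>i<k. Q ^ i)" for k
  proof (induction k)
    case (Suc k)
    have "(\<Sum>q\<in>Z (2^Suc k) - Z (2^k). F q) \<le> (\<Sum>q\<in>Z (2^Suc k) - Z (2^k). real_of_int (zorder f q) / 4 ^ k)"
    proof (intro sum_mono)
      fix q assume q: "q \<in> Z (2^Suc k) - Z (2^k)"
      have "(4::real) ^ k = (2 ^ k)\<^sup>2" by (simp add: power2_eq_square power_mult_distrib[symmetric])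
      also have "\<dots> \<le> (norm q)\<^sup>2" using q by (intro power_mono) (auto simp: Z_def)
      finally show "F q \<le> real_of_int (zorder f q) / 4 ^ k" unfolding F_def
        using zo[of q] q by (intro divide_left_mono mult_pos_pos) (auto simp: Z_def)
    qed
    also have "\<dots> \<le> (\<Sum>q\<in>Z (2^Suc k). real_of_int (zorder f q) / 4 ^ k)"
      using fin zo by (intro sum_mono2) (auto simp: Z_def less_imp_le)
    also have "\<dots> = real_of_int (\<Sum>q\<in>Z (2^Suc k). zorder f q) / 4 ^ k"
      by (simp add: sum_divide_distrib)
    also have "\<dots> \<le> K * (2^Suc k) powr (3/2) / 4 ^ k"
      unfolding Z_def by (intro divide_right_mono K) (auto simp: one_le_power simp del: power_Suc)
    also have "(2^Suc k :: real) powr (3/2) = 2 powr (3/2) * (2 powr (3/2)) ^ k"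
      by (simp add: powr_mult powr_realpow[symmetric] powr_powr mult.commute)
    also have "K * (2 powr (3/2) * (2 powr (3/2)) ^ k) / 4 ^ k = c * Q ^ k"
      by (simp add: c_def Q_def power_divide)
    finally have *: "(\<Sum>q\<in>Z (2^Suc k) - Z (2^k). F q) \<le> c * Q ^ k" .
    have "Z (2^k) \<subseteq> Z (2^Suc k)"
      by (auto simp: Z_def intro: order.trans)
    hence "(\<Sum>q\<in>Z (2^Suc k). F q) = (\<Sum>q\<in>Z (2^Suc k) - Z (2^k). F q) + (\<Sum>q\<in>Z (2^k). F q)"
      using fin by (intro sum.subset_diff) auto
    thus ?case using * Suc.IH by (simp add: algebra_simps)
  qed simp
  show ?thesis unfolding F_def[symmetric]
  proof (rule nonneg_bdd_above_summable_on)
    show "bdd_above (sum F ` {X. X \<subseteq> {z. f z = 0} \<and> finite X})"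
    proof (rule bdd_aboveI2)
      fix X assume "X \<in> {X. X \<subseteq> {z. f z = 0} \<and> finite X}"
      hence X: "X \<subseteq> {z. f z = 0}" "finite X" by auto
      obtain k where k: "Max (insert 0 (norm ` X)) < 2 ^ k"
        using real_arch_pow[of 2] by auto
      have "X \<subseteq> Z (2^k)" using X k by (auto simp: Z_def less_imp_le)
      hence "sum F X \<le> sum F (Z (2^k))"
        using fin F_nonneg by (intro sum_mono2) (auto simp: Z_def)
      also have "\<dots> \<le> sum F (Z 1) + c * (\<Sum>i<k. Q ^ i)" by (rule step)
      also have "(\<Sum>i<k. Q ^ i) \<le> (\<Sum>i. Q ^ i)"
        using Q by (intro sum_le_suminf summable_geometric) auto
      finally show "sum F X \<le> sum F (Z 1) + c * (\<Sum>i. Q ^ i)"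
        using c by (simp add: mult_left_mono)
    qed
  qed (use F_nonneg in auto)
qed


section \<open>Partial fractions of the logarithmic derivative\<close>

text \<open>Once the zeros in |z| <= 2 R are divided out, the quotient g has a logarithm on |z| < 2
  R whose real part is at most of order R powr (3/2). Borel-Caratheodory turns this into a bound of
  its modulus on |z| <= R, and Cauchy's inequality bounds its second derivative on |z| < R / 2 with
  a gain of R^-2. Comparing the logarithmic derivatives at s and at 0 needs just this second
  derivative.\<close>

lemma log_deriv_diff_bound:
  fixes f :: "complex \<Rightarrow> complex"
  assumes holo: "f holomorphic_on UNIV" and f0: "f 0 \<noteq> 0"
    and C: "C \<ge> 0" "\<And>z. norm (f z) \<le> exp (C * (1 + norm z) powr (3/2))"
    and s: "f s \<noteq> 0" and R: "R > 0" "norm s < R / 2"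
    and P: "P = {z. f z = 0 \<and> norm z \<le> 2 * R}"
  shows "norm ((deriv f s / f s - deriv f 0 / f 0) - (\<Sum>q\<in>P. of_int (zorder f q) * (1 / (s - q) + 1 / q)))
    \<le> 16 * (C * (1 + 4 * R) powr (3/2) - ln (norm (f 0)) + 1) / R\<^sup>2 * norm s"
proof -
  \<comment> \<open>A bounds the real part of log g - log g(0), where g(0) = f(0); the added 1 makes
    the inequality strict, as Borel-Caratheodory asks.\<close>
  define A where "A = C * (1 + 4 * R) powr (3/2) - ln (norm (f 0)) + 1"
  have fin: "finite P" unfolding P by (rule finite_zeros_cball[OF holo f0])
  have P0: "q \<noteq> 0" "f q = 0" if "q \<in> P" for q using that f0 by (auto simp: P)
  obtain g where g: "g holomorphic_on UNIV" 
      "\<And>z. f z = g z * (\<Prod>q\<in>P. (1 - z / q) ^ nat (zorder f q))" "\<And>q. q \<in> P \<Longrightarrow> g q \<noteq> 0"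
    using factor_out_zeros[OF holo f0 fin] P0 by blast
  have g_nz: "g z \<noteq> 0" if "norm z < 2 * R" for z
    using g(2)[of z] g(3)[of z] that by (auto simp: P)
  have g0: "g 0 = f 0" by (simp add: g(2))
  have g_le: "norm (g z) \<le> exp (C * (1 + 4 * R) powr (3/2))" if "norm z \<le> 4 * R" for z
  proof (rule factor_bound(1)[OF holo f0 R(1) _ P g(1,2) that])
    show "norm (f z) \<le> exp (C * (1 + 4 * R) powr (3/2))" if "norm z = 4 * R" for z
      using C(2)[of z] that by simp
  qed
  have "ln (norm (g 0)) \<le> C * (1 + 4 * R) powr (3/2)"
    using g_le[of 0] R g_nz[of 0] by (intro ln_leI) auto
  hence A: "A > 0" by (simp add: A_def g0)
  obtain G where G: "G holomorphic_on ball 0 (2 * R)" "\<And>z. z \<in> ball 0 (2 * R) \<Longrightarrow> exp (G z) = g z"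
    by (rule holomorphic_logarithm_exists[of "ball 0 (2 * R)" g 0])
       (use g(1) g_nz R in \<open>auto intro: holomorphic_on_subset\<close>)
  define h where "h = (\<lambda>z. G z - G 0)"
  have h_holo: "h holomorphic_on ball 0 (2 * R)" unfolding h_def by (intro holomorphic_intros G)
  have Re_G: "Re (G z) = ln (norm (g z))" if "norm z < 2 * R" for z
    using G(2)[of z] that by (metis dist_0_norm ln_exp mem_ball norm_exp_eq_Re)
  have Re_h: "Re (h z) < A" if "norm z < 2 * R" for z
  proof -
    have "ln (norm (g z)) \<le> C * (1 + 4 * R) powr (3/2)"
      using g_le[of z] R g_nz[of z] that
      by (intro ln_leI) auto
    thus ?thesis using Re_G[OF that] Re_G[of 0] R by (simp add: h_def A_def g0)
  qed
  have h_le: "norm (h z) \<le> 2 * A" if z: "norm z \<le> R" for z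
  proof -
    have "norm (h z) \<le> 2 * norm z * A / (2 * R - norm z)"
      by (rule borel_caratheodory[OF h_holo _ _ A Re_h]) (use z R in \<open>auto simp: h_def\<close>)
    also have "\<dots> \<le> 2 * R * A / (2 * R - R)"
      using z R A by (intro frac_le mult_mono) auto
    finally show ?thesis using R by simp
  qed
  define h' where "h' = deriv h"
  have h'_eq: "h' z = deriv g z / g z" if z: "norm z < 2 * R" for z
  proof -
    have "eventually (\<lambda>w. w \<in> ball 0 (2 * R)) (nhds z)" using z by (intro eventually_nhds_in_open) auto
    hence ev: "eventually (\<lambda>w. exp (h w) * exp (G 0) = g w) (nhds z)"
      by eventually_elim (use G(2) in \<open>simp add: h_def exp_diff\<close>)
    have "(h has_field_derivative h' z) (at z)" unfolding h'_def
      by (rule holomorphic_derivI[OF h_holo]) (use z in auto)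
    hence "((\<lambda>w. exp (h w) * exp (G 0)) has_field_derivative exp (h z) * h' z * exp (G 0)) (at z)"
      by (auto intro!: derivative_eq_intros)
    hence "(g has_field_derivative exp (h z) * h' z * exp (G 0)) (at z)"
      using DERIV_cong_ev[OF refl ev refl] by blast
    hence "deriv g z = (exp (h z) * exp (G 0)) * h' z" by (simp add: DERIV_imp_deriv mult_ac)
    also have "exp (h z) * exp (G 0) = g z" using eventually_nhds_x_imp_x[OF ev] .
    finally show ?thesis using g_nz[OF z] by simp
  qed
  have logd: "deriv g z / g z = deriv f z / f z - (\<Sum>q\<in>P. of_int (zorder f q) / (z - q))" if z: "f z \<noteq> 0" for z
  proof -
    define p where "p = (\<lambda>z. \<Prod>q\<in>P. (1 - z / q) ^ nat (zorder f q))"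
    have nz: "1 - z / q \<noteq> 0" "z \<noteq> q" if "q \<in> P" for q using P0[OF that] z by (auto simp: field_simps)
    have "(p has_field_derivative p z * (\<Sum>q\<in>P. (of_nat (nat (zorder f q)) * ((1 - z / q) ^ (nat (zorder f q) - 1) * (- 1 / q))) / (1 - z / q) ^ nat (zorder f q))) (at z)"
      unfolding p_def using nz P0 by (intro has_field_derivative_prod') (auto intro!: derivative_eq_intros)
    also have "(\<Sum>q\<in>P. (of_nat (nat (zorder f q)) * ((1 - z / q) ^ (nat (zorder f q) - 1) * (- 1 / q))) / (1 - z / q) ^ nat (zorder f q))
        = (\<Sum>q\<in>P. of_int (zorder f q) / (z - q))"
    proof (rule sum.cong[OF refl])
      fix q assume q: "q \<in> P"
      define n where "n = nat (zorder f q)"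
      have n: "n > 0" "of_int (zorder f q) = (of_nat n :: complex)"
        using zorder_entire_pos[OF holo f0 P0(2)[OF q]] by (auto simp: n_def)
      have e1: "(1 - z / q) ^ n = (1 - z / q) * (1 - z / q) ^ (n - 1)" using n by (cases n) auto
      have e2: "(-1 / q) / (1 - z / q) = 1 / (z - q)" using nz[OF q] P0[OF q] by (simp add: divide_simps)
      have e3: "of_nat n * (c ^ (n - 1) * d) / (c * c ^ (n - 1)) = of_nat n * (d / c)" if "c \<noteq> 0" for c d :: complex
        using that by simp
      show "of_nat (nat (zorder f q)) * ((1 - z / q) ^ (nat (zorder f q) - 1) * (- 1 / q)) / (1 - z / q) ^ nat (zorder f q) = of_int (zorder f q) / (z - q)"
        unfolding n_def[symmetric] n(2) e1 e3[OF nz(1)[OF q]] e2 by simp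
    qed
    finally have p': "(p has_field_derivative p z * (\<Sum>q\<in>P. of_int (zorder f q) / (z - q))) (at z)" .
    have "(g has_field_derivative deriv g z) (at z)"
      by (rule holomorphic_derivI[OF g(1)]) auto
    from DERIV_mult[OF this p'] have "((\<lambda>z. g z * p z) has_field_derivative
        deriv g z * p z + p z * (\<Sum>q\<in>P. of_int (zorder f q) / (z - q)) * g z) (at z)" .
    moreover have feq: "(\<lambda>z. g z * p z) = f" using g(2) by (auto simp: p_def)
    ultimately have "deriv f z = deriv g z * p z + (g z * p z) * (\<Sum>q\<in>P. of_int (zorder f q) / (z - q))"
      by (simp add: DERIV_imp_deriv mult_ac)
    moreover have "f z = g z * p z" using feq by metis
    ultimately show ?thesis using z by (simp add: field_simps)
  qed
  have "norm (h' s - h' 0) \<le> 16 * A / R\<^sup>2 * norm (s - 0)"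
  proof (rule field_differentiable_bound[of "ball 0 (R / 2)" h' "deriv h'"])
    fix z :: complex assume z: "z \<in> ball 0 (R / 2)"
    have "h' holomorphic_on ball 0 (2 * R)" unfolding h'_def by (intro holomorphic_deriv h_holo) auto
    thus "(h' has_field_derivative deriv h' z) (at z within ball 0 (R / 2))"
      by (rule holomorphic_derivI) (use z R in auto)
    have sub: "cball z (R / 2) \<subseteq> ball 0 (2 * R)" and sub2: "cball z (R / 2) \<subseteq> cball 0 R"
    proof -
      have "norm x < R" if "dist z x \<le> R / 2" for x
        using that z norm_triangle_ineq[of z "x - z"] by (simp add: dist_norm norm_minus_commute)
      thus "cball z (R / 2) \<subseteq> ball 0 (2 * R)" "cball z (R / 2) \<subseteq> cball 0 R"
        using R by (fastforce simp: less_imp_le)+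
    qed
    have "norm ((deriv ^^ 2) h z) \<le> fact 2 * (2 * A) / (R / 2) ^ 2"
    proof (rule Cauchy_inequality)
      show "h holomorphic_on ball z (R / 2)" 
        using sub ball_subset_cball by (intro holomorphic_on_subset[OF h_holo]) blast
      show "continuous_on (cball z (R / 2)) h" 
        using sub by (intro holomorphic_on_imp_continuous_on holomorphic_on_subset[OF h_holo])
      show "norm (h x) \<le> 2 * A" if "norm (z - x) = R / 2" for x
        using sub2 that by (intro h_le) (auto simp: subset_iff dist_norm)
    qed (use R in auto)
    thus "norm (deriv h' z) \<le> 16 * A / R\<^sup>2"
      by (simp add: h'_def numeral_2_eq_2 power_divide)
  qed (use R in auto)
  also have "h' s - h' 0 = deriv f s / f s - deriv f 0 / f 0 - (\<Sum>q\<in>P. of_int (zorder f q) * (1 / (s - q) + 1 / q))"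
    using h'_eq[of s] h'_eq[of 0] R logd[OF s] logd[OF f0] 
    by (simp add: sum_subtractf sum.distrib sum_negf algebra_simps)
  finally show ?thesis by (simp add: A_def)
qed

lemma filterlim_finite_subsets_at_topI:
  assumes "\<And>R. finite (P R)" "\<And>R. P R \<subseteq> Z" "\<And>q. q \<in> Z \<Longrightarrow> eventually (\<lambda>R. q \<in> P R) F"
  shows "filterlim P (finite_subsets_at_top Z) F"
  unfolding filterlim_iff eventually_finite_subsets_at_top
proof (intro allI impI, elim exE conjE)
  fix Q X assume X: "finite X" "X \<subseteq> Z" "\<forall>Y. finite Y \<and> X \<subseteq> Y \<and> Y \<subseteq> Z \<longrightarrow> Q Y"
  have "eventually (\<lambda>R. \<forall>q\<in>X. q \<in> P R) F"
    using X assms(3) by (intro eventually_ball_finite) auto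
  thus "eventually (\<lambda>R. Q (P R)) F" by eventually_elim (use X(3) assms(1,2) in blast)
qed

text \<open>Each summand is s / ((s - q) q) times the multiplicity, hence O(|q|^-2), and the sum
  converges absolutely. It may then be evaluated along the discs |q| <= 2 R, where the error is O(R
  powr (3/2) / R^2). Subtracting the value at 0 eliminates the linear exponential factor of the
  Hadamard product.\<close>

theorem has_sum_log_deriv_zeros:
  fixes f :: "complex \<Rightarrow> complex"
  assumes holo: "f holomorphic_on UNIV" and f0: "f 0 \<noteq> 0"
    and C: "C \<ge> 0" "\<And>z. norm (f z) \<le> exp (C * (1 + norm z) powr (3/2))"
    and s: "f s \<noteq> 0"
  shows "((\<lambda>q. of_int (zorder f q) * (1 / (s - q) + 1 / q)) has_sum
    (deriv f s / f s - deriv f 0 / f 0)) {z. f z = 0}"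
proof -
  define Z where "Z = {z. f z = 0}"
  define t where "t = (\<lambda>q. of_int (zorder f q) * (1 / (s - q) + 1 / q))"
  have Z0: "q \<noteq> 0" "q \<noteq> s" if "q \<in> Z" for q using that f0 s by (auto simp: Z_def)
  have zo: "zorder f q > 0" if "q \<in> Z" for q 
    using zorder_entire_pos[OF holo f0] that by (auto simp: Z_def)
  define P where "P = (\<lambda>R. {z. f z = 0 \<and> norm z \<le> 2 * R})"
  have fin: "finite (P R)" for R unfolding P_def by (rule finite_zeros_cball[OF holo f0])
  have "t summable_on Z"
  proof (rule abs_summable_summable)
    have sub: "(\<lambda>q. norm (t q)) summable_on (Z - P (norm s))"
    proof (rule summable_on_comparison_test)
      show "(\<lambda>q. 2 * norm s * (real_of_int (zorder f q) / (norm q)\<^sup>2)) summable_on (Z - P (norm s))"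
        by (rule summable_on_cmult_right, rule summable_on_subset_banach[of _ Z])
           (use summable_on_inverse_zeros_squared[OF assms(1-4)] in \<open>auto simp: Z_def\<close>)
      fix q assume q: "q \<in> Z - P (norm s)"
      hence n: "norm q > 2 * norm s" by (auto simp: P_def Z_def)
      have "norm (s - q) \<ge> norm q - norm s" by (metis norm_minus_commute norm_triangle_ineq2)
      with n have n2: "norm (s - q) \<ge> norm q / 2" by simp
      have "1 / (s - q) + 1 / q = s / ((s - q) * q)" using Z0[of q] q by (auto simp: field_simps)
      hence "norm (t q) = of_int (zorder f q) * (norm s / (norm (s - q) * norm q))"
        using zo[of q] q by (simp add: t_def norm_mult norm_divide)
      also have "\<dots> \<le> of_int (zorder f q) * (norm s / (norm q / 2 * norm q))"
        using n2 zo[of q] q Z0[of q] by (intro mult_left_mono divide_left_mono mult_right_mono mult_pos_pos) auto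
      finally show "norm (t q) \<le> 2 * norm s * (real_of_int (zorder f q) / (norm q)\<^sup>2)"
        by (simp add: power2_eq_square mult_ac)
    qed auto
    moreover have "(\<lambda>q. norm (t q)) summable_on (P (norm s))" using fin by (rule summable_on_finite)
    ultimately have "(\<lambda>q. norm (t q)) summable_on ((Z - P (norm s)) \<union> P (norm s))"
      by (intro summable_on_Un_disjoint) auto
    moreover have "(Z - P (norm s)) \<union> P (norm s) = Z" by (auto simp: Z_def P_def)
    ultimately show "(\<lambda>q. norm (t q)) summable_on Z" by simp
  qed
  hence hs: "(t has_sum infsum t Z) Z" by (rule has_sum_infsum)
  have "filterlim P (finite_subsets_at_top Z) at_top"
  proof (rule filterlim_finite_subsets_at_topI[OF fin])
    show "eventually (\<lambda>R. q \<in> P R) at_top" if "q \<in> Z" for q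
      using eventually_ge_at_top[of "norm q / 2"] by eventually_elim (use that in \<open>auto simp: P_def Z_def\<close>)
  qed (auto simp: P_def Z_def)
  hence lim1: "((\<lambda>R. \<Sum>q\<in>P R. t q) \<longlongrightarrow> infsum t Z) at_top"
    using hs unfolding has_sum_def by (rule filterlim_compose[rotated])
  define L where "L = deriv f s / f s - deriv f 0 / f 0"
  have "((\<lambda>R. L - (\<Sum>q\<in>P R. t q)) \<longlongrightarrow> 0) at_top"
  proof (rule Lim_null_comparison)
    show "((\<lambda>R. 16 * (C * (1 + 4 * R) powr (3/2) - ln (norm (f 0)) + 1) / R\<^sup>2 * norm s) \<longlongrightarrow> 0) at_top"
    proof -
      have "((\<lambda>R::real. (1 + 4 * R) powr (3/2) / R\<^sup>2) \<longlongrightarrow> 0) at_top" "((\<lambda>R::real. 1 / R\<^sup>2) \<longlongrightarrow> 0) at_top"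
        by real_asymp+
      hence "((\<lambda>R. 16 * (C * ((1 + 4 * R) powr (3/2) / R\<^sup>2) + (1 - ln (norm (f 0))) * (1 / R\<^sup>2)) * norm s)
          \<longlongrightarrow> 16 * (C * 0 + (1 - ln (norm (f 0))) * 0) * norm s) at_top"
        by (intro tendsto_intros)
      thus ?thesis by (simp add: add_divide_distrib diff_divide_distrib algebra_simps)
    qed
    show "eventually (\<lambda>R. norm (L - (\<Sum>q\<in>P R. t q)) \<le>
        16 * (C * (1 + 4 * R) powr (3/2) - ln (norm (f 0)) + 1) / R\<^sup>2 * norm s) at_top"
      using eventually_gt_at_top[of "2 * norm s"] eventually_gt_at_top[of 0]
      by eventually_elim 
         (unfold L_def t_def, rule log_deriv_diff_bound[OF assms], auto simp: P_def)
  qed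
  from tendsto_diff[OF tendsto_const[of L] this] have "((\<lambda>R. \<Sum>q\<in>P R. t q) \<longlongrightarrow> L) at_top" by simp
  with lim1 have "infsum t Z = L" by (intro tendsto_unique[OF _ lim1]) auto
  with hs show ?thesis by (simp add: L_def t_def Z_def)
qed

subsection \<open>The Fourier series of the sawtooth polynomial\<close>

lemma Im_Ln_one_minus_cis:
  assumes "0 < t" "t < 2 * pi"
  shows "Im (Ln (1 - cis t)) = (t - pi) / 2"
proof -
  have s: "sin (t / 2) > 0" using assms by (intro sin_gt_zero) auto
  have "sin t = 2 * sin (t / 2) * cos (t / 2)" "cos t = 1 - 2 * (sin (t / 2))\<^sup>2"
    using sin_double[of "t / 2"] cos_double_sin[of "t / 2"] by simp_all
  moreover have "cos ((t - pi) / 2) = sin (t / 2)" "sin ((t - pi) / 2) = - cos (t / 2)"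
    by (simp_all add: diff_divide_distrib cos_diff sin_diff)
  ultimately have "1 - cis t = of_real (2 * sin (t / 2)) * cis ((t - pi) / 2)"
    by (simp add: complex_eq_iff power2_eq_square)
  also have "Ln \<dots> = of_real (ln (2 * sin (t / 2))) + \<i> * of_real ((t - pi) / 2)"
    using s assms by (intro Ln_unique) (auto simp: exp_add exp_of_real cis_conv_exp)
  finally show ?thesis by simp
qed

text \<open>Abel summation: with a factor r^n, r < 1, the series may be differentiated termwise in
  \<theta>, and the derivative is -Im Ln (1 - r cis t). Its modulus is at most pi, so the integral
  over {0..\<theta>} can be taken to the limit r -> 1; the series is continuous in r up to 1 because
  it is dominated by 2 / n^2.\<close>

lemma sums_one_minus_cos_over_square:
  fixes \<theta> :: real
  assumes \<theta>: "0 \<le> \<theta>" "\<theta> \<le> 2 * pi"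
  shows "(\<lambda>n. (1 - cos (real (Suc n) * \<theta>)) / (real (Suc n))\<^sup>2) sums (pi * \<theta> / 2 - \<theta>\<^sup>2 / 4)"
proof -
  define e where "e = (\<lambda>r n (t::real). r ^ Suc n * ((1 - cos (real (Suc n) * t)) / (real (Suc n))\<^sup>2) :: real)"
  define C where "C = (\<lambda>r t. \<Sum>n. e r n t)"
  have sum2: "summable (\<lambda>n. 2 / (real (Suc n))\<^sup>2)"
  proof -
    have "summable (\<lambda>n. 2 * inverse ((real n)\<^sup>2))" by (intro summable_mult inverse_power_summable) simp
    hence "summable (\<lambda>n. 2 * inverse ((real (Suc n))\<^sup>2))" by (subst summable_Suc_iff)
    thus ?thesis by (simp add: field_simps)
  qed
  have e_le: "norm (e r n t) \<le> 2 / (real (Suc n))\<^sup>2" if "r \<in> {0..1}" for r n t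
  proof -
    have "\<bar>1 - cos (real (Suc n) * t)\<bar> \<le> 2" using cos_ge_minus_one[of "Suc n * t"] cos_le_one[of "Suc n * t"] by linarith
    moreover have "\<bar>r ^ Suc n\<bar> \<le> 1" using that by (subst power_abs) (intro power_le_one, auto)
    ultimately have "\<bar>r ^ Suc n\<bar> * \<bar>1 - cos (real (Suc n) * t)\<bar> \<le> 1 * 2" by (intro mult_mono) auto
    hence "\<bar>r ^ Suc n\<bar> * \<bar>1 - cos (real (Suc n) * t)\<bar> / (real (Suc n))\<^sup>2 \<le> 1 * 2 / (real (Suc n))\<^sup>2" 
      by (rule divide_right_mono) simp
    thus ?thesis unfolding e_def by (simp add: abs_mult)
  qed
  have summ: "summable (\<lambda>n. e r n t)" if "r \<in> {0..1}" for r t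
    by (rule summable_comparison_test'[OF sum2 e_le[OF that]])
  have contC: "continuous_on {0..1} (\<lambda>r. C r \<theta>)" unfolding C_def
  proof (rule uniform_limit_theorem[OF _ Weierstrass_m_test[OF e_le sum2]])
    show "\<forall>\<^sub>F n in sequentially. continuous_on {0..1} (\<lambda>r. \<Sum>i<n. e r i \<theta>)"
      unfolding e_def by (intro always_eventually allI continuous_intros)
  qed auto
  have int: "((\<lambda>t. - Im (Ln (1 - of_real r * cis t))) has_integral C r \<theta>) {0..\<theta>}"
    if r: "0 \<le> r" "r < 1" for r
  proof -
    define d where "d = (\<lambda>n (t::real). r ^ Suc n * (sin (real (Suc n) * t) / real (Suc n)))"
    have d_le: "norm (d n t) \<le> r ^ Suc n" for n t
    proof -
      have "\<bar>sin (real (Suc n) * t)\<bar> / real (Suc n) \<le> 1 / 1" by (intro frac_le) auto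
      hence "r ^ Suc n * (\<bar>sin (real (Suc n) * t)\<bar> / real (Suc n)) \<le> r ^ Suc n * 1" using r by (intro mult_left_mono) auto
      thus ?thesis using r by (simp add: d_def abs_mult power_abs)
    qed
    have "(C r has_real_derivative (\<Sum>n. d n t)) (at t)" for t
      unfolding C_def
    proof (rule has_field_derivative_series'(2)[where S = UNIV and f = "e r" and f' = d])
      show "(e r n has_real_derivative d n x) (at x within UNIV)" for n x
        unfolding e_def d_def
        by (auto intro!: derivative_eq_intros simp: field_simps power2_eq_square simp del: of_nat_Suc)
      show "uniformly_convergent_on UNIV (\<lambda>n x. \<Sum>i<n. d i x)"
        by (rule Weierstrass_m_test'[OF d_le]) (use r in \<open>auto simp: summable_Suc_iff intro!: summable_geometric summable_mult\<close>)
      show "summable (\<lambda>n. e r n 0)" using r by (intro summ) auto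
    qed auto
    moreover have "(\<Sum>n. d n t) = - Im (Ln (1 - of_real r * cis t))" for t
    proof -
      have "norm (- of_real r * cis t) < 1" using r by (simp add: norm_mult)
      from Ln_series'[OF this] have "(\<lambda>n. - ((of_real r * cis t) ^ n) / of_nat n) sums Ln (1 - of_real r * cis t)" by simp
      from sums_minus[OF sums_Im[OF this]]
      have "(\<lambda>n. - Im (- ((of_real r * cis t) ^ n) / of_nat n)) sums - Im (Ln (1 - of_real r * cis t))" .
      hence "(\<lambda>n. - Im (- ((of_real r * cis t) ^ Suc n) / of_nat (Suc n))) sums - Im (Ln (1 - of_real r * cis t))"
        by (subst sums_Suc_iff) simp
      moreover have "- Im (- ((of_real r * cis t) ^ Suc n) / of_nat (Suc n)) = d n t" for n
      proof -
        have "(of_real r * cis t) ^ Suc n = of_real (r ^ Suc n) * cis (real (Suc n) * t)"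
          by (simp only: power_mult_distrib Complex.DeMoivre of_real_power)
        hence "- ((of_real r * cis t) ^ Suc n) / of_nat (Suc n) = - (of_real (r ^ Suc n / real (Suc n)) * cis (real (Suc n) * t))" by simp
        thus ?thesis by (simp add: d_def del: of_nat_Suc power_Suc)
      qed
      ultimately show ?thesis by (simp add: sums_iff)
    qed
    ultimately have "((\<lambda>t. - Im (Ln (1 - of_real r * cis t))) has_integral (C r \<theta> - C r 0)) {0..\<theta>}"
      by (intro fundamental_theorem_of_calculus \<theta>)
         (auto simp: has_real_derivative_iff_has_vector_derivative[symmetric] intro: has_field_derivative_at_within)
    thus ?thesis by (simp add: C_def e_def)
  qed
  define r where "r = (\<lambda>j::nat. 1 - 1 / real (Suc j))"
  have r: "0 \<le> r j" "r j < 1" for j by (auto simp: r_def)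
  have r_lim: "r \<longlonglongrightarrow> 1" unfolding r_def by real_asymp
  \<comment> \<open>At t = 0 and t = 2 pi the argument 1 - r is a positive real for all r < 1, so
    the limit there is 0 and not (pi - t) / 2. The two points do not affect the integral.\<close>
  define L where "L = (\<lambda>t. if t = 0 \<or> t = 2 * pi then 0 else (pi - t) / 2)"
  have "(\<lambda>j. integral {0..\<theta>} (\<lambda>t. - Im (Ln (1 - of_real (r j) * cis t)))) \<longlonglongrightarrow> integral {0..\<theta>} L"
  proof (rule dominated_convergence(2))
    show "(\<lambda>t. - Im (Ln (1 - of_real (r j) * cis t))) integrable_on {0..\<theta>}" for j
      using int[OF r] by blast
    show "(\<lambda>_. pi) integrable_on {0..\<theta>}" by (rule integrable_const_ivl)
    have re: "0 < Re (1 - of_real (r j) * cis t)" for j t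
    proof -
      have "r j * cos t \<le> r j * 1" using r[of j] by (intro mult_left_mono) auto
      with r[of j] show ?thesis by simp
    qed
    hence "1 - of_real (r j) * cis t \<noteq> 0" for j t by (metis less_irrefl zero_complex.simps(1))
    thus "norm (- Im (Ln (1 - of_real (r j) * cis t))) \<le> pi" for j t
      using mpi_less_Im_Ln[of "1 - of_real (r j) * cis t"] Im_Ln_le_pi[of "1 - of_real (r j) * cis t"] 
      by (simp add: abs_le_iff)
    show "(\<lambda>j. - Im (Ln (1 - of_real (r j) * cis t))) \<longlonglongrightarrow> L t" if t: "t \<in> {0..\<theta>}" for t
    proof (cases "t = 0 \<or> t = 2 * pi")
      case True
      hence "- Im (Ln (1 - of_real (r j) * cis t)) = 0" for j
      proof -
        have "cis t = 1" using True by (auto simp: complex_eq_iff)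
        hence "1 - of_real (r j) * cis t = of_real (1 - r j)" by simp
        thus ?thesis using r[of j] by (metis Im_Ln_of_real add.inverse_neutral diff_gt_0_iff_gt Im_complex_of_real Ln_of_real)
      qed
      thus ?thesis using True by (simp add: L_def)
    next
      case False
      hence t': "0 < t" "t < 2 * pi" using t \<theta> by auto
      have "Re (1 - cis t) > 0" 
      proof -
        have "sin (t / 2) > 0" using t' by (intro sin_gt_zero) auto
        moreover have "cos t = 1 - 2 * (sin (t / 2))\<^sup>2" using cos_double_sin[of "t / 2"] by simp
        ultimately show ?thesis by simp
      qed
      hence "1 - cis t \<notin> \<real>\<^sub>\<le>\<^sub>0" by (auto simp: complex_nonpos_Reals_iff)
      have "(\<lambda>j. - Im (Ln (1 - of_real (r j) * cis t))) \<longlonglongrightarrow> - Im (Ln (1 - of_real 1 * cis t))"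
        by (intro tendsto_intros r_lim tendsto_Ln) (use \<open>1 - cis t \<notin> _\<close> in simp)
      moreover have "- ((t - pi) / 2) = L t" using False by (simp add: L_def minus_divide_left)
      ultimately show ?thesis using Im_Ln_one_minus_cis[OF t'] by simp
    qed
  qed
  moreover have "integral {0..\<theta>} (\<lambda>t. - Im (Ln (1 - of_real (r j) * cis t))) = C (r j) \<theta>" for j
    using int[OF r] by (rule integral_unique)
  moreover have "(\<lambda>j. C (r j) \<theta>) \<longlonglongrightarrow> C 1 \<theta>"
    by (rule continuous_on_tendsto_compose[OF contC r_lim]) (use r in \<open>auto simp: less_imp_le\<close>)
  ultimately have "C 1 \<theta> = integral {0..\<theta>} L" using LIMSEQ_unique by simp
  also have "(L has_integral (pi * \<theta> / 2 - \<theta>\<^sup>2 / 4)) {0..\<theta>}"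
  proof (rule has_integral_spike[of "{0, 2 * pi}"])
    have "((\<lambda>t. (pi - t) / 2) has_integral (pi * \<theta> / 2 - \<theta>\<^sup>2 / 4) - (pi * 0 / 2 - 0\<^sup>2 / 4)) {0..\<theta>}"
      by (intro fundamental_theorem_of_calculus \<theta>)
         (auto intro!: derivative_eq_intros simp: has_real_derivative_iff_has_vector_derivative[symmetric] field_simps)
    thus "((\<lambda>t. (pi - t) / 2) has_integral (pi * \<theta> / 2 - \<theta>\<^sup>2 / 4)) {0..\<theta>}" by simp
  qed (auto simp: L_def)
  hence "integral {0..\<theta>} L = pi * \<theta> / 2 - \<theta>\<^sup>2 / 4" by (rule integral_unique)
  finally have "C 1 \<theta> = pi * \<theta> / 2 - \<theta>\<^sup>2 / 4" .
  moreover have "(\<lambda>n. e 1 n \<theta>) sums C 1 \<theta>" unfolding C_def by (intro summable_sums summ) auto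
  ultimately show ?thesis by (simp add: e_def)
qed

subsection \<open>A cosine integral\<close>

text \<open>The substitution t = u^2 / (1 + u^2) turns the Beta integral into twice this one. The
  parameters a and b have sum 1, so the Beta value is Gamma a * Gamma (1 - a), and the reflection
  formula evaluates it.\<close>

lemma has_integral_powr_over_one_plus_square:
  fixes \<alpha> :: real
  assumes \<alpha>: "0 < \<alpha>" "\<alpha> < 1"
  shows "((\<lambda>u. u powr (-\<alpha>) / (1 + u\<^sup>2)) has_integral (pi / (2 * cos (pi * \<alpha> / 2)))) {0<..}"
proof -
  define a b where "a = (1 - \<alpha>) / 2" and "b = (1 + \<alpha>) / 2"
  have ab: "a > 0" "b > 0" "a + b = 1" using \<alpha> by (auto simp: a_def b_def field_simps)
  define f where "f = (\<lambda>t::real. t powr (a - 1) * (1 - t) powr (b - 1))"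
  define g where "g = (\<lambda>u::real. u\<^sup>2 / (1 + u\<^sup>2))"
  define g' where "g' = (\<lambda>u::real. 2 * u / (1 + u\<^sup>2)\<^sup>2)"
  have pos: "1 + u\<^sup>2 > 0" for u :: real by (rule add_pos_nonneg) auto
  have "(f has_integral Beta a b) {0..1}" unfolding f_def by (rule has_integral_Beta_real) (use ab in auto)
  hence fI: "(f has_integral Beta a b) {0<..<1}" by (simp add: has_integral_Icc_iff_Ioo)
  hence "f absolutely_integrable_on {0<..<1}"
    by (intro nonnegative_absolutely_integrable_1) (auto simp: f_def)
  moreover have "g ` {0<..} = {0<..<1}"
  proof (intro equalityI subsetI)
    fix t :: real assume t: "t \<in> {0<..<1}"
    have "1 + t / (1 - t) = 1 / (1 - t)" using t by (simp add: field_simps)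
    hence "g (sqrt (t / (1 - t))) = t" using t by (simp add: g_def)
    moreover have "sqrt (t / (1 - t)) \<in> {0<..}" using t by simp
    ultimately show "t \<in> g ` {0<..}" by (metis image_eqI)
  next
    fix t assume "t \<in> g ` {0<..}"
    thus "t \<in> {0<..<1}" using pos by (auto simp: g_def divide_less_eq)
  qed
  moreover have "inj_on g {0<..}"
  proof (rule inj_onI)
    fix x y :: real assume xy: "x \<in> {0<..}" "y \<in> {0<..}" "g x = g y"
    have "x\<^sup>2 * (1 + y\<^sup>2) = y\<^sup>2 * (1 + x\<^sup>2)" using xy(3) pos[of x] pos[of y] by (simp add: g_def field_simps)
    hence "x\<^sup>2 = y\<^sup>2" by (simp add: algebra_simps)
    thus "x = y" using xy by (simp add: power2_eq_iff_nonneg)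
  qed
  moreover have "(g has_field_derivative g' u) (at u within {0<..})" for u
    unfolding g_def g'_def using pos[of u]
    by (auto intro!: derivative_eq_intros simp: field_simps power2_eq_square)
  ultimately have "(\<lambda>u. \<bar>g' u\<bar> * f (g u)) absolutely_integrable_on {0<..} \<and>
      integral {0<..} (\<lambda>u. \<bar>g' u\<bar> * f (g u)) = Beta a b"
    using fI by (subst has_absolute_integral_change_of_variables_1') (auto simp: integral_unique)
  hence "((\<lambda>u. \<bar>g' u\<bar> * f (g u)) has_integral Beta a b) {0<..}"
    using set_lebesgue_integral_eq_integral(1) integrable_integral by metis
  also have "?this \<longleftrightarrow> ((\<lambda>u. 2 * (u powr (-\<alpha>) / (1 + u\<^sup>2))) has_integral Beta a b) {0<..}"
  proof (rule has_integral_cong)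
    fix u :: real assume "u \<in> {0<..}"
    hence u: "u > 0" by simp
    have "1 - g u = 1 / (1 + u\<^sup>2)" using pos[of u] by (simp add: g_def field_simps)
    moreover have "(u\<^sup>2) powr (a - 1) = u powr (-\<alpha> - 1)"
    proof -
      have "2 * (a - 1) = -\<alpha> - 1" by (simp add: a_def field_simps)
      moreover have "u\<^sup>2 = u powr 2" using u by (simp add: powr_numeral)
      ultimately show ?thesis by (metis powr_powr)
    qed
    ultimately have "f (g u) = u powr (-\<alpha> - 1) / (1 + u\<^sup>2) powr (a - 1) * (1 / (1 + u\<^sup>2) powr (b - 1))"
      using pos[of u] unfolding f_def by (simp add: g_def powr_divide)
    also have "\<dots> = u powr (-\<alpha> - 1) / (1 + u\<^sup>2) powr (-1)"
      using ab pos[of u] by (simp add: powr_add[symmetric] algebra_simps) 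
    also have "(1 + u\<^sup>2) powr (-1) = 1 / (1 + u\<^sup>2)" using pos[of u] by (simp add: powr_minus_divide)
    finally have "f (g u) = u powr (-\<alpha> - 1) * (1 + u\<^sup>2)" by simp
    moreover have "u powr (-\<alpha>) = u powr (-\<alpha> - 1) * u" using u by (simp add: powr_diff)
    ultimately show "\<bar>g' u\<bar> * f (g u) = 2 * (u powr (-\<alpha>) / (1 + u\<^sup>2))"
      using u pos[of u] by (simp add: g'_def power2_eq_square)
  qed
  finally have "((\<lambda>u. (1/2) * (2 * (u powr (-\<alpha>) / (1 + u\<^sup>2)))) has_integral (1/2 * Beta a b)) {0<..}"
    by (rule has_integral_mult_right)
  moreover have "Beta a b = pi / cos (pi * \<alpha> / 2)"
  proof -
    have "Gamma (complex_of_real a) * Gamma (1 - complex_of_real a) = of_real pi / sin (of_real pi * of_real a)"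
      by (rule Gamma_reflection_complex)
    also have "1 - complex_of_real a = of_real b" using ab by (simp add: complex_eq_iff)
    finally have "complex_of_real (Gamma a * Gamma b) = of_real (pi / sin (pi * a))"
      by (simp add: Gamma_complex_of_real sin_of_real[symmetric])
    hence "Gamma a * Gamma b = pi / sin (pi * a)" by (simp only: of_real_eq_iff)
    moreover have "sin (pi * a) = cos (pi * \<alpha> / 2)"
      by (simp add: a_def sin_cos_eq field_simps)
    ultimately show ?thesis using ab by (simp add: Beta_def)
  qed
  ultimately show ?thesis by (simp add: mult.commute)
qed

text \<open>The Laplace transform 1 / u - u / (1 + u^2) of 1 - cos, from an explicit antiderivative
  that tends to 0 at infinity. It is stated as a nonnegative integral so that Tonelli's theorem can
  be applied to it.\<close>

lemma nn_integral_one_minus_cos_exp: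
  assumes u: "u > (0::real)"
  shows "(\<integral>\<^sup>+y. ennreal ((1 - cos y) * exp (- u * y)) * indicator {0..} y \<partial>lborel) = ennreal (1 / (u * (1 + u\<^sup>2)))"
proof -
  define F where "F = (\<lambda>y. - exp (- u * y) / u - exp (- u * y) * (sin y - u * cos y) / (1 + u\<^sup>2))"
  have pos: "1 + u\<^sup>2 > 0" by (rule add_pos_nonneg) auto
  have "(\<integral>\<^sup>+y. ennreal ((1 - cos y) * exp (- u * y)) * indicator {0..} y \<partial>lborel) = ennreal (0 - F 0)"
  proof (rule nn_integral_FTC_atLeast)
    show "DERIV F y :> (1 - cos y) * exp (- u * y)" for y
    proof -
      have 1: "DERIV (\<lambda>y. - exp (- u * y)) y :> u * exp (- u * y)"
        by (auto intro!: derivative_eq_intros)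
      have 2: "DERIV (\<lambda>y. exp (- u * y) * (sin y - u * cos y)) y :>
          - u * exp (- u * y) * (sin y - u * cos y) + exp (- u * y) * (cos y + u * sin y)"
        by (auto intro!: derivative_eq_intros simp: algebra_simps)
      have "DERIV F y :> u * exp (- u * y) / u - (- u * exp (- u * y) * (sin y - u * cos y) + exp (- u * y) * (cos y + u * sin y)) / (1 + u\<^sup>2)"
        unfolding F_def by (intro DERIV_diff DERIV_cdivide 1 2)
      also have "- u * exp (- u * y) * (sin y - u * cos y) + exp (- u * y) * (cos y + u * sin y) = (exp (- u * y) * cos y) * (1 + u\<^sup>2)"
        by (simp add: algebra_simps power2_eq_square)
      also have "u * exp (- u * y) / u - (exp (- u * y) * cos y) * (1 + u\<^sup>2) / (1 + u\<^sup>2) = (1 - cos y) * exp (- u * y)"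
      proof -
        have *: "E * (1 + u\<^sup>2) / (1 + u\<^sup>2) = E" for E using pos by simp
        show ?thesis unfolding * using u by (simp add: algebra_simps)
      qed
      finally show ?thesis .
    qed
    have lim0: "((\<lambda>y. exp (- u * y)) \<longlongrightarrow> 0) at_top" using u by real_asymp
    have "((\<lambda>y. exp (- u * y) * (sin y - u * cos y)) \<longlongrightarrow> 0) at_top"
    proof -
      have "((\<lambda>y. exp (- u * y) * (1 + u)) \<longlongrightarrow> 0 * (1 + u)) at_top" 
        by (intro tendsto_intros lim0)
      hence lim: "((\<lambda>y. exp (- u * y) * (1 + u)) \<longlongrightarrow> 0) at_top" by simp
      show ?thesis
      proof (rule Lim_null_comparison[OF always_eventually lim], rule allI)
        fix y :: real
        have "\<bar>sin y - u * cos y\<bar> \<le> \<bar>sin y\<bar> + \<bar>u * cos y\<bar>" by linarith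
        also have "\<dots> \<le> 1 + u * 1" using u by (intro add_mono) (auto simp: abs_mult intro!: mult_left_mono)
        finally show "norm (exp (- u * y) * (sin y - u * cos y)) \<le> exp (- u * y) * (1 + u)"
          by (simp add: abs_mult)
      qed
    qed
    hence "(F \<longlongrightarrow> - 0 / u - 0 / (1 + u\<^sup>2)) at_top" 
      unfolding F_def using u pos by (intro tendsto_intros lim0) auto
    thus "(F \<longlongrightarrow> 0) at_top" by simp
  qed (auto)
  also have "0 - F 0 = 1 / (u * (1 + u\<^sup>2))" 
    using u pos by (simp add: F_def divide_simps) (simp add: power2_eq_square algebra_simps)
  finally show ?thesis .
qed

lemma nn_integral_powr_exp:
  assumes "s > (0::real)" "y > 0"
  shows "(\<integral>\<^sup>+u. ennreal (u powr (s - 1) * exp (- u * y)) * indicator {0..} u \<partial>lborel) = ennreal (Gamma s * y powr (-s))" (is "?I = _")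
proof -
  have "ennreal (Gamma s) = (\<integral>\<^sup>+t. ennreal (indicator {0..} t * t powr (s - 1) / exp t) \<partial>lborel)"
    using Gamma_conv_nn_integral_real[OF assms(1)] .
  also have "\<dots> = ennreal \<bar>y\<bar> * (\<integral>\<^sup>+u. ennreal (indicator {0..} (0 + y * u) * (0 + y * u) powr (s - 1) / exp (0 + y * u)) \<partial>lborel)"
    by (rule nn_integral_real_affine) (use assms in auto)
  also have "(\<integral>\<^sup>+u. ennreal (indicator {0..} (0 + y * u) * (0 + y * u) powr (s - 1) / exp (0 + y * u)) \<partial>lborel)
      = (\<integral>\<^sup>+u. ennreal (y powr (s - 1)) * (ennreal (u powr (s - 1) * exp (- u * y)) * indicator {0..} u) \<partial>lborel)"
    using assms by (intro nn_integral_cong)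
      (auto simp: indicator_def powr_mult exp_minus field_simps ennreal_mult'[symmetric] zero_le_mult_iff)
  also have "\<dots> = ennreal (y powr (s - 1)) * ?I"
    by (rule nn_integral_cmult) auto
  finally have eq: "ennreal (Gamma s) = ennreal (y powr s) * ?I"
    using assms by (simp add: mult.assoc[symmetric] ennreal_mult'[symmetric] powr_diff)
  have "ennreal (Gamma s * y powr (-s)) = ennreal (y powr (-s)) * ennreal (Gamma s)"
    using assms by (simp add: ennreal_mult'[symmetric] mult.commute)
  also have "\<dots> = (ennreal (y powr (-s)) * ennreal (y powr s)) * ?I"
    unfolding eq by (simp add: mult.assoc)
  also have "ennreal (y powr (-s)) * ennreal (y powr s) = 1"
    using assms by (simp add: ennreal_mult'[symmetric] powr_add[symmetric])
  finally show ?thesis by simp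
qed

text \<open>Writing Gamma (2 - \<alpha>) y powr (\<alpha> - 2) as an integral of u powr (1 -
  \<alpha>) exp (- u y) over u and exchanging the integrals leaves the Laplace transform of 1 - cos,
  and then the preceding Beta integral. With 1 - cos in place of cos everything is nonnegative and
  the integral converges at both ends.\<close>

lemma nn_integral_one_minus_cos_powr:
  fixes \<alpha> :: real
  assumes \<alpha>: "0 < \<alpha>" "\<alpha> < 1"
  shows "(\<integral>\<^sup>+y. ennreal ((1 - cos y) * y powr (\<alpha> - 2)) * indicator {0..} y \<partial>lborel) =
    ennreal (pi / (2 * Gamma (2 - \<alpha>) * cos (pi * \<alpha> / 2)))"
proof -
  have G: "Gamma (2 - \<alpha>) > 0" using \<alpha> by (intro Gamma_real_pos) auto
  let ?K = "\<integral>\<^sup>+y. ennreal ((1 - cos y) * y powr (\<alpha> - 2)) * indicator {0..} y \<partial>lborel"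
  let ?h = "\<lambda>u y. ennreal ((1 - cos y) * exp (- u * y)) * indicator {0..} y * (ennreal (u powr (1 - \<alpha>)) * indicator {0..} u)"
  have "ennreal (Gamma (2 - \<alpha>)) * ?K = (\<integral>\<^sup>+y. ennreal (Gamma (2 - \<alpha>)) * (ennreal ((1 - cos y) * y powr (\<alpha> - 2)) * indicator {0..} y) \<partial>lborel)"
    by (rule nn_integral_cmult[symmetric]) auto
  also have "\<dots> = (\<integral>\<^sup>+y. (\<integral>\<^sup>+u. ?h u y \<partial>lborel) \<partial>lborel)"
  proof (rule nn_integral_cong)
    fix y :: real
    have "(\<integral>\<^sup>+u. ?h u y \<partial>lborel) = (\<integral>\<^sup>+u. (ennreal (1 - cos y) * indicator {0..} y) * (ennreal (u powr ((2 - \<alpha>) - 1) * exp (- u * y)) * indicator {0..} u) \<partial>lborel)"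
      by (intro nn_integral_cong) (auto simp: indicator_def ennreal_mult'[symmetric] mult_ac)
    also have "\<dots> = (ennreal (1 - cos y) * indicator {0..} y) * (\<integral>\<^sup>+u. ennreal (u powr ((2 - \<alpha>) - 1) * exp (- u * y)) * indicator {0..} u \<partial>lborel)"
      by (rule nn_integral_cmult) auto
    also have "\<dots> = ennreal (Gamma (2 - \<alpha>)) * (ennreal ((1 - cos y) * y powr (\<alpha> - 2)) * indicator {0..} y)"
    proof (cases "y > 0")
      case True
      thus ?thesis using G \<alpha> 
        by (subst nn_integral_powr_exp) (auto simp: ennreal_mult'[symmetric] mult_ac)
    next
      case False
      thus ?thesis by (cases "y = 0") auto
    qed
    finally show "ennreal (Gamma (2 - \<alpha>)) * (ennreal ((1 - cos y) * y powr (\<alpha> - 2)) * indicator {0..} y) = (\<integral>\<^sup>+u. ?h u y \<partial>lborel)" ..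
  qed
  also have "\<dots> = (\<integral>\<^sup>+u. (\<integral>\<^sup>+y. ?h u y \<partial>lborel) \<partial>lborel)"
    by (rule lborel_pair.Fubini') measurable
  also have "\<dots> = (\<integral>\<^sup>+u. ennreal (u powr (-\<alpha>) / (1 + u\<^sup>2)) * indicator {0<..} u \<partial>lborel)"
  proof (rule nn_integral_cong)
    fix u :: real
    have pos: "1 + u\<^sup>2 > 0" by (rule add_pos_nonneg) auto
    have "(\<integral>\<^sup>+y. ?h u y \<partial>lborel) = (\<integral>\<^sup>+y. ennreal ((1 - cos y) * exp (- u * y)) * indicator {0..} y \<partial>lborel) * (ennreal (u powr (1 - \<alpha>)) * indicator {0..} u)"
      by (rule nn_integral_multc) auto
    also have "\<dots> = ennreal (u powr (-\<alpha>) / (1 + u\<^sup>2)) * indicator {0<..} u"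
    proof (cases "u > 0")
      case True
      have "u powr (1 - \<alpha>) = u * u powr (-\<alpha>)" using True by (simp add: powr_diff powr_minus field_simps)
      thus ?thesis using True pos unfolding nn_integral_one_minus_cos_exp[OF True]
        by (simp add: ennreal_mult'[symmetric])
    next
      case False
      thus ?thesis by (cases "u = 0") auto
    qed
    finally show "(\<integral>\<^sup>+y. ?h u y \<partial>lborel) = ennreal (u powr (-\<alpha>) / (1 + u\<^sup>2)) * indicator {0<..} u" .
  qed
  also have "\<dots> = ennreal (pi / (2 * cos (pi * \<alpha> / 2)))"
    by (rule nn_integral_has_integral_lebesgue'[OF _ has_integral_powr_over_one_plus_square[OF \<alpha>]]) 
       (auto intro!: divide_nonneg_nonneg)
  finally have eq: "ennreal (Gamma (2 - \<alpha>)) * ?K = ennreal (pi / (2 * cos (pi * \<alpha> / 2)))" .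
  have "?K = (ennreal (1 / Gamma (2 - \<alpha>)) * ennreal (Gamma (2 - \<alpha>))) * ?K"
    using G by (simp add: ennreal_mult'[symmetric])
  also have "\<dots> = ennreal (1 / Gamma (2 - \<alpha>)) * ennreal (pi / (2 * cos (pi * \<alpha> / 2)))"
    using eq by (simp add: mult.assoc)
  also have "\<dots> = ennreal (pi / (2 * Gamma (2 - \<alpha>) * cos (pi * \<alpha> / 2)))"
    using G by (simp add: ennreal_mult'[symmetric] mult_ac)
  finally show ?thesis .
qed

subsection \<open>Analytic continuation and functional equation of zeta\<close>

text \<open>This is (1/6 - B_2(frac x)) / 2 for the second Bernoulli polynomial B_2, the Peano
  kernel of the trapezoidal rule. It is nonnegative and vanishes at the integers.\<close>

definition sawtooth :: "real \<Rightarrow> real" where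
  "sawtooth x = frac x * (1 - frac x) / 2"

lemma sums_sawtooth:
  "(\<lambda>n. (1 - cos (2 * pi * real (Suc n) * x)) / (2 * pi\<^sup>2 * (real (Suc n))\<^sup>2)) sums sawtooth x"
proof -
  define \<theta> where "\<theta> = 2 * pi * frac x"
  have "0 \<le> \<theta>" "\<theta> \<le> 2 * pi" using frac_lt_1[of x] frac_ge_0[of x] by (auto simp: \<theta>_def)
  hence "(\<lambda>n. (1 - cos (real (Suc n) * \<theta>)) / (real (Suc n))\<^sup>2) sums (pi * \<theta> / 2 - \<theta>\<^sup>2 / 4)"
    by (rule sums_one_minus_cos_over_square)
  hence "(\<lambda>n. (1 - cos (real (Suc n) * \<theta>)) / (real (Suc n))\<^sup>2 / (2 * pi\<^sup>2)) sums ((pi * \<theta> / 2 - \<theta>\<^sup>2 / 4) / (2 * pi\<^sup>2))"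
    by (rule sums_divide)
  moreover have "(pi * \<theta> / 2 - \<theta>\<^sup>2 / 4) / (2 * pi\<^sup>2) = sawtooth x"
    by (simp add: \<theta>_def sawtooth_def divide_simps power2_eq_square algebra_simps)
  moreover have "cos (real (Suc n) * \<theta>) = cos (2 * pi * real (Suc n) * x)" for n
  proof -
    have "2 * pi * real (Suc n) * x = real (Suc n) * \<theta> + 2 * pi * of_int (int (Suc n) * \<lfloor>x\<rfloor>)"
      by (simp add: \<theta>_def frac_def algebra_simps)
    thus ?thesis by (simp only: cos_add cos_int_2pin sin_int_2pin)
  qed
  ultimately show ?thesis by (simp add: mult_ac)
qed

lemma borel_measurable_sawtooth [measurable]: "sawtooth \<in> borel_measurable borel"
  unfolding sawtooth_def[abs_def] frac_def by measurable

text \<open>The Fourier series of the kernel is a sum of nonnegative terms 1 - cos (2 pi n x), so it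
  may be integrated termwise; each term is a rescaling of the integral just computed.\<close>

lemma nn_integral_sawtooth_eq_suminf:
  fixes \<alpha> :: real
  assumes \<alpha>: "0 < \<alpha>" "\<alpha> < 1"
  defines "K \<equiv> pi / (2 * Gamma (2 - \<alpha>) * cos (pi * \<alpha> / 2))"
  shows "(\<integral>\<^sup>+x. ennreal (sawtooth x * x powr (\<alpha> - 2)) * indicator {0..} x \<partial>lborel) =
    (\<Sum>n. ennreal ((2 * pi * real (Suc n)) powr (1 - \<alpha>) / (2 * pi\<^sup>2 * (real (Suc n))\<^sup>2) * K))"
proof -
  let ?c = "\<lambda>n. 1 / (2 * pi\<^sup>2 * (real (Suc n))\<^sup>2)"
  let ?g = "\<lambda>n x. ennreal ((1 - cos (2 * pi * real (Suc n) * x)) * x powr (\<alpha> - 2)) * indicator {0..} x"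
  let ?J = "\<lambda>c. \<integral>\<^sup>+x. ennreal ((1 - cos (c * x)) * x powr (\<alpha> - 2)) * indicator {0..} x \<partial>lborel"
  have scale: "?J c = ennreal (c powr (1 - \<alpha>) * K)"
    if c: "c > 0" for c
  proof -
    have "ennreal K = (\<integral>\<^sup>+y. ennreal ((1 - cos y) * y powr (\<alpha> - 2)) * indicator {0..} y \<partial>lborel)"
      unfolding K_def using nn_integral_one_minus_cos_powr[OF \<alpha>] ..
    also have "\<dots> = ennreal \<bar>c\<bar> * (\<integral>\<^sup>+x. ennreal ((1 - cos (0 + c * x)) * (0 + c * x) powr (\<alpha> - 2)) * indicator {0..} (0 + c * x) \<partial>lborel)"
      by (rule nn_integral_real_affine) (use c in auto)
    also have "(\<integral>\<^sup>+x. ennreal ((1 - cos (0 + c * x)) * (0 + c * x) powr (\<alpha> - 2)) * indicator {0..} (0 + c * x) \<partial>lborel)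
       = (\<integral>\<^sup>+x. ennreal (c powr (\<alpha> - 2)) * (ennreal ((1 - cos (c * x)) * x powr (\<alpha> - 2)) * indicator {0..} x) \<partial>lborel)"
      using c by (intro nn_integral_cong)
        (auto simp: indicator_def powr_mult ennreal_mult'[symmetric] zero_le_mult_iff mult_ac)
    also have "\<dots> = ennreal (c powr (\<alpha> - 2)) * ?J c"
      by (rule nn_integral_cmult) auto
    finally have eq: "ennreal K = ennreal (c powr (\<alpha> - 1)) * ?J c"
      using c by (simp add: mult.assoc[symmetric] ennreal_mult'[symmetric] powr_diff power2_eq_square)
    have "ennreal (c powr (1 - \<alpha>) * K) = ennreal (c powr (1 - \<alpha>)) * ennreal K"
      by (rule ennreal_mult') auto
    also have "\<dots> = (ennreal (c powr (1 - \<alpha>)) * ennreal (c powr (\<alpha> - 1))) * ?J c"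
      unfolding eq by (simp add: mult.assoc)
    also have "ennreal (c powr (1 - \<alpha>)) * ennreal (c powr (\<alpha> - 1)) = 1"
      using c by (simp add: ennreal_mult'[symmetric] powr_add[symmetric])
    finally show ?thesis by simp
  qed
  have "(\<integral>\<^sup>+x. ennreal (sawtooth x * x powr (\<alpha> - 2)) * indicator {0..} x \<partial>lborel) =
    (\<integral>\<^sup>+x. (\<Sum>n. ennreal (?c n) * ?g n x) \<partial>lborel)"
  proof (rule nn_integral_cong)
    fix x :: real
    have "(\<lambda>n. (1 - cos (2 * pi * real (Suc n) * x)) / (2 * pi\<^sup>2 * (real (Suc n))\<^sup>2) * x powr (\<alpha> - 2)) sums (sawtooth x * x powr (\<alpha> - 2))"
      by (intro sums_mult2 sums_sawtooth)
    hence "(\<Sum>n. ennreal ((1 - cos (2 * pi * real (Suc n) * x)) / (2 * pi\<^sup>2 * (real (Suc n))\<^sup>2) * x powr (\<alpha> - 2)))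
        = ennreal (sawtooth x * x powr (\<alpha> - 2))"
      by (rule suminf_ennreal_eq[rotated]) (intro mult_nonneg_nonneg divide_nonneg_nonneg, auto)
    hence "ennreal (sawtooth x * x powr (\<alpha> - 2)) = 
      (\<Sum>n. ennreal ((1 - cos (2 * pi * real (Suc n) * x)) / (2 * pi\<^sup>2 * (real (Suc n))\<^sup>2) * x powr (\<alpha> - 2)))" ..
    also have "\<dots> = (\<Sum>n. ennreal (?c n) * ennreal ((1 - cos (2 * pi * real (Suc n) * x)) * x powr (\<alpha> - 2)))"
    proof (rule suminf_cong)
      fix n
      have "(1 - cos (2 * pi * real (Suc n) * x)) / (2 * pi\<^sup>2 * (real (Suc n))\<^sup>2) * x powr (\<alpha> - 2)
        = ?c n * ((1 - cos (2 * pi * real (Suc n) * x)) * x powr (\<alpha> - 2))" by simp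
      thus "ennreal ((1 - cos (2 * pi * real (Suc n) * x)) / (2 * pi\<^sup>2 * (real (Suc n))\<^sup>2) * x powr (\<alpha> - 2))
        = ennreal (?c n) * ennreal ((1 - cos (2 * pi * real (Suc n) * x)) * x powr (\<alpha> - 2))"
        by (simp only: ennreal_mult'[symmetric] zero_le_divide_1_iff zero_le_mult_iff zero_le_power2) 
           (subst ennreal_mult', auto)
    qed
    finally show "ennreal (sawtooth x * x powr (\<alpha> - 2)) * indicator {0..} x =
      (\<Sum>n. ennreal (?c n) * ?g n x)"
      by (simp only: ennreal_suminf_multc[symmetric] mult.assoc)
  qed
  also have "\<dots> = (\<Sum>n. \<integral>\<^sup>+x. ennreal (?c n) * ?g n x \<partial>lborel)"
    by (rule nn_integral_suminf) auto
  also have "\<dots> = (\<Sum>n. ennreal ((2 * pi * real (Suc n)) powr (1 - \<alpha>) / (2 * pi\<^sup>2 * (real (Suc n))\<^sup>2) * K))"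
  proof (rule suminf_cong)
    fix n
    have "(\<integral>\<^sup>+x. ennreal (?c n) * ?g n x \<partial>lborel)
      = ennreal (?c n) * ennreal ((2 * pi * real (Suc n)) powr (1 - \<alpha>) * K)"
      by (subst nn_integral_cmult, measurable) (subst scale, auto)
    also have "\<dots> = ennreal ((2 * pi * real (Suc n)) powr (1 - \<alpha>) / (2 * pi\<^sup>2 * (real (Suc n))\<^sup>2) * K)"
      by (subst ennreal_mult'[symmetric]) auto
    finally show "(\<integral>\<^sup>+x. ennreal (?c n) * ?g n x \<partial>lborel)
      = ennreal ((2 * pi * real (Suc n)) powr (1 - \<alpha>) / (2 * pi\<^sup>2 * (real (Suc n))\<^sup>2) * K)" .
  qed
  finally show ?thesis .
qed

section \<open>Euler-Maclaurin continuation of (s - 1) \<zeta>(s) to Re s > -1\<close>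

text \<open>The error of the trapezoidal rule for \<open>x powr (-s)\<close> on \<open>{n..n+1}\<close>, multiplied by \<open>s - 1\<close>.\<close>

definition zeta_summand :: "nat \<Rightarrow> complex \<Rightarrow> complex" where
  "zeta_summand n s = (s - 1) * (of_nat (Suc n) powr (-s) + of_nat (Suc (Suc n)) powr (-s)) / 2
     - (of_nat (Suc n) powr (1 - s) - of_nat (Suc (Suc n)) powr (1 - s))"

lemma has_integral_zeta_summand:
  "((\<lambda>x. of_real ((x - real (Suc n)) * (real (Suc (Suc n)) - x) / 2) * (s * (s + 1) * (s - 1) * of_real x powr (-s - 2)))
    has_integral zeta_summand n s) {real (Suc n)..real (Suc (Suc n))}"
proof -
  define N where "N = real (Suc n)"
  have N: "real (Suc (Suc n)) = N + 1" "N > 0" by (auto simp: N_def)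
  \<comment> \<open>Two integrations by parts of the kernel k(x) = (x - N) (N + 1 - x) / 2 against
    the second derivative of x powr (-s) leave boundary terms and, as k'' = -1, an antiderivative of
    - x powr (-s). The factor s - 1 cancels the denominator of the latter, so s = 1 is no
    exception.\<close>
  define Q where "Q = (\<lambda>x. (s - 1) * (((x - of_real N) * (of_real N + 1 - x) / 2) * (- s * x powr (-s - 1))
     - (2 * of_real N + 1 - 2 * x) / 2 * x powr (-s)) + x powr (1 - s))"
  have "((\<lambda>x. of_real ((x - N) * (N + 1 - x) / 2) * (s * (s + 1) * (s - 1) * of_real x powr (-s - 2)))
    has_integral (Q (of_real (N + 1)) - Q (of_real N))) {N..N + 1}"
  proof (rule fundamental_theorem_of_calculus)
    fix x assume x: "x \<in> {N..N + 1}"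
    hence x0: "x > 0" using N by auto
    hence nn: "complex_of_real x \<notin> \<real>\<^sub>\<le>\<^sub>0" by auto
    have p1: "of_real x powr (-s - 1) = of_real x * of_real x powr (-s - 2 :: complex)"
      and p0: "of_real x powr (-s) = of_real x * (of_real x * of_real x powr (-s - 2 :: complex))"
      using x0 by (simp_all add: powr_diff powr_numeral power2_eq_square field_simps)
    define w where "w = complex_of_real x"
    have D: "((\<lambda>z. z powr c) has_field_derivative c * w powr d) (at w)" if "d = c - 1" for c d
      using has_field_derivative_powr[of w c] nn that by (simp add: w_def)
    have D1: "((\<lambda>z. - s * z powr (-s - 1)) has_field_derivative - s * ((-s - 1) * w powr (-s - 2))) (at w)"
      by (intro DERIV_cmult D) simp
    have D2: "((\<lambda>z. z powr (-s)) has_field_derivative (-s) * w powr (-s - 1)) (at w)"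
      and D3: "((\<lambda>z. z powr (1 - s)) has_field_derivative (1 - s) * w powr (-s)) (at w)"
      by (intro D; simp)+
    have A: "((\<lambda>z. (z - of_real N) * (of_real N + 1 - z) / 2) has_field_derivative (2 * of_real N + 1 - 2 * w) / 2) (at w)"
      by (auto intro!: derivative_eq_intros simp: field_simps)
    have B: "((\<lambda>z. (2 * of_real N + 1 - 2 * z) / 2) has_field_derivative - 1) (at w)"
      by (auto intro!: derivative_eq_intros)
    have "(Q has_field_derivative (w - of_real N) * (of_real N + 1 - w) / 2 * (s * (s + 1) * (s - 1) * w powr (-s - 2))) (at w)"
      unfolding Q_def
      by (rule DERIV_cong[OF DERIV_add[OF DERIV_cmult[OF DERIV_diff[OF DERIV_mult[OF A D1] DERIV_mult[OF B D2]]] D3]])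
         (simp add: w_def p1 p0 field_simps)
    hence "(Q has_field_derivative (of_real x - of_real N) * (of_real N + 1 - of_real x) / 2 * (s * (s + 1) * (s - 1) * of_real x powr (-s - 2))) (at (of_real x))"
      by (simp add: w_def)
    from has_vector_derivative_real_field[OF this]
    show "((\<lambda>x. Q (of_real x)) has_vector_derivative of_real ((x - N) * (N + 1 - x) / 2) * (s * (s + 1) * (s - 1) * of_real x powr (-s - 2))) (at x within {N..N + 1})"
      by (auto intro: has_vector_derivative_at_within)
  qed simp
  also have "Q (of_real (N + 1)) - Q (of_real N) = zeta_summand n s"
    by (simp add: Q_def zeta_summand_def N_def field_simps)
  finally show ?thesis unfolding N_def[symmetric] N(1) .
qed

text \<open>The kernel is at most 1/8 and the integral form gains a factor n^-2 over n powr (-s).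
  The series thus converges for Re s > -1, a half plane that overlaps Re s < 0, where the reflected
  expression is holomorphic.\<close>

lemma norm_zeta_summand_le:
  assumes s: "Re s \<ge> -2"
  shows "norm (zeta_summand n s) \<le> norm (s * (s + 1) * (s - 1)) / 8 * real (Suc n) powr (- Re s - 2)"
proof -
  define N where "N = real (Suc n)"
  have N: "N > 0" by (simp add: N_def)
  have "norm (zeta_summand n s) \<le> norm (s * (s + 1) * (s - 1)) / 8 * N powr (- Re s - 2) * measure lborel (cbox N (N + 1))"
  proof (rule has_integral_bound)
    show "((\<lambda>x. of_real ((x - N) * (N + 1 - x) / 2) * (s * (s + 1) * (s - 1) * of_real x powr (-s - 2))) has_integral zeta_summand n s) (cbox N (N + 1))"
      using has_integral_zeta_summand[of n s] by (simp add: N_def add_ac)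
    fix x assume "x \<in> cbox N (N + 1)"
    hence x: "N \<le> x" "x \<le> N + 1" by auto
    have "0 \<le> (2 * (x - N) - 1)\<^sup>2" by simp
    hence "(x - N) * (N + 1 - x) \<le> 1 / 4" by (simp add: power2_eq_square algebra_simps)
    moreover have "0 \<le> (x - N) * (N + 1 - x)" using x by (intro mult_nonneg_nonneg) auto
    ultimately have "norm (of_real ((x - N) * (N + 1 - x) / 2) :: complex) \<le> 1 / 8" unfolding norm_of_real by simp
    moreover have "norm (of_real x powr (-s - 2) :: complex) = x powr (- Re s - 2)"
      using x N by (simp add: norm_powr_real_powr)
    moreover have "x powr (- Re s - 2) \<le> N powr (- Re s - 2)"
      using x N s by (intro powr_mono2') auto
    ultimately have "norm (of_real ((x - N) * (N + 1 - x) / 2) :: complex) * (norm (s * (s + 1) * (s - 1)) * norm (of_real x powr (-s - 2) :: complex))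
      \<le> 1 / 8 * (norm (s * (s + 1) * (s - 1)) * N powr (- Re s - 2))"
      by (intro mult_mono mult_left_mono) auto
    thus "norm (of_real ((x - N) * (N + 1 - x) / 2) * (s * (s + 1) * (s - 1) * of_real x powr (-s - 2)))
      \<le> norm (s * (s + 1) * (s - 1)) / 8 * N powr (- Re s - 2)" by (simp add: norm_mult mult_ac)
  qed auto
  thus ?thesis by (simp add: N_def)
qed

lemma summable_Suc_powr: "a < -1 \<Longrightarrow> summable (\<lambda>n. real (Suc n) powr a)"
  by (subst summable_Suc_iff) (simp add: summable_real_powr_iff)

lemma norm_zeta_factor_le: "norm (s * (s + 1) * (s - 1) :: complex) \<le> (1 + norm s) ^ 3"
proof -
  have "norm s * norm (s + 1) * norm (s - 1) \<le> (1 + norm s) * (1 + norm s) * (1 + norm s)"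
    using norm_triangle_ineq[of s 1] norm_triangle_ineq4[of s 1] by (intro mult_mono) auto
  thus ?thesis by (simp add: norm_mult power3_eq_cube)
qed

lemma norm_zeta_summand_le_uniform:
  assumes "Re s \<ge> d - 1" "d > 0" "norm s \<le> B"
  shows "norm (zeta_summand n s) \<le> (1 + B) ^ 3 / 8 * real (Suc n) powr (- 1 - d)"
proof -
  have "norm (zeta_summand n s) \<le> norm (s * (s + 1) * (s - 1)) / 8 * real (Suc n) powr (- Re s - 2)"
    using assms by (intro norm_zeta_summand_le) auto
  also have "\<dots> \<le> (1 + B) ^ 3 / 8 * real (Suc n) powr (- 1 - d)"
    using assms order.trans[OF norm_ge_zero assms(3)]
    by (intro mult_mono divide_right_mono powr_mono order.trans[OF norm_zeta_factor_le] power_mono) auto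
  finally show ?thesis .
qed

text \<open>This is (s - 1) \<zeta>(s) on Re s > -1. The first term is (s - 1) / 2 + 1: half of the
  first term of the Dirichlet series, times s - 1, and the value of the telescoping sum.\<close>

definition zeta_right :: "complex \<Rightarrow> complex" where
  "zeta_right s = (s + 1) / 2 + (\<Sum>n. zeta_summand n s)"

lemma summable_zeta_summand: "Re s > -1 \<Longrightarrow> summable (\<lambda>n. zeta_summand n s)"
  by (rule summable_comparison_test'[OF _ norm_zeta_summand_le_uniform[of "Re s + 1" s "norm s"]])
     (auto intro!: summable_mult summable_Suc_powr simp del: of_nat_Suc)

lemma holomorphic_zeta_summand: "zeta_summand n holomorphic_on S"
  unfolding zeta_summand_def[abs_def] by (intro holomorphic_intros) auto

lemma open_Re_greater: "open {s. Re s > c}" and open_Re_less: "open {s. Re s < c}"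
  by (simp_all add: open_halfspace_Re_gt open_halfspace_Re_lt)

lemma holomorphic_zeta_right: "zeta_right holomorphic_on {s. Re s > -1}"
proof -
  have "(\<lambda>s. \<Sum>n. zeta_summand n s) holomorphic_on {s. Re s > -1}"
  proof (rule holomorphic_uniform_sequence[where f = "\<lambda>N s. \<Sum>n<N. zeta_summand n s"])
    show "(\<lambda>s. \<Sum>n<N. zeta_summand n s) holomorphic_on {s. Re s > -1}" for N
      by (intro holomorphic_intros holomorphic_zeta_summand)
    fix z assume z: "z \<in> {s. Re s > -1}"
    define d where "d = (Re z + 1) / 2"
    have d: "d > 0" using z by (simp add: d_def)
    have re: "Re s \<ge> d - 1" "norm s \<le> norm z + d" if "s \<in> cball z d" for s
    proof -
      have "norm (s - z) \<le> d" using that by (simp add: dist_norm norm_minus_commute)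
      with abs_Re_le_cmod[of "s - z"] norm_triangle_ineq[of z "s - z"]
      show "Re s \<ge> d - 1" "norm s \<le> norm z + d" by (auto simp: d_def field_simps)
    qed
    have "uniform_limit (cball z d) (\<lambda>N s. \<Sum>n<N. zeta_summand n s) (\<lambda>s. \<Sum>n. zeta_summand n s) sequentially"
      by (rule Weierstrass_m_test[OF norm_zeta_summand_le_uniform[OF re(1) d re(2)]])
         (use d in \<open>auto intro!: summable_mult summable_Suc_powr simp del: of_nat_Suc\<close>)
    moreover have "cball z d \<subseteq> {s. Re s > -1}" using re(1) d by fastforce
    ultimately show "\<exists>d>0. cball z d \<subseteq> {s. Re s > -1} \<and> uniform_limit (cball z d) (\<lambda>N s. \<Sum>n<N. zeta_summand n s) (\<lambda>s. \<Sum>n. zeta_summand n s) sequentially"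
      using d by blast
  qed (rule open_Re_greater)
  thus ?thesis unfolding zeta_right_def[abs_def] by (intro holomorphic_intros) auto
qed

lemma zeta_right_bound:
  obtains C where "C \<ge> 0" "\<And>s. Re s \<ge> -1/2 \<Longrightarrow> norm (zeta_right s) \<le> C * (1 + norm s) ^ 3"
proof
  define c where "c = (\<Sum>n. real (Suc n) powr (-3/2))"
  have sm: "summable (\<lambda>n. real (Suc n) powr (-3/2))" by (rule summable_Suc_powr) simp
  have c: "c \<ge> 0" unfolding c_def by (intro suminf_nonneg sm) auto
  thus "1 + c / 8 \<ge> 0" by simp
  fix s assume s: "Re s \<ge> -1/2"
  have le: "norm (zeta_summand n s) \<le> (1 + norm s) ^ 3 / 8 * real (Suc n) powr (-3/2)" for n
    using norm_zeta_summand_le_uniform[of "1/2" s "norm s" n] s by simp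
  have "norm (\<Sum>n. zeta_summand n s) \<le> (\<Sum>n. (1 + norm s) ^ 3 / 8 * real (Suc n) powr (-3/2))"
    by (rule norm_suminf_le[OF le summable_mult[OF sm]])
  also have "\<dots> = (1 + norm s) ^ 3 / 8 * c" unfolding c_def by (rule suminf_mult[OF sm])
  finally have 1: "norm (\<Sum>n. zeta_summand n s) \<le> (1 + norm s) ^ 3 / 8 * c" .
  have "norm ((s + 1) / 2) \<le> 1 + norm s" 
    using norm_triangle_ineq[of s 1] norm_ge_zero[of s] unfolding norm_divide norm_one norm_numeral by linarith
  also have "\<dots> = (1 + norm s) ^ 1" by simp
  also have "\<dots> \<le> (1 + norm s) ^ 3" by (rule power_increasing) auto
  finally have "norm (zeta_right s) \<le> (1 + norm s) ^ 3 + (1 + norm s) ^ 3 / 8 * c"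
    unfolding zeta_right_def using 1 by (intro order.trans[OF norm_triangle_ineq] add_mono)
  thus "norm (zeta_right s) \<le> (1 + c / 8) * (1 + norm s) ^ 3" by (simp add: algebra_simps)
qed

lemma zeta_right_1: "zeta_right 1 = 1"
  by (simp add: zeta_right_def zeta_summand_def del: of_nat_Suc) (simp add: field_simps)?

lemma zeta_right_0: "zeta_right 0 = 1/2"
  by (simp add: zeta_right_def zeta_summand_def del: of_nat_Suc) simp

abbreviation dirichlet_zeta :: "complex \<Rightarrow> complex" where
  "dirichlet_zeta s \<equiv> \<Sum>n. 1 / of_nat (Suc n) powr s"

lemma summable_norm_dirichlet_zeta: "Re s > 1 \<Longrightarrow> summable (\<lambda>n. norm (1 / of_nat (Suc n) powr s :: complex))"
  using summable_Suc_powr[of "- Re s"] 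
  by (simp add: norm_divide norm_powr_real_powr powr_minus_divide del: of_nat_Suc)

text \<open>For Re s > 1 the trapezoidal errors can be taken apart: the endpoint values sum to two
  copies of the Dirichlet series, the second one without its first term, and the integrals telescope
  to 1.\<close>

lemma zeta_right_eq_dirichlet_zeta:
  assumes s: "Re s > 1"
  shows "zeta_right s = (s - 1) * dirichlet_zeta s"
proof -
  define t where "t = (\<lambda>n. 1 / of_nat (Suc n) powr s :: complex)"
  have t_eq: "of_nat (Suc n) powr (-s) = t n" for n by (simp only: t_def powr_minus_divide)
  have "t sums (\<Sum>n. t n)" unfolding t_def
    using summable_norm_cancel[OF summable_norm_dirichlet_zeta[OF s]] by (rule summable_sums)
  moreover from this have "(\<lambda>n. t (Suc n)) sums ((\<Sum>n. t n) - t 0)" by (simp only: sums_Suc_iff diff_add_cancel)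
  ultimately have 1: "(\<lambda>n. (s - 1) * (t n + t (Suc n)) / 2) sums ((s - 1) * ((\<Sum>n. t n) + ((\<Sum>n. t n) - t 0)) / 2)"
    by (intro sums_divide sums_mult sums_add)
  have "(\<lambda>n. of_nat (Suc n) powr (1 - s) :: complex) \<longlonglongrightarrow> 0"
  proof (rule tendsto_norm_zero_cancel)
    have "(\<lambda>n. real (Suc n) powr (1 - Re s)) \<longlonglongrightarrow> 0"
      using s by (intro LIMSEQ_Suc tendsto_neg_powr filterlim_real_sequentially) auto
    thus "(\<lambda>n. norm (of_nat (Suc n) powr (1 - s) :: complex)) \<longlonglongrightarrow> 0"
      by (simp add: norm_powr_real_powr del: of_nat_Suc)
  qed
  from telescope_sums'[OF this]
  have "(\<lambda>n. of_nat (Suc n) powr (1 - s) - of_nat (Suc (Suc n)) powr (1 - s)) sums (1 :: complex)" by simp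
  from sums_diff[OF 1 this] have "(\<lambda>n. zeta_summand n s) sums ((s - 1) * ((\<Sum>n. t n) + ((\<Sum>n. t n) - t 0)) / 2 - 1)"
    unfolding zeta_summand_def t_eq .
  hence "(\<Sum>n. zeta_summand n s) = (s - 1) * ((\<Sum>n. t n) + ((\<Sum>n. t n) - t 0)) / 2 - 1" by (rule sums_unique[symmetric])
  moreover have "t 0 = 1" by (simp add: t_def)
  ultimately show ?thesis unfolding zeta_right_def t_def[symmetric] by (simp add: field_simps)
qed

section \<open>The functional equation\<close>

text \<open>At s = -\<alpha> the integrals of the kernel against x powr (\<alpha> - 2) also converge
  on the cell {0..1}, and this additional cell accounts exactly for the summand (s + 1) / 2. So
  \<open>zeta_right\<close> is a multiple of the integral of \<open>sawtooth\<close> over the whole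
  half line, and the Fourier series turns it into the Dirichlet series at 1 + \<alpha>. On this real
  segment all integrands are nonnegative, which justifies every exchange.\<close>

lemma zeta_right_reflection_real:
  fixes \<alpha> :: real
  assumes \<alpha>: "0 < \<alpha>" "\<alpha> < 1"
  shows "zeta_right (of_real (-\<alpha>)) = of_real ((1 + \<alpha>) * 2 powr (-\<alpha>) * pi powr (-\<alpha> - 1) * sin (pi * \<alpha> / 2) * Gamma (1 + \<alpha>) * (\<Sum>n. real (Suc n) powr (-1 - \<alpha>)))"
proof -
  \<comment> \<open>The value of s (s + 1) (s - 1) at s = -\<alpha>.\<close>
  define \<kappa> where "\<kappa> = \<alpha> * (1 - \<alpha>) * (1 + \<alpha>)"
  have \<kappa>: "\<kappa> > 0" using \<alpha> by (simp add: \<kappa>_def)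
  define K where "K = pi / (2 * Gamma (2 - \<alpha>) * cos (pi * \<alpha> / 2))"
  define q where "q = (\<lambda>N x. (x - N) * (N + 1 - x) / 2 * x powr (\<alpha> - 2) :: real)"
  define b where "b = (\<lambda>n. integral {real n..real n + 1} (q (real n)))"
  define c where "c = (\<lambda>n. (2 * pi * real (Suc n)) powr (1 - \<alpha>) / (2 * pi\<^sup>2 * (real (Suc n))\<^sup>2) * K)"
  have q_nonneg: "q (real n) x \<ge> 0" if "x \<in> {real n..real n + 1}" for n x
    using that unfolding q_def by (intro mult_nonneg_nonneg divide_nonneg_pos) auto
  have q_int: "(q (real (Suc n)) has_integral b (Suc n)) {real (Suc n)..real (Suc n) + 1}" for n
    unfolding b_def q_def by (intro integrable_integral integrable_continuous_interval continuous_intros) auto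
  have q0: "(q 0 has_integral 1 / (2 * \<alpha> * (\<alpha> + 1))) {0..1}"
  proof -
    define Q where "Q = (\<lambda>x. x powr \<alpha> / (2 * \<alpha>) - x powr (\<alpha> + 1) / (2 * (\<alpha> + 1)))"
    have "(q 0 has_integral (Q 1 - Q 0)) {0..1}"
    proof (rule fundamental_theorem_of_calculus_interior)
      show "continuous_on {0..1} Q" unfolding Q_def
        using \<alpha> by (intro continuous_on_diff continuous_on_divide continuous_on_powr' continuous_intros) auto
      show "(Q has_vector_derivative q 0 x) (at x)" if "x \<in> {0<..<1}" for x
      proof -
        have x: "x > 0" using that by auto
        have "(Q has_real_derivative (\<alpha> * x powr (\<alpha> - 1)) / (2 * \<alpha>) - ((\<alpha> + 1) * x powr \<alpha>) / (2 * (\<alpha> + 1))) (at x)"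
          unfolding Q_def using x by (intro DERIV_diff DERIV_cdivide) (auto intro!: derivative_eq_intros)
        moreover have "(\<alpha> * y) / (2 * \<alpha>) = y / 2" "((\<alpha> + 1) * y) / (2 * (\<alpha> + 1)) = y / 2" for y
          using \<alpha> by (auto simp: divide_simps)
        ultimately have "(Q has_real_derivative x powr (\<alpha> - 1) / 2 - x powr \<alpha> / 2) (at x)" by (simp only:)
        moreover have "x powr (\<alpha> - 1) = x * x powr (\<alpha> - 2)" "x powr \<alpha> = x * (x * x powr (\<alpha> - 2))"
          using x by (simp_all add: powr_diff power2_eq_square)
        ultimately show ?thesis using \<alpha> x
          unfolding has_real_derivative_iff_has_vector_derivative[symmetric] q_def
          by (simp add: diff_divide_distrib[symmetric] algebra_simps)
      qed
    qed simp
    moreover have "Q 1 - Q 0 = 1 / (2 * \<alpha> * (\<alpha> + 1))" 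
    proof -
      have "(\<alpha> + 1) - \<alpha> = 1" by simp
      hence "1 / (2 * \<alpha>) - 1 / (2 * (\<alpha> + 1)) = 1 / (2 * \<alpha> * (\<alpha> + 1))"
        using \<alpha> by (simp add: divide_simps)
      thus ?thesis using \<alpha> by (simp add: Q_def)
    qed
    ultimately show ?thesis by simp
  qed
  hence b0: "b 0 = 1 / (2 * \<alpha> * (\<alpha> + 1))" "(q (real 0) has_integral b 0) {real 0..real 0 + 1}"
    by (auto simp: b_def integral_unique)
  have q_has: "(q (real n) has_integral b n) {real n..real n + 1}" for n
  proof (cases n)
    case 0
    show ?thesis unfolding 0 by (rule b0(2))
  next
    case (Suc m)
    show ?thesis unfolding Suc by (rule q_int)
  qed
  have b_nn: "(\<integral>\<^sup>+x. ennreal (q (real n) x) * indicator {real n..real n + 1} x \<partial>lborel) = ennreal (b n)" for n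
    by (rule nn_integral_has_integral_lebesgue'[OF q_nonneg q_has])
  have b_nonneg: "b n \<ge> 0" for n unfolding b_def
    by (rule integral_nonneg) (use q_has q_nonneg in blast)+
  have summand: "zeta_summand n (of_real (-\<alpha>)) = of_real (\<kappa> * b (Suc n))" for n
  proof -
    have "((\<lambda>x. of_real (\<kappa> * q (real (Suc n)) x)) has_integral (of_real (\<kappa> * b (Suc n)) :: complex)) {real (Suc n)..real (Suc n) + 1}"
      by (intro has_integral_of_real has_integral_mult_right q_int)
    moreover have "((\<lambda>x. of_real (\<kappa> * q (real (Suc n)) x)) has_integral zeta_summand n (of_real (-\<alpha>))) {real (Suc n)..real (Suc n) + 1}"
    proof (rule has_integral_eq)
      show "((\<lambda>x. of_real ((x - real (Suc n)) * (real (Suc (Suc n)) - x) / 2) * (of_real (-\<alpha>) * (of_real (-\<alpha>) + 1) * (of_real (-\<alpha>) - 1) * of_real x powr (-of_real (-\<alpha>) - 2)))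
        has_integral zeta_summand n (of_real (-\<alpha>))) {real (Suc n)..real (Suc n) + 1}"
        using has_integral_zeta_summand[of n "of_real (-\<alpha>)"] by (simp add: add_ac)
      fix x assume x: "x \<in> {real (Suc n)..real (Suc n) + 1}"
      have "of_real x powr (-of_real (-\<alpha>) - 2) = complex_of_real (x powr (\<alpha> - 2))"
        using x by (subst powr_of_real[symmetric]) auto
      thus "of_real ((x - real (Suc n)) * (real (Suc (Suc n)) - x) / 2) * (of_real (-\<alpha>) * (of_real (-\<alpha>) + 1) * (of_real (-\<alpha>) - 1) * of_real x powr (-of_real (-\<alpha>) - 2))
        = complex_of_real (\<kappa> * q (real (Suc n)) x)"
        by (simp add: \<kappa>_def q_def algebra_simps)
    qed
    ultimately show ?thesis by (rule has_integral_unique[rotated])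
  qed
  have "(\<lambda>n. of_real (\<kappa> * b (Suc n)) :: complex) sums (\<Sum>n. zeta_summand n (of_real (-\<alpha>)))"
    unfolding summand[symmetric] using \<alpha> by (intro summable_sums summable_zeta_summand) auto
  from sums_Suc[OF this] have "(\<lambda>n. of_real (\<kappa> * b n) :: complex) sums
      ((\<Sum>n. zeta_summand n (of_real (-\<alpha>))) + of_real (\<kappa> * b 0))" .
  \<comment> \<open>The cell {0..1} supplies the boundary summand (s + 1) / 2 of
    \<open>zeta_right\<close>, so that the sum can start at 0.\<close>
  moreover have "\<kappa> * b 0 = (1 - \<alpha>) / 2" using \<alpha> by (simp add: \<kappa>_def b0(1) divide_simps)
  ultimately have zb: "(\<lambda>n. of_real (\<kappa> * b n) :: complex) sums zeta_right (of_real (-\<alpha>))"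
    by (simp add: zeta_right_def add_ac)
  from sums_Re[OF this] have bs: "(\<lambda>n. \<kappa> * b n) sums Re (zeta_right (of_real (-\<alpha>)))" by simp
  hence b_summable: "summable b" using \<kappa> summable_mult_D[of \<kappa> b] by (auto simp: sums_iff)
  have "(\<lambda>n. of_real (\<kappa> * b n) :: complex) sums of_real (\<kappa> * suminf b)"
    using b_summable by (intro sums_of_real sums_mult summable_sums)
  with zb have Z: "zeta_right (of_real (-\<alpha>)) = of_real (\<kappa> * suminf b)" using sums_unique2 by blast
  have G: "Gamma (2 - \<alpha>) > 0" "Gamma (1 - \<alpha>) > 0" "Gamma \<alpha> > 0" using \<alpha> by (auto intro!: Gamma_real_pos)
  have "pi * \<alpha> < pi * 1" using \<alpha> by (intro mult_strict_left_mono) auto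
  moreover have "pi * \<alpha> > 0" using \<alpha> by simp
  ultimately have cs: "cos (pi * \<alpha> / 2) > 0" "sin (pi * \<alpha> / 2) > 0"
    by (intro cos_gt_zero_pi sin_gt_zero; linarith)+
  have K: "K > 0" using G cs by (simp add: K_def)
  have c_eq: "c n = 2 powr (-\<alpha>) * pi powr (-\<alpha> - 1) * K * real (Suc n) powr (-1 - \<alpha>)" for n
  proof -
    have e: "y powr (1 - \<alpha>) = y\<^sup>2 * y powr (-1 - \<alpha>)" if "y > 0" for y :: real
      using that by (simp add: powr_diff powr_minus power2_eq_square field_simps)
    define N where "N = real (Suc n)"
    have N: "N > 0" by (simp add: N_def)
    have "c n = (2 * pi * N)\<^sup>2 * (2 * pi * N) powr (-1 - \<alpha>) / (2 * pi\<^sup>2 * N\<^sup>2) * K"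
      unfolding c_def N_def[symmetric] using N by (subst e) auto
    also have "\<dots> = 2 * (2 * pi * N) powr (-1 - \<alpha>) * K"
      using N by (simp add: power_mult_distrib)
    also have "(2 * pi * N) powr (-1 - \<alpha>) = 2 powr (-1 - \<alpha>) * pi powr (-1 - \<alpha>) * N powr (-1 - \<alpha>)"
      using N by (simp add: powr_mult)
    also have "(2::real) powr (-1 - \<alpha>) = 2 powr (-\<alpha>) / 2" by (simp add: powr_diff powr_minus field_simps)
    finally show ?thesis unfolding N_def by (simp add: minus_diff_commute) (simp add: mult_ac)?
  qed
  have sm: "summable (\<lambda>n. real (Suc n) powr (-1 - \<alpha>))" by (rule summable_Suc_powr) (use \<alpha> in auto)
  have c_summable: "summable c" unfolding c_eq[abs_def] by (intro summable_mult sm)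
  have c_nonneg: "c n \<ge> 0" for n using K by (simp add: c_def)
  have "(\<Sum>n. ennreal (b n)) = (\<Sum>n. \<integral>\<^sup>+x. ennreal (q (real n) x) * indicator {real n..real n + 1} x \<partial>lborel)"
    by (simp only: b_nn)
  also have "\<dots> = (\<integral>\<^sup>+x. (\<Sum>n. ennreal (q (real n) x) * indicator {real n..real n + 1} x) \<partial>lborel)"
    unfolding q_def by (rule nn_integral_suminf[symmetric]) auto
  also have "\<dots> = (\<integral>\<^sup>+x. ennreal (sawtooth x * x powr (\<alpha> - 2)) * indicator {0..} x \<partial>lborel)"
  proof (rule nn_integral_cong)
    fix x :: real
    show "(\<Sum>n. ennreal (q (real n) x) * indicator {real n..real n + 1} x) = ennreal (sawtooth x * x powr (\<alpha> - 2)) * indicator {0..} x"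
    proof (cases "x \<ge> 0")
      case True
      define m where "m = nat \<lfloor>x\<rfloor>"
      have m: "real m \<le> x" "x < real m + 1" using True by (auto simp: m_def) 
      \<comment> \<open>The closed cells overlap at the integers, but the kernel is 0 there, so only
        the cell that starts at the integer part of x can contribute.\<close>
      have "(\<Sum>n. ennreal (q (real n) x) * indicator {real n..real n + 1} x) = (\<Sum>n\<in>{m}. ennreal (q (real n) x) * indicator {real n..real n + 1} x)"
      proof (rule suminf_finite)
        fix n assume n: "n \<notin> {m}"
        show "ennreal (q (real n) x) * indicator {real n..real n + 1} x = 0"
        proof (cases "x \<in> {real n..real n + 1}")
          case True
          with n m have "real n < real m + 1" "real m \<le> real n + 1" "n \<noteq> m" by auto
          hence "m = Suc n" by linarith
          hence "x = real n + 1" using True m by auto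
          thus ?thesis by (simp add: q_def)
        qed simp
      qed simp
      also have "\<dots> = ennreal (q (real m) x)" using m by simp
      also have "q (real m) x = sawtooth x * x powr (\<alpha> - 2)"
      proof -
        have "x - real m = frac x" using True by (simp add: m_def frac_def)
        moreover from this have "real m + 1 - x = 1 - frac x" by linarith
        ultimately show ?thesis unfolding q_def sawtooth_def by (simp only:)
      qed
      finally show ?thesis using True by simp
    qed (auto simp: indicator_def)
  qed
  also have "\<dots> = (\<Sum>n. ennreal (c n))" unfolding c_def K_def by (rule nn_integral_sawtooth_eq_suminf[OF \<alpha>])
  finally have "ennreal (suminf b) = ennreal (suminf c)"
    using b_nonneg c_nonneg b_summable c_summable by (simp add: suminf_ennreal2)
  hence "suminf b = suminf c"
    using b_nonneg c_nonneg b_summable c_summable by (simp add: suminf_nonneg)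
  also have "suminf c = 2 powr (-\<alpha>) * pi powr (-\<alpha> - 1) * K * (\<Sum>n. real (Suc n) powr (-1 - \<alpha>))"
    unfolding c_eq[abs_def] by (rule suminf_mult[OF sm])
  finally have "\<kappa> * suminf b = (\<kappa> * K) * 2 powr (-\<alpha>) * pi powr (-\<alpha> - 1) * (\<Sum>n. real (Suc n) powr (-1 - \<alpha>))"
    by (simp add: mult_ac)
  \<comment> \<open>The reflection formula together with the double angle formula for the sine
    trades Gamma (1 - \<alpha>) and the cosine in the denominator for Gamma \<alpha> and a sine in
    the numerator.\<close>
  also have "\<kappa> * K = (1 + \<alpha>) * sin (pi * \<alpha> / 2) * Gamma (1 + \<alpha>)"
  proof -
    have "Gamma (complex_of_real \<alpha>) * Gamma (1 - complex_of_real \<alpha>) = of_real pi / sin (of_real pi * of_real \<alpha>)"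
      by (rule Gamma_reflection_complex)
    also have "1 - complex_of_real \<alpha> = of_real (1 - \<alpha>)" by simp
    finally have "complex_of_real (Gamma \<alpha> * Gamma (1 - \<alpha>)) = of_real (pi / sin (pi * \<alpha>))"
      by (simp only: Gamma_complex_of_real sin_of_real of_real_mult[symmetric] of_real_divide[symmetric])
    hence r: "Gamma \<alpha> * Gamma (1 - \<alpha>) = pi / sin (pi * \<alpha>)" by (simp only: of_real_eq_iff)
    have "sin (pi * \<alpha>) = 2 * sin (pi * \<alpha> / 2) * cos (pi * \<alpha> / 2)" using sin_double[of "pi * \<alpha> / 2"] by simp
    with r have r': "Gamma \<alpha> * Gamma (1 - \<alpha>) * (2 * sin (pi * \<alpha> / 2) * cos (pi * \<alpha> / 2)) = pi"
      using cs by (simp add: field_simps)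
    have "1 - \<alpha> \<notin> \<int>\<^sub>\<le>\<^sub>0" "\<alpha> \<notin> \<int>\<^sub>\<le>\<^sub>0"
      using \<alpha> nonpos_Ints_nonpos[of "1 - \<alpha>"] nonpos_Ints_nonpos[of \<alpha>] by auto
    hence g1: "Gamma (2 - \<alpha>) = (1 - \<alpha>) * Gamma (1 - \<alpha>)" and g2: "Gamma (1 + \<alpha>) = \<alpha> * Gamma \<alpha>"
      using Gamma_plus1[of "1 - \<alpha>"] Gamma_plus1[of \<alpha>] by (simp_all add: add_ac)
    have "\<kappa> * K = \<alpha> * (1 + \<alpha>) * (pi / (2 * Gamma (1 - \<alpha>) * cos (pi * \<alpha> / 2)))"
    proof -
      have "K = pi / (2 * Gamma (1 - \<alpha>) * cos (pi * \<alpha> / 2)) / (1 - \<alpha>)"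
        unfolding K_def g1 by (simp add: mult_ac)
      moreover have "\<kappa> * (Y / (1 - \<alpha>)) = \<alpha> * (1 + \<alpha>) * Y" for Y
        using \<alpha> by (simp add: \<kappa>_def)
      ultimately show ?thesis by (simp only:)
    qed
    also have "pi / (2 * Gamma (1 - \<alpha>) * cos (pi * \<alpha> / 2)) = Gamma \<alpha> * sin (pi * \<alpha> / 2)"
      using r' G cs by (simp add: field_simps)
    finally show ?thesis by (simp add: g2 mult_ac)
  qed
  finally show ?thesis unfolding Z by (simp add: mult_ac)
qed

text \<open>The right side of the functional equation, multiplied by s - 1. The quotient at the end
  is \<zeta>(1 - s), since (1 - s) - 1 = - s.\<close>

definition zeta_reflected :: "complex \<Rightarrow> complex" where
  "zeta_reflected s = (s - 1) * 2 powr s * of_real pi powr (s - 1) * sin (of_real pi * s / 2) * Gamma (1 - s)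
     * (zeta_right (1 - s) / (- s))"

text \<open>The entire function (s - 1) \<zeta>(s). Its branches agree on the strip -1 < Re s < 0,
  so either may be used there.\<close>

definition entire_zeta :: "complex \<Rightarrow> complex" where
  "entire_zeta s = (if Re s > -1 then zeta_right s else zeta_reflected s)"

lemma not_nonpos_Ints_of_Re_pos: "Re z > 0 \<Longrightarrow> z \<notin> \<int>\<^sub>\<le>\<^sub>0"
  by (auto elim!: nonpos_Ints_cases)

lemma holomorphic_zeta_right_one_minus:
  "(\<lambda>s. zeta_right (1 - s)) holomorphic_on {s. Re s < 0}"
  by (rule holomorphic_on_compose_gen[of "\<lambda>s. 1 - s" _ zeta_right "{s. Re s > -1}", unfolded o_def])
     (auto intro!: holomorphic_intros holomorphic_zeta_right)

lemma holomorphic_zeta_reflected: "zeta_reflected holomorphic_on {s. Re s < 0}"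
proof -
  show ?thesis unfolding zeta_reflected_def[abs_def]
    by (intro holomorphic_intros holomorphic_zeta_right_one_minus) (auto intro!: not_nonpos_Ints_of_Re_pos)
qed

lemma zeta_right_eq_reflected_real:
  assumes \<alpha>: "0 < \<alpha>" "\<alpha> < 1"
  shows "zeta_right (of_real (-\<alpha>)) = zeta_reflected (of_real (-\<alpha>))"
proof -
  have "zeta_right (1 - of_real (-\<alpha>)) = (1 - of_real (-\<alpha>) - 1) * dirichlet_zeta (1 - of_real (-\<alpha>))"
    by (rule zeta_right_eq_dirichlet_zeta) (use \<alpha> in auto)
  hence z: "zeta_right (1 - of_real (-\<alpha>)) / (- of_real (-\<alpha>)) = dirichlet_zeta (1 - of_real (-\<alpha>))"
    using \<alpha> by simp
  have "(\<lambda>n. 1 / of_nat (Suc n) powr (1 - of_real (-\<alpha>)) :: complex) = (\<lambda>n. of_real (real (Suc n) powr (-1 - \<alpha>)))"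
  proof
    fix n
    have "1 / of_nat (Suc n) powr (1 - of_real (-\<alpha>)) = (of_real (real (Suc n)) powr (of_real (-1 - \<alpha>)) :: complex)"
      by (simp add: powr_minus_divide[symmetric] del: of_nat_Suc)
    also have "\<dots> = of_real (real (Suc n) powr (-1 - \<alpha>))" by (rule powr_of_real) simp
    finally show "1 / of_nat (Suc n) powr (1 - of_real (-\<alpha>)) = (of_real (real (Suc n) powr (-1 - \<alpha>)) :: complex)" .
  qed
  hence d: "dirichlet_zeta (1 - of_real (-\<alpha>)) = of_real (\<Sum>n. real (Suc n) powr (-1 - \<alpha>))"
    using suminf_of_real[OF summable_Suc_powr[of "-1 - \<alpha>"], where 'a = complex] \<alpha> by simp
  have p2: "2 powr (of_real (-\<alpha>)) = complex_of_real (2 powr (-\<alpha>))"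
    using powr_of_real[of 2 "-\<alpha>"] by simp
  have pp: "of_real pi powr (of_real (-\<alpha>) - 1) = complex_of_real (pi powr (-\<alpha> - 1))"
    using powr_of_real[of pi "-\<alpha> - 1"] by simp
  have ss: "sin (of_real pi * of_real (-\<alpha>) / 2) = complex_of_real (- sin (pi * \<alpha> / 2))"
    using sin_of_real[of "- (pi * \<alpha> / 2)", where 'a = complex] by simp
  have gg: "Gamma (1 - of_real (-\<alpha>)) = complex_of_real (Gamma (1 + \<alpha>))"
    using Gamma_complex_of_real[of "1 + \<alpha>"] by simp
  show ?thesis unfolding zeta_right_reflection_real[OF \<alpha>] zeta_reflected_def z d p2 pp ss gg
    by (simp add: algebra_simps)
qed

text \<open>Positivity gave the functional equation on a real segment; the identity theorem extends
  it to the strip in which both sides are holomorphic.\<close>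

lemma zeta_right_eq_reflected:
  assumes s: "-1 < Re s" "Re s < 0"
  shows "zeta_right s = zeta_reflected s"
proof -
  define S where "S = {s. -1 < Re s \<and> Re s < 0}"
  have S_eq: "S = {s. Re s > -1} \<inter> {s. Re s < 0}" by (auto simp: S_def)
  have "zeta_right s - zeta_reflected s = 0"
  proof (rule analytic_continuation[of "\<lambda>s. zeta_right s - zeta_reflected s" S "of_real ` {-1<..<0}" "of_real (-1/2)"])
    show "(\<lambda>s. zeta_right s - zeta_reflected s) holomorphic_on S"
      unfolding S_eq by (intro holomorphic_intros holomorphic_on_subset[OF holomorphic_zeta_right] 
        holomorphic_on_subset[OF holomorphic_zeta_reflected]) auto
    show "open S" unfolding S_eq by (intro open_Int open_Re_greater open_Re_less)
    have "convex S" unfolding S_eq by (intro convex_Int convex_halfspace_Re_gt convex_halfspace_Re_lt)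
    thus "connected S" by (rule convex_connected)
    show "complex_of_real (-1/2) islimpt of_real ` {-1<..<0}"
    proof (rule islimpt_isCont_image)
      show "(-1/2 :: real) islimpt {-1<..<0}" by (rule interior_limit_point) simp
      show "\<forall>\<^sub>F y in at (-1/2). complex_of_real y \<noteq> of_real (-1/2)"
        unfolding of_real_eq_iff eventually_at_filter by simp
    qed auto
    show "zeta_right z - zeta_reflected z = 0" if "z \<in> of_real ` {-1<..<0}" for z
    proof -
      from that obtain r where r: "z = of_real r" "-1 < r" "r < 0" by auto
      thus ?thesis using zeta_right_eq_reflected_real[of "- r"] by simp
    qed
  qed (use s in \<open>auto simp: S_def\<close>)
  thus ?thesis by simp
qed

lemma entire_zeta_left: "Re s < 0 \<Longrightarrow> entire_zeta s = zeta_reflected s"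
  and entire_zeta_right: "Re s > -1 \<Longrightarrow> entire_zeta s = zeta_right s"
  using zeta_right_eq_reflected[of s] by (auto simp: entire_zeta_def)

lemma holomorphic_entire_zeta: "entire_zeta holomorphic_on UNIV"
proof -
  have "entire_zeta holomorphic_on {s. Re s > -1} \<union> {s. Re s < 0}"
  proof (rule holomorphic_on_Un)
    show "entire_zeta holomorphic_on {s. Re s > -1}"
      by (subst holomorphic_cong[OF refl entire_zeta_right]) (auto intro: holomorphic_zeta_right)
    show "entire_zeta holomorphic_on {s. Re s < 0}"
      by (subst holomorphic_cong[OF refl entire_zeta_left]) (auto intro: holomorphic_zeta_reflected)
  qed (rule open_Re_greater open_Re_less)+
  moreover have "{s. Re s > -1} \<union> {s. Re s < 0} = (UNIV :: complex set)" by auto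
  ultimately show ?thesis by simp
qed

lemma entire_zeta_0: "entire_zeta 0 = 1/2" and entire_zeta_1: "entire_zeta 1 = 1"
  by (simp_all add: entire_zeta_def zeta_right_0 zeta_right_1)

lemma meromorphic_continuation_eqI:
  assumes "is_meromorphic_continuation H h U" "open U" "U \<noteq> {}"
  shows "meromorphic_continuation h U = H"
  unfolding meromorphic_continuation_def
  using assms meromorphic_continuation_unique by (intro the_equality) blast+

text \<open>The quotient by s - 1 agrees with the Dirichlet series on Re s > 1 and is meromorphic,
  so uniqueness of the continuation applies. There is a pole at 1 because
  \<open>entire_zeta 1 = 1\<close>, and the normalisation at poles forces the value 0 there.\<close>

lemma riemann_zeta_eq: "riemann_zeta s = (if s = 1 then 0 else entire_zeta s / (s - 1))"
proof -
  define H where "H = (\<lambda>s. if s = 1 then 0 else entire_zeta s / (s - 1))"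
  have ana: "entire_zeta analytic_on A" for A
    using holomorphic_entire_zeta analytic_on_subset[of _ UNIV A] by (simp add: analytic_on_open)
  have ev: "\<forall>\<^sub>F w in at z. H w = entire_zeta w / (w - 1)" for z
  proof -
    have "eventually (\<lambda>w. w \<in> - {1}) (at 1)" by (auto simp: eventually_at_filter)
    moreover have "eventually (\<lambda>w. w \<in> - {1}) (at z)" if "z \<noteq> 1"
      by (rule eventually_at_in_open') (use that in auto)
    ultimately have "eventually (\<lambda>w. w \<in> - {1}) (at z)" by (cases "z = 1") auto
    thus ?thesis by eventually_elim (auto simp: H_def)
  qed
  have "is_meromorphic_continuation H dirichlet_zeta {s. 1 < Re s}"
    unfolding is_meromorphic_continuation_def nicely_meromorphic_on_def
  proof (intro conjI ballI)
    have "(\<lambda>w. entire_zeta w / (w - 1)) meromorphic_on UNIV"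
      by (intro meromorphic_intros analytic_on_imp_meromorphic_on ana)
    moreover have "H meromorphic_on UNIV \<longleftrightarrow> (\<lambda>w. entire_zeta w / (w - 1)) meromorphic_on UNIV"
      using ev by (intro meromorphic_on_cong) (auto intro!: ev)
    ultimately show "H meromorphic_on UNIV" by simp
    fix z :: complex
    show "is_pole H z \<and> H z = 0 \<or> H \<midarrow>z\<rightarrow> H z"
    proof (cases "z = 1")
      case True
      have "is_pole (\<lambda>w. entire_zeta w / (w - 1)) 1"
      proof (rule is_pole_divide)
        show "isCont entire_zeta 1" using ana[of "{1}"] by (rule analytic_at_imp_isCont)
        have "eventually (\<lambda>w. w \<noteq> 1) (at (1::complex))" by (auto simp: eventually_at_filter)
        thus "filterlim (\<lambda>w. w - 1) (at 0) (at (1::complex))"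
          by (auto simp: filterlim_at intro!: tendsto_eq_intros)
      qed (simp add: entire_zeta_1)
      hence "is_pole H z" using ev[of 1] is_pole_cong[OF ev[of 1] refl] True by simp
      thus ?thesis using True by (simp add: H_def)
    next
      case False
      have "isCont (\<lambda>w. entire_zeta w / (w - 1)) z"
        using False ana[of "{z}"] by (intro continuous_intros analytic_at_imp_isCont) auto
      hence "(\<lambda>w. entire_zeta w / (w - 1)) \<midarrow>z\<rightarrow> H z" using False by (simp add: isCont_def H_def)
      hence "H \<midarrow>z\<rightarrow> H z" using tendsto_cong[OF ev[of z]] by simp
      thus ?thesis ..
    qed
  next
    fix s :: complex assume s: "s \<in> {s. 1 < Re s}"
    hence "s \<noteq> 1" by auto
    thus "H s = dirichlet_zeta s"
      using s zeta_right_eq_dirichlet_zeta[of s] by (simp add: H_def entire_zeta_right del: of_nat_Suc)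
  qed
  hence "riemann_zeta = H" unfolding riemann_zeta_def
  proof (rule meromorphic_continuation_eqI)
    have "2 \<in> {s. 1 < Re s}" by simp
    thus "{s. 1 < Re s} \<noteq> {}" by blast
  qed (rule open_Re_greater)
  thus ?thesis unfolding H_def by (rule fun_cong)
qed

section \<open>Upper bounds for the Gamma function\<close>

lemma norm_Gamma_le: "Re z > 0 \<Longrightarrow> norm (Gamma z) \<le> Gamma (Re z)"
proof -
  assume z: "Re z > 0"
  have 1: "((\<lambda>t. of_real t powr (z - 1) / of_real (exp t)) has_integral Gamma z) {0..}"
    by (rule Gamma_integral_complex[OF z])
  have 2: "((\<lambda>t. t powr (Re z - 1) / exp t) has_integral Gamma (Re z)) {0..}"
    by (rule Gamma_integral_real[OF z])
  have "norm (integral {0..} (\<lambda>t. of_real t powr (z - 1) / of_real (exp t))) \<le> integral {0..} (\<lambda>t. t powr (Re z - 1) / exp t)"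
  proof (rule integral_norm_bound_integral)
    fix t :: real assume "t \<in> {0..}"
    thus "norm (of_real t powr (z - 1) / of_real (exp t)) \<le> t powr (Re z - 1) / exp t"
      by (simp add: norm_divide norm_powr_real_powr)
  qed (use 1 2 in blast)+
  thus ?thesis using 1 2 by (simp add: integral_unique)
qed

text \<open>A coarse substitute for Stirling's formula: log-convexity gives Gamma x <= 1 between 1
  and 2, where both end values are 1, and the recurrence carries x powr x upwards in unit
  steps.\<close>

lemma Gamma_real_le_powr:
  assumes x: "x \<ge> (1::real)"
  shows "Gamma x \<le> x powr x"
proof -
  have G12: "Gamma x \<le> 1" if "1 \<le> x" "x \<le> 2" for x :: real
  proof -
    define t where "t = x - 1"
    have t: "0 \<le> t" "t \<le> 1" using that by (auto simp: t_def)
    have "(ln \<circ> Gamma) ((1 - t) *\<^sub>R 1 + t *\<^sub>R 2) \<le> (1 - t) * (ln \<circ> Gamma) (1::real) + t * (ln \<circ> Gamma) (2::real)"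
      using t by (intro convex_onD[OF log_convex_Gamma_real]) auto
    also have "(1 - t) *\<^sub>R 1 + t *\<^sub>R 2 = x" by (simp add: t_def algebra_simps)
    finally have "ln (Gamma x) \<le> 0" by (simp add: Gamma_numeral)
    moreover have "Gamma x > 0" using that by (intro Gamma_real_pos) auto
    ultimately show ?thesis by simp
  qed
  have one: "1 \<le> x powr x" if "1 \<le> x" for x :: real using that by (intro ge_one_powr_ge_zero) auto
  have "Gamma x \<le> x powr x" if "1 \<le> x" "x \<le> real (Suc n) + 1" for n and x :: real
    using that
  proof (induction n arbitrary: x)
    case 0
    thus ?case using G12[of x] one[of x] by simp
  next
    case (Suc n)
    show ?case
    proof (cases "x \<le> 2")
      case True
      thus ?thesis using G12[of x] one[of x] Suc.prems by simp
    next
      case False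
      hence "x - 1 \<notin> \<int>\<^sub>\<le>\<^sub>0" using nonpos_Ints_nonpos[of "x - 1"] by auto
      from Gamma_plus1[OF this] have "Gamma x = (x - 1) * Gamma (x - 1)" by simp
      also have "\<dots> \<le> x * (x - 1) powr (x - 1)"
        using False Suc.prems Suc.IH[of "x - 1"] by (intro mult_mono less_imp_le[OF Gamma_real_pos]) auto
      also have "\<dots> \<le> x * x powr (x - 1)"
        using False by (intro mult_left_mono powr_mono2) auto
      also have "\<dots> = x powr x" using False by (simp add: powr_diff)
      finally show ?thesis .
    qed
  qed
  from this[of x "nat \<lceil>x\<rceil>"] x show ?thesis by linarith
qed

subsection \<open>The Dirichlet series of the von Mangoldt function\<close>

lemma ln_times_powr_le:
  assumes "\<delta> > 0" "x \<ge> (1::real)"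
  shows "ln x * x powr (-1 - \<delta>) \<le> 2 / \<delta> * x powr (-1 - \<delta> / 2)"
proof -
  have "ln x * x powr (-1 - \<delta>) \<le> (x powr (\<delta> / 2) / (\<delta> / 2)) * x powr (-1 - \<delta>)"
    using assms by (intro mult_right_mono ln_powr_bound) auto
  also have "\<dots> = 2 / \<delta> * (x powr (\<delta> / 2) * x powr (-1 - \<delta>))" by (simp add: field_simps)
  also have "x powr (\<delta> / 2) * x powr (-1 - \<delta>) = x powr (-1 - \<delta> / 2)"
  proof -
    have "\<delta> / 2 + (-1 - \<delta>) = -1 - \<delta> / 2" by (simp add: field_simps)
    thus ?thesis by (metis powr_add)
  qed
  finally show ?thesis .
qed

lemma norm_ln_dirichlet_le:
  assumes "\<delta> > 0" "Re s \<ge> 1 + \<delta>"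
  shows "norm (of_real (ln (real (Suc n))) / of_nat (Suc n) powr s :: complex) \<le> 2 / \<delta> * real (Suc n) powr (-1 - \<delta> / 2)"
proof -
  have "norm (of_real (ln (real (Suc n))) / of_nat (Suc n) powr s :: complex) = ln (real (Suc n)) * real (Suc n) powr (- Re s)"
    by (simp add: norm_divide norm_powr_real_powr powr_minus_divide del: of_nat_Suc)
  also have "\<dots> \<le> ln (real (Suc n)) * real (Suc n) powr (-1 - \<delta>)"
    using assms by (intro mult_left_mono powr_mono) auto
  also have "\<dots> \<le> 2 / \<delta> * real (Suc n) powr (-1 - \<delta> / 2)"
    by (rule ln_times_powr_le) (use assms in auto)
  finally show ?thesis .
qed

lemma norm_mangoldt_dirichlet_le:
  assumes "\<delta> > 0" "Re s \<ge> 1 + \<delta>"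
  shows "norm (mangoldt (Suc n) / of_nat (Suc n) powr s :: complex) \<le> 2 / \<delta> * real (Suc n) powr (-1 - \<delta> / 2)"
proof -
  have "norm (mangoldt (Suc n) / of_nat (Suc n) powr s :: complex) = mangoldt (Suc n) / norm (of_nat (Suc n) powr s :: complex)"
    by (simp add: norm_divide)
  also have "\<dots> \<le> ln (real (Suc n)) / norm (of_nat (Suc n) powr s :: complex)"
    by (intro divide_right_mono mangoldt_le) auto
  also have "\<dots> = norm (of_real (ln (real (Suc n))) / of_nat (Suc n) powr s :: complex)"
    by (simp add: norm_divide)
  also have "\<dots> \<le> 2 / \<delta> * real (Suc n) powr (-1 - \<delta> / 2)" by (rule norm_ln_dirichlet_le[OF assms])
  finally show ?thesis .
qed

lemma summable_norm_mangoldt_dirichlet: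
  assumes "Re s > 1"
  shows "summable (\<lambda>n. norm (mangoldt (Suc n) / of_nat (Suc n) powr s :: complex))"
proof (rule summable_comparison_test')
  show "norm (norm (mangoldt (Suc n) / of_nat (Suc n) powr s :: complex)) \<le> 2 / (Re s - 1) * real (Suc n) powr (-1 - (Re s - 1) / 2)" for n
    using norm_mangoldt_dirichlet_le[of "Re s - 1" s n] assms by simp
  show "summable (\<lambda>n. 2 / (Re s - 1) * real (Suc n) powr (-1 - (Re s - 1) / 2))"
    by (intro summable_mult summable_Suc_powr) (use assms in auto)
qed

text \<open>The absolutely convergent double series is regrouped by the value of the product, and
  the sum of \<Lambda> over the divisors of n is ln n.\<close>

lemma sums_mangoldt_times_zeta:
  assumes s: "Re s > 1"
  shows "(\<lambda>n. of_real (ln (real (Suc n))) / of_nat (Suc n) powr s) sums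
    ((\<Sum>n. mangoldt (Suc n) / of_nat (Suc n) powr s) * dirichlet_zeta s)"
proof -
  define a where "a = (\<lambda>n. mangoldt (Suc n) / of_nat (Suc n) powr s :: complex)"
  define b where "b = (\<lambda>n. 1 / of_nat (Suc n) powr s :: complex)"
  have a: "summable (\<lambda>n. norm (a n))" unfolding a_def by (rule summable_norm_mangoldt_dirichlet[OF s])
  have b: "summable (\<lambda>n. norm (b n))" unfolding b_def by (rule summable_norm_dirichlet_zeta[OF s])
  have ha: "(a has_sum suminf a) UNIV" and hb: "(b has_sum suminf b) UNIV"
    using a b by (auto intro!: norm_summable_imp_has_sum summable_sums dest: summable_norm_cancel)
  have na: "(\<lambda>n. norm (a n)) summable_on UNIV" and nb: "(\<lambda>n. norm (b n)) summable_on UNIV"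
    using a b norm_summable_imp_summable_on[of "\<lambda>n. norm (a n)"] norm_summable_imp_summable_on[of "\<lambda>n. norm (b n)"] by auto
  define f where "f = (\<lambda>(d, k). a d * b k)"
  have "(\<lambda>p. norm (f p)) summable_on (UNIV \<times> UNIV)"
    unfolding Infinite_Sum.abs_summable_on_Sigma_iff
  proof (intro conjI ballI)
    show "(\<lambda>k. norm (f (d, k))) summable_on UNIV" for d
      unfolding f_def by (simp add: norm_mult summable_on_cmult_right nb)
    have "(\<Sum>\<^sub>\<infinity>k. norm (f (d, k))) = norm (a d) * (\<Sum>\<^sub>\<infinity>k. norm (b k))" for d
      unfolding f_def by (simp add: norm_mult infsum_cmult_right')
    moreover have "(\<lambda>d. norm (norm (a d) * (\<Sum>\<^sub>\<infinity>k. norm (b k)))) summable_on UNIV"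
      by (simp add: abs_mult infsum_nonneg summable_on_cmult_left na)
    ultimately show "(\<lambda>d. norm (\<Sum>\<^sub>\<infinity>k. norm (f (d, k)))) summable_on UNIV" by simp
  qed
  hence "f summable_on (UNIV \<times> UNIV)" by (rule abs_summable_summable)
  hence "(f has_sum (suminf a * suminf b)) (UNIV \<times> UNIV)"
    by (intro has_sum_SigmaI[where g = "\<lambda>d. a d * suminf b"])
       (auto simp: f_def intro!: has_sum_cmult_right has_sum_cmult_left ha hb)
  \<comment> \<open>Indices are shifted by one: d and k stand for the positive integers
    \<open>Suc d\<close> and \<open>Suc k\<close>, so a pair is sent to their product minus one,
    together with d.\<close>
  also have "?this \<longleftrightarrow> ((\<lambda>(n, d). mangoldt (Suc d) / of_nat (Suc n) powr s) has_sum (suminf a * suminf b))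
      (SIGMA n:UNIV. {d. Suc d dvd Suc n})"
  proof (rule has_sum_reindex_bij_witness[where j = "\<lambda>(d, k). (Suc d * Suc k - 1, d)" and i = "\<lambda>(n, d). (d, Suc n div Suc d - 1)"])
    fix p :: "nat \<times> nat" assume "p \<in> UNIV \<times> UNIV"
    obtain d k where p: "p = (d, k)" by (cases p)
    have e: "Suc (Suc d * Suc k - 1) = Suc d * Suc k" by simp
    show "(case case p of (d, k) \<Rightarrow> (Suc d * Suc k - 1, d) of (n, d) \<Rightarrow> (d, Suc n div Suc d - 1)) = p"
      unfolding p prod.case e by (simp del: mult_Suc mult_Suc_right)
    show "(case p of (d, k) \<Rightarrow> (Suc d * Suc k - 1, d)) \<in> (SIGMA n:UNIV. {d. Suc d dvd Suc n})"
      unfolding p prod.case mem_Sigma_iff mem_Collect_eq e using dvd_triv_left by blast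
    have "of_nat (Suc d * Suc k) powr s = (of_nat (Suc d) powr s * of_nat (Suc k) powr s :: complex)"
      unfolding of_nat_mult by (rule powr_times_real) auto
    thus "(case case p of (d, k) \<Rightarrow> (Suc d * Suc k - 1, d) of (n, d) \<Rightarrow> mangoldt (Suc d) / of_nat (Suc n) powr s) = f p"
      unfolding p prod.case e f_def a_def b_def by simp
  next
    fix q assume "q \<in> (SIGMA n:UNIV. {d. Suc d dvd Suc n})"
    then obtain n d where q: "q = (n, d)" "Suc d dvd Suc n" by auto
    then obtain c where c: "Suc n = Suc d * c" by (elim dvdE)
    hence "c > 0" by (cases c) auto
    have "Suc n div Suc d = c" unfolding c by (rule nonzero_mult_div_cancel_left) simp
    thus "(case case q of (n, d) \<Rightarrow> (d, Suc n div Suc d - 1) of (d, k) \<Rightarrow> (Suc d * Suc k - 1, d)) = q"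
      using \<open>c > 0\<close> c[symmetric] unfolding q(1) prod.case by simp
  qed auto
  finally have "((\<lambda>n. of_real (ln (real (Suc n))) / of_nat (Suc n) powr s) has_sum (suminf a * suminf b)) UNIV"
  proof (rule has_sum_SigmaD)
    fix n :: nat
    have fin: "finite {d. Suc d dvd Suc n}"
      by (rule finite_subset[of _ "{..n}"]) (auto dest: dvd_imp_le)
    have "of_real (ln (real (Suc n))) = (\<Sum>d | d dvd Suc n. mangoldt d :: complex)"
      by (rule mangoldt_sum[symmetric]) simp
    also have "\<dots> = (\<Sum>d | Suc d dvd Suc n. mangoldt (Suc d))"
    proof (rule sum.reindex_bij_witness[of _ Suc "\<lambda>d. d - 1"])
      fix d assume "d \<in> {d. d dvd Suc n}"
      thus "Suc (d - 1) = d" "d - 1 \<in> {d. Suc d dvd Suc n}" by (cases d; auto)+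
      thus "mangoldt (Suc (d - 1)) = (mangoldt d :: complex)" by simp
    qed auto
    finally have "of_real (ln (real (Suc n))) / of_nat (Suc n) powr s = (\<Sum>d | Suc d dvd Suc n. mangoldt (Suc d) / of_nat (Suc n) powr s :: complex)"
      by (simp add: sum_divide_distrib)
    thus "((\<lambda>d. case (n, d) of (n, d) \<Rightarrow> mangoldt (Suc d) / of_nat (Suc n) powr s) has_sum (of_real (ln (real (Suc n))) / of_nat (Suc n) powr s)) {d. Suc d dvd Suc n}"
      using fin has_sum_finite[OF fin, of "\<lambda>d. mangoldt (Suc d) / of_nat (Suc n) powr s"] by simp
  qed
  thus ?thesis unfolding a_def b_def by (rule has_sum_imp_sums)
qed

text \<open>In the multiplied form \<zeta>' = - D \<zeta> the identity does not presuppose \<zeta>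
  \<noteq> 0; the next lemma deduces the non-vanishing from it.\<close>

lemma has_field_derivative_dirichlet_zeta:
  assumes s: "Re s > 1"
  shows "(dirichlet_zeta has_field_derivative - ((\<Sum>n. mangoldt (Suc n) / of_nat (Suc n) powr s) * dirichlet_zeta s)) (at s)"
proof -
  define \<delta> where "\<delta> = (Re s - 1) / 2"
  have \<delta>: "\<delta> > 0" "Re s > 1 + \<delta>" using s by (auto simp: \<delta>_def field_simps)
  define f' where "f' = (\<lambda>n s. - (of_real (ln (real (Suc n))) / of_nat (Suc n) powr s) :: complex)"
  have "((\<lambda>s. \<Sum>n. 1 / of_nat (Suc n) powr s) has_field_derivative (\<Sum>n. f' n s)) (at s)"
  proof (rule has_field_derivative_series'(2))
    show "convex {s. Re s > 1 + \<delta>}" by (rule convex_halfspace_Re_gt)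
    show "uniformly_convergent_on {s. Re s > 1 + \<delta>} (\<lambda>n s. \<Sum>i<n. f' i s)"
    proof (rule Weierstrass_m_test')
      show "norm (f' n s) \<le> 2 / \<delta> * real (Suc n) powr (-1 - \<delta> / 2)" if "s \<in> {s. Re s > 1 + \<delta>}" for n s
        using norm_ln_dirichlet_le[of \<delta> s n] \<delta> that by (simp add: f'_def)
      show "summable (\<lambda>n. 2 / \<delta> * real (Suc n) powr (-1 - \<delta> / 2))"
        by (intro summable_mult summable_Suc_powr) (use \<delta> in auto)
    qed
    have "interior {s. Re s > 1 + \<delta>} = {s. Re s > 1 + \<delta>}" by (rule interior_open[OF open_Re_greater])
    thus "s \<in> interior {s. Re s > 1 + \<delta>}" using \<delta> by simp
    show "s \<in> {s. Re s > 1 + \<delta>}" using \<delta> by simp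
    show "summable (\<lambda>n. 1 / of_nat (Suc n) powr s :: complex)"
      using summable_norm_dirichlet_zeta[OF s] by (rule summable_norm_cancel)
    show "((\<lambda>s. 1 / of_nat (Suc n) powr s) has_field_derivative f' n z) (at z within {s. Re s > 1 + \<delta>})" for n z
    proof -
      have "((\<lambda>s. of_nat (Suc n) powr (- s)) has_field_derivative f' n z) (at z)"
        by (auto intro!: derivative_eq_intros simp: f'_def powr_minus_divide Ln_of_nat simp del: of_nat_Suc)
      thus ?thesis by (simp only: powr_minus_divide) (rule has_field_derivative_at_within)
    qed
  qed
  also have "(\<Sum>n. f' n s) = - ((\<Sum>n. mangoldt (Suc n) / of_nat (Suc n) powr s) * dirichlet_zeta s)"
    using sums_minus[OF sums_mangoldt_times_zeta[OF s]] unfolding f'_def by (rule sums_unique[symmetric])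
  finally show ?thesis .
qed

text \<open>At a zero the quotient \<zeta>' / \<zeta> would have a pole. But it equals the negative
  Dirichlet series of \<Lambda>, which is bounded on every half plane Re w > 1 + \<delta>. The value
  pi^2 / 6 at 2 ensures that \<zeta> does not vanish identically, so that the quotient makes sense
  near the zero.\<close>

lemma zeta_right_nonzero:
  assumes s: "Re s > 1"
  shows "zeta_right s \<noteq> 0"
proof
  assume "zeta_right s = 0"
  hence z: "dirichlet_zeta s = 0" using zeta_right_eq_dirichlet_zeta[OF s] s by auto
  define f where "f = dirichlet_zeta"
  define D where "D = (\<lambda>s. \<Sum>n. mangoldt (Suc n) / of_nat (Suc n) powr s :: complex)"
  have f': "(f has_field_derivative - (D s * f s)) (at s)" if "Re s > 1" for s
    unfolding f_def D_def by (rule has_field_derivative_dirichlet_zeta[OF that])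
  have holo: "f holomorphic_on {s. Re s > 1}"
    using f' by (subst holomorphic_on_open[OF open_Re_greater]) blast
  have "f 2 \<noteq> 0"
  proof -
    have "f 2 = (\<Sum>n. of_real (1 / (real (Suc n))\<^sup>2))"
      unfolding f_def by (intro suminf_cong) (simp add: powr_numeral del: of_nat_Suc)
    also have "\<dots> = of_real (\<Sum>n. 1 / (real (Suc n))\<^sup>2)"
      using inverse_squares_sums by (intro suminf_of_real[symmetric]) (auto simp: sums_iff add_ac)
    also have "(\<Sum>n. 1 / (real (Suc n))\<^sup>2) = pi\<^sup>2 / 6"
      using inverse_squares_sums by (simp add: sums_iff add_ac)
    finally have "f 2 = of_real (pi\<^sup>2 / 6)" .
    moreover have "pi\<^sup>2 / 6 \<noteq> 0" by simp
    ultimately show ?thesis by (simp only: of_real_eq_0_iff not_False_eq_True)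
  qed
  moreover have "2 \<in> {s. Re s > 1}" by simp
  ultimately have ev0: "eventually (\<lambda>w. f w \<noteq> 0) (at s)" 
    using non_zero_neighbour_alt[OF holo open_Re_greater convex_connected[OF convex_halfspace_Re_gt], of s 2] s
    by (auto elim: eventually_mono)
  have ana: "f analytic_on {s}" using holo open_Re_greater s by (auto simp: analytic_at)
  obtain F where F: "(\<lambda>w. f (s + w)) has_laurent_expansion F"
    using analytic_on_imp_meromorphic_on[OF ana] by (auto simp: meromorphic_on_def)
  have "F \<noteq> 0"
  proof
    assume "F = 0"
    with F has_laurent_expansion_eventually_nonzero_iff[OF F] ev0 show False by simp
  qed
  moreover have "f \<midarrow>s\<rightarrow> 0" using analytic_at_imp_isCont[OF ana] z by (simp add: isCont_def f_def)
  ultimately have pole: "is_pole (\<lambda>w. deriv f w / f w) s"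
    using is_pole_deriv_divide_iff[OF F] by blast
  define \<delta> where "\<delta> = (Re s - 1) / 2"
  have \<delta>: "\<delta> > 0" "Re s > 1 + \<delta>" using s by (auto simp: \<delta>_def field_simps)
  define B where "B = (\<Sum>n. 2 / \<delta> * real (Suc n) powr (-1 - \<delta> / 2))"
  have D_le: "norm (D w) \<le> B" if "Re w > 1 + \<delta>" for w unfolding D_def B_def
    by (intro norm_suminf_le norm_mangoldt_dirichlet_le summable_mult summable_Suc_powr) (use \<delta> that in auto)
  have "eventually (\<lambda>w. w \<in> {w. Re w > 1 + \<delta>}) (at s)"
    by (rule eventually_at_in_open'[OF open_Re_greater]) (use \<delta> in auto)
  hence "eventually (\<lambda>w. norm (deriv f w / f w) \<le> B) (at s)"
    using ev0
  proof eventually_elim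
    case (elim w)
    have "deriv f w = - (D w * f w)" using f'[of w] elim \<delta> by (intro DERIV_imp_deriv) auto
    thus ?case using elim D_le[of w] by simp
  qed
  moreover have "eventually (\<lambda>w. norm (deriv f w / f w) > B) (at s)"
    using pole unfolding is_pole_def filterlim_at_infinity_conv_norm_at_top filterlim_at_top_dense by blast
  ultimately have "eventually (\<lambda>w. False) (at s)" by eventually_elim simp
  thus False by simp
qed

subsection \<open>Zeros and growth of zeta\<close>

lemma zeta_right_one_minus_nonzero: "Re s < 0 \<Longrightarrow> zeta_right (1 - s) \<noteq> 0"
  by (rule zeta_right_nonzero) simp

lemma zeta_reflected_nonzero_factor:
  assumes s: "Re s < 0"
  shows "(s - 1) * 2 powr s * of_real pi powr (s - 1) * Gamma (1 - s) * (zeta_right (1 - s) / (- s)) \<noteq> 0"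
  using s zeta_right_one_minus_nonzero[OF s] Gamma_nonzero[OF not_nonpos_Ints_of_Re_pos, of "1 - s"] by auto

lemma entire_zeta_eq_0_left_iff:
  assumes s: "Re s < 0"
  shows "entire_zeta s = 0 \<longleftrightarrow> (\<exists>n\<ge>1. s = - 2 * of_nat n)"
proof -
  have "entire_zeta s = 0 \<longleftrightarrow> sin (of_real pi * s / 2) = 0"
    unfolding entire_zeta_left[OF s] zeta_reflected_def using zeta_reflected_nonzero_factor[OF s] by auto
  also have "\<dots> \<longleftrightarrow> (\<exists>n\<ge>1. s = - 2 * of_nat n)"
  proof
    assume "sin (of_real pi * s / 2) = 0"
    then obtain n :: int where n: "of_real pi * s / 2 = of_real (n * pi)" unfolding sin_eq_0 by blast
    have "of_real pi * s = of_real pi * (2 * of_int n)" using n by (simp add: field_simps)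
    hence sn: "s = 2 * of_int n" by simp
    with s have "n < 0" by simp
    hence "s = - 2 * of_nat (nat (- n))" "nat (- n) \<ge> 1" by (auto simp: sn)
    thus "\<exists>n\<ge>1. s = - 2 * of_nat n" by blast
  next
    assume "\<exists>n\<ge>1. s = - 2 * of_nat n"
    then obtain n :: nat where "s = - 2 * of_nat n" by blast
    hence "of_real pi * s / 2 = of_real (of_int (- int n) * pi)" by simp
    thus "sin (of_real pi * s / 2) = 0" unfolding sin_eq_0 by blast
  qed
  finally show ?thesis .
qed

lemma entire_zeta_nonzero_right: "Re s > 1 \<Longrightarrow> entire_zeta s \<noteq> 0"
  using zeta_right_nonzero[of s] entire_zeta_right[of s] by simp

text \<open>In the reflected expression only the sine vanishes, and its zeros are simple. For this
  reason the trivial zeros enter the explicit formula without multiplicities.\<close>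

lemma zorder_entire_zeta_trivial_zero:
  assumes "n \<ge> 1"
  shows "zorder entire_zeta (- 2 * of_nat n) = 1"
proof -
  define z where "z = (- 2 * of_nat n :: complex)"
  have z: "Re z < 0" using assms by (simp add: z_def)
  define h where "h = (\<lambda>s. (s - 1) * 2 powr s * of_real pi powr (s - 1) * Gamma (1 - s) * (zeta_right (1 - s) / (- s)))"
  have h_holo: "h holomorphic_on {s. Re s < 0}" unfolding h_def
    by (intro holomorphic_intros holomorphic_zeta_right_one_minus) (auto intro!: not_nonpos_Ints_of_Re_pos)
  have hz: "h z \<noteq> 0" unfolding h_def by (rule zeta_reflected_nonzero_factor[OF z])
  define sn where "sn = (\<lambda>s::complex. sin (of_real pi * s / 2))"
  have sn_holo: "sn holomorphic_on {s. Re s < 0}" unfolding sn_def by (intro holomorphic_intros) auto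
  have d: "((\<lambda>s. h s * sn s) has_field_derivative h z * (of_real pi / 2 * cos (of_real pi * z / 2)) + deriv h z * sn z) (at z)"
  proof -
    have "(h has_field_derivative deriv h z) (at z)"
      by (rule holomorphic_derivI[OF h_holo open_Re_less]) (use z in auto)
    moreover have "(sn has_field_derivative (of_real pi / 2 * cos (of_real pi * z / 2))) (at z)"
      unfolding sn_def by (auto intro!: derivative_eq_intros)
    ultimately show ?thesis by (auto intro!: derivative_eq_intros)
  qed
  have eq: "entire_zeta s = h s * sn s" if "s \<in> {s. Re s < 0}" for s
    using that by (simp add: entire_zeta_left zeta_reflected_def h_def sn_def)
  have e0: "entire_zeta z = 0" using entire_zeta_eq_0_left_iff[OF z] assms unfolding z_def by blast
  have sn0: "sn z = 0" using eq[of z] e0 hz z by auto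
  have "(entire_zeta has_field_derivative h z * (of_real pi / 2 * cos (of_real pi * z / 2)) + deriv h z * sn z) (at z)"
    by (rule has_field_derivative_transform_within_open[OF d open_Re_less[of 0]]) (use z eq in auto)
  hence "deriv entire_zeta z = h z * (of_real pi / 2 * cos (of_real pi * z / 2))"
    using sn0 by (simp add: DERIV_imp_deriv)
  moreover have "cos (of_real pi * z / 2) \<noteq> 0"
    using sn0 sin_cos_squared_add[of "of_real pi * z / 2"] unfolding sn_def by auto
  hence "h z * (of_real pi / 2 * cos (of_real pi * z / 2)) \<noteq> 0" using hz by simp
  ultimately have "deriv entire_zeta z \<noteq> 0" by (simp only: not_False_eq_True)
  thus ?thesis using e0 unfolding z_def[symmetric]
    by (intro zorder_zero_eqI[OF holomorphic_entire_zeta open_UNIV]) auto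
qed

lemma norm_sin_le_exp: "norm (sin (z::complex)) \<le> exp (norm z)"
  using cmod_sin_le_exp[of 1 z] abs_Im_le_cmod[of z] 
  by (auto intro: order.trans)

text \<open>To the right of Re z = -1/2 the Euler-Maclaurin form grows polynomially. To the left the
  functional equation is used, and its Gamma factor dominates with R powr R, where R = 1 + |z|;
  since ln R <= 2 R powr (1/2), this is at most exp (2 R powr (3/2)). The dividing line stays away
  from -1, where the series stops converging, and from 0, where the reflected expression divides by
  s.\<close>

lemma entire_zeta_growth:
  obtains C where "C \<ge> 0" "\<And>z. norm (entire_zeta z) \<le> exp (C * (1 + norm z) powr (3/2))"
proof -
  obtain c where c: "c \<ge> 0" "\<And>s. Re s \<ge> -1/2 \<Longrightarrow> norm (zeta_right s) \<le> c * (1 + norm s) ^ 3"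
    using zeta_right_bound by blast
  \<comment> \<open>The constant 16 comes from the left half plane: 8 from (2 R)^3, and 2 from 1 /
    |z| <= 2.\<close>
  have main: "norm (entire_zeta z) \<le> 16 * c * R ^ 4 * exp (2 * R) * R powr R" if R: "R = 1 + norm z" for z R
  proof (cases "Re z \<ge> -1/2")
    case True
    have R1: "R \<ge> 1" by (simp add: R)
    have "norm (entire_zeta z) \<le> c * R ^ 3" using c(2)[OF True] True by (simp add: entire_zeta_right R)
    also have "\<dots> \<le> (16 * c * R ^ 4) * 1 * 1"
    proof -
      have "R ^ 3 \<le> R ^ 4" using R1 by (intro power_increasing) auto
      hence "c * R ^ 3 \<le> c * R ^ 4" using c by (intro mult_left_mono)
      moreover have "c * R ^ 4 \<ge> 0" using c R1 by simp
      ultimately show ?thesis by linarith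
    qed
    also have "\<dots> \<le> 16 * c * R ^ 4 * exp (2 * R) * R powr R"
      using c R1 by (intro mult_mono ge_one_powr_ge_zero mult_nonneg_nonneg) auto
    finally show ?thesis .
  next
    case False
    hence z: "Re z < -1/2" by simp
    have R1: "R \<ge> 1" by (simp add: R)
    have "norm (entire_zeta z) = norm (z - 1) * 2 powr Re z * pi powr (Re z - 1) * norm (sin (of_real pi * z / 2)) * norm (Gamma (1 - z)) * (norm (zeta_right (1 - z)) / norm z)"
      using z by (simp add: entire_zeta_left zeta_reflected_def norm_mult norm_divide norm_powr_real_powr)
    also have "\<dots> \<le> R * 1 * 1 * exp (2 * R) * R powr R * (16 * c * R ^ 3)"
    proof (intro mult_mono)
      show "norm (z - 1) \<le> R" using norm_triangle_ineq4[of z 1] by (simp add: R)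
      show "2 powr Re z \<le> 1" using z powr_mono[of "Re z" 0 2] by simp
      show "pi powr (Re z - 1) \<le> 1" using z powr_mono[of "Re z - 1" 0 pi] pi_ge_two by simp
      have "norm (of_real pi * z / 2 :: complex) = pi / 2 * norm z" by (simp add: norm_mult norm_divide)
      also have "\<dots> \<le> 2 * norm z" using pi_less_4 by (intro mult_right_mono) auto
      finally show "norm (sin (of_real pi * z / 2)) \<le> exp (2 * R)"
        using norm_sin_le_exp[of "of_real pi * z / 2"] by (intro order.trans[OF norm_sin_le_exp]) (simp add: R)
      have "norm (Gamma (1 - z)) \<le> Gamma (1 - Re z)" using norm_Gamma_le[of "1 - z"] z by simp
      also have "\<dots> \<le> (1 - Re z) powr (1 - Re z)" using z by (intro Gamma_real_le_powr) auto
      also have "\<dots> \<le> R powr (1 - Re z)" using z abs_Re_le_cmod[of z] by (intro powr_mono2) (auto simp: R)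
      also have "\<dots> \<le> R powr R" using z R1 abs_Re_le_cmod[of z] by (intro powr_mono) (auto simp: R)
      finally show "norm (Gamma (1 - z)) \<le> R powr R" .
      have nz: "norm z \<ge> 1/2" using z abs_Re_le_cmod[of z] by linarith
      have "norm (zeta_right (1 - z)) \<le> c * (1 + norm (1 - z)) ^ 3" using z by (intro c(2)) simp
      also have "\<dots> \<le> c * (2 * R) ^ 3"
      proof -
        have "norm (1 - z) \<le> 1 + norm z" using norm_triangle_ineq4[of 1 z] by simp
        also have "\<dots> \<le> 1 + 2 * norm z" by simp
        finally have "1 + norm (1 - z) \<le> 2 * R" by (simp add: R)
        thus ?thesis using c by (intro mult_left_mono power_mono) auto
      qed
      finally have "norm (zeta_right (1 - z)) / norm z \<le> c * (2 * R) ^ 3 / (1/2)"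
        using nz c R1 by (intro frac_le) auto
      thus "norm (zeta_right (1 - z)) / norm z \<le> 16 * c * R ^ 3" by (simp add: power_mult_distrib)
    qed (use R1 in auto)
    also have "\<dots> = 16 * c * R ^ 4 * exp (2 * R) * R powr R" by (simp add: power_numeral_reduce)
    finally show ?thesis .
  qed
  \<comment> \<open>The four factors cost 16 c for the constant, 8 for R^4 (from 4 ln R <= 8 R powr
    (1/2)), 2 for exp (2 R) and 2 for R powr R.\<close>
  show ?thesis
  proof (rule that[of "16 * c + 12"])
    show "16 * c + 12 \<ge> 0" using c by simp
    fix z :: complex
    define R where "R = 1 + norm z"
    have R1: "R \<ge> 1" by (simp add: R_def)
    have sq: "ln R \<le> 2 * R powr (1/2)" using ln_powr_bound[of R "1/2"] R1 by simp
    have one: "1 \<le> R powr (3/2)" using R1 by (intro ge_one_powr_ge_zero) auto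
    have r32: "R * R powr (1/2) = R powr (3/2)" using R1 powr_add[of R 1 "1/2"] by simp
    have le1: "R powr (1/2) \<le> R powr (3/2)" "R \<le> R powr (3/2)"
      using R1 powr_mono[of "1/2" "3/2" R] powr_mono[of 1 "3/2" R] by auto
    have "16 * c \<le> exp (16 * c)" using exp_ge_add_one_self[of "16 * c"] by linarith
    also have "\<dots> \<le> exp (16 * c * R powr (3/2))" using c one mult_left_mono[OF one, of "16 * c"] by simp
    finally have 1: "16 * c \<le> exp (16 * c * R powr (3/2))" .
    have "R ^ 4 = exp (4 * ln R)" using R1 exp_of_nat_mult[of 4 "ln R"] by simp
    also have "\<dots> \<le> exp (8 * R powr (3/2))" using sq le1 by simp
    finally have 2: "R ^ 4 \<le> exp (8 * R powr (3/2))" .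
    have 3: "exp (2 * R) \<le> exp (2 * R powr (3/2))" using le1 by simp
    have "R * ln R \<le> R * (2 * R powr (1/2))" using sq R1 by (intro mult_left_mono) auto
    also have "\<dots> = 2 * R powr (3/2)" unfolding r32[symmetric] by simp
    finally have "exp (R * ln R) \<le> exp (2 * R powr (3/2))" by simp
    moreover have "R powr R = exp (R * ln R)" using R1 by (simp add: powr_def)
    ultimately have 4: "R powr R \<le> exp (2 * R powr (3/2))" by simp
    have "16 * c * R ^ 4 * exp (2 * R) * R powr R \<le> exp (16 * c * R powr (3/2)) * exp (8 * R powr (3/2)) * exp (2 * R powr (3/2)) * exp (2 * R powr (3/2))"
      using 1 2 3 4 c R1 by (intro mult_mono) auto
    also have "\<dots> = exp ((16 * c + 12) * R powr (3/2))" by (simp add: exp_add[symmetric] algebra_simps)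
    finally show "norm (entire_zeta z) \<le> exp ((16 * c + 12) * (1 + norm z) powr (3/2))"
      using main[OF R_def] unfolding R_def by (rule order.trans[rotated])
  qed
qed

subsection \<open>The Mellin transform\<close>

lemma has_field_derivative_within_Un:
  assumes "(f has_field_derivative D) (at x within S)" "(f has_field_derivative D) (at x within T)"
  shows "(f has_field_derivative D) (at x within S \<union> T)"
proof -
  have "((\<lambda>y. (f y - f x) / (y - x)) \<longlongrightarrow> D) (sup (at x within S) (at x within T))"
    using assms unfolding has_field_derivative_iff by (rule filterlim_sup)
  thus ?thesis unfolding has_field_derivative_iff unfolding at_within_union .
qed

text \<open>The half line is covered by three closed pieces. On each piece that contains t the
  one-sided derivatives agree, because H' vanishes at 0 and 1; for a piece that does not contain t
  the filter is trivial and any derivative is correct.\<close>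

lemma has_real_derivative_glued:
  fixes H H' h :: "real \<Rightarrow> real"
  assumes ab: "0 < a" "a < b"
    and H: "\<And>y. y \<in> {0..1} \<Longrightarrow> (H has_real_derivative H' y) (at y within {0..1})"
    and H': "H' 0 = 0" "H' 1 = 0"
    and h: "\<And>t. 0 \<le> t \<Longrightarrow> t \<le> a \<Longrightarrow> h t = H 0" "\<And>t. t \<ge> b \<Longrightarrow> h t = H 1"
      "\<And>t. a \<le> t \<Longrightarrow> t \<le> b \<Longrightarrow> h t = H ((t - a) / (b - a))"
    and t: "t > 0"
  shows "(h has_real_derivative (if a \<le> t \<and> t \<le> b then H' ((t - a) / (b - a)) / (b - a) else 0)) (at t)"
proof -
  define D where "D = (if a \<le> t \<and> t \<le> b then H' ((t - a) / (b - a)) / (b - a) else 0)"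
  have const: "(h has_real_derivative D) (at t within S)" if S: "closed S" "t \<in> S \<Longrightarrow> D = 0" "\<And>u. u \<in> S \<Longrightarrow> h u = c" for S c
  proof (cases "t \<in> S")
    case True
    have "((\<lambda>_. c) has_real_derivative D) (at t within S)" using S(2)[OF True] by simp
    thus ?thesis by (rule has_field_derivative_transform_within[of _ _ _ _ 1]) (use True S in auto)
  next
    case False
    hence "at t within S = bot" using S(1) closed_limpt trivial_limit_within by blast
    thus ?thesis by (simp add: has_field_derivative_iff)
  qed
  have d1: "(h has_real_derivative D) (at t within {0..a})"
    by (rule const[where c = "H 0"]) (use ab H' h in \<open>auto simp: D_def\<close>)
  have d2: "(h has_real_derivative D) (at t within {b..})"
    by (rule const[where c = "H 1"]) (use ab H' h in \<open>auto simp: D_def\<close>)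
  have d3: "(h has_real_derivative D) (at t within {a..b})"
  proof (cases "t \<in> {a..b}")
    case True
    define \<phi> where "\<phi> = (\<lambda>t. (t - a) / (b - a))"
    have im: "\<phi> ` {a..b} \<subseteq> {0..1}" using ab by (auto simp: \<phi>_def)
    have "\<phi> t \<in> {0..1}" using im True by blast
    from DERIV_subset[OF H[OF this] im]
    have "(H has_real_derivative H' (\<phi> t)) (at (\<phi> t) within \<phi> ` {a..b})" .
    moreover have "(\<phi> has_real_derivative 1 / (b - a)) (at t within {a..b})"
      unfolding \<phi>_def using ab by (auto intro!: derivative_eq_intros)
    ultimately have "((H \<circ> \<phi>) has_real_derivative H' (\<phi> t) * (1 / (b - a))) (at t within {a..b})"
      by (rule DERIV_image_chain)
    moreover have "H' (\<phi> t) * (1 / (b - a)) = D" using True by (simp add: D_def \<phi>_def)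
    ultimately have "((H \<circ> \<phi>) has_real_derivative D) (at t within {a..b})" by simp
    thus ?thesis by (rule has_field_derivative_transform_within[of _ _ _ _ 1]) (use True h in \<open>auto simp: \<phi>_def\<close>)
  next
    case False
    hence "at t within {a..b} = bot" using closed_atLeastAtMost[of a b] closed_limpt trivial_limit_within by blast
    thus ?thesis by (simp add: has_field_derivative_iff)
  qed
  note has_field_derivative_within_Un[OF has_field_derivative_within_Un[OF d1 d2] d3]
  moreover have "{0..a} \<union> {b..} \<union> {a..b} = {0..}" using ab by auto
  moreover have "at t within {0..} = at t" by (rule at_within_interior) (use t in simp)
  ultimately show ?thesis unfolding D_def by simp
qed

lemma has_vector_derivative_of_real_powr:
  assumes "t > 0"
  shows "((\<lambda>t. complex_of_real t powr s) has_vector_derivative (s * of_real t powr (s - 1))) (at t within S)"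
proof -
  have "complex_of_real t \<notin> \<real>\<^sub>\<le>\<^sub>0" using assms by auto
  from has_vector_derivative_real_field[OF has_field_derivative_powr[OF this]]
  show ?thesis by (rule has_vector_derivative_at_within)
qed

lemma has_vector_derivative_times_powr:
  assumes t: "t > 0" and f: "(f has_real_derivative f') (at t)"
  shows "((\<lambda>t. complex_of_real (f t) * of_real t powr s) has_vector_derivative
     (of_real (f t) * (s * of_real t powr (s - 1)) + of_real f' * of_real t powr s)) (at t within S)"
proof -
  have "((\<lambda>t. complex_of_real (f t)) has_vector_derivative of_real f') (at t within S)"
    using f by (intro has_vector_derivative_of_real has_vector_derivative_at_within)
      (simp add: has_real_derivative_iff_has_vector_derivative)
  from has_vector_derivative_mult[OF this has_vector_derivative_of_real_powr[OF t, of s S]]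
  show ?thesis .
qed

lemma continuous_on_of_real_powr:
  assumes "\<And>t. t \<in> S \<Longrightarrow> t > 0"
  shows "continuous_on S (\<lambda>t. complex_of_real t powr s)"
proof (rule continuous_on_vector_derivative)
  show "((\<lambda>t. complex_of_real t powr s) has_vector_derivative (s * of_real t powr (s - 1))) (at t within S)"
    if "t \<in> S" for t
    by (rule has_vector_derivative_of_real_powr[OF assms[OF that]])
qed

lemma holomorphic_integral_powr:
  fixes w :: "real \<Rightarrow> real"
  assumes "0 < c" and w: "continuous_on {c..d} w"
  shows "(\<lambda>s. integral {c..d} (\<lambda>t. of_real (w t) * of_real t powr s)) holomorphic_on UNIV"
  unfolding cbox_interval[symmetric]
proof (rule leibniz_rule_holomorphic)
  show "((\<lambda>s. of_real (w t) * of_real t powr s) has_field_derivative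
      of_real (w t) * (Ln (of_real t) * of_real t powr s)) (at s within UNIV)" if "t \<in> cbox c d" for s t
    using that assms(1) by (intro DERIV_cmult has_field_derivative_powr_right) auto
  show "(\<lambda>t. complex_of_real (w t) * of_real t powr s) integrable_on cbox c d" for s
    using assms by (intro integrable_continuous continuous_on_mult continuous_on_of_real continuous_on_of_real_powr) auto
  have "continuous_on (UNIV \<times> cbox c d) (\<lambda>p. of_real (w (snd p)) * (Ln (of_real (snd p)) * of_real (snd p) powr fst p))"
    using assms(1) by (intro continuous_intros continuous_on_compose2[OF w]) auto
  thus "continuous_on (UNIV \<times> cbox c d) (\<lambda>(s, t). of_real (w t) * (Ln (of_real t) * of_real t powr s))"
    by (simp add: case_prod_unfold)
qed simp

text \<open>One integration by parts on {0..b}; the boundary term at 0 vanishes because Re s > 0.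
  The remaining integral runs over {a..b}, away from 0, and is entire in s, so the right side gives
  the continuation.\<close>

lemma mellin_integral_eq:
  fixes f f1 :: "real \<Rightarrow> real"
  assumes ab: "0 < a" "a < b"
    and f: "\<And>t. 0 \<le> t \<Longrightarrow> t \<le> a \<Longrightarrow> f t = 1" "\<And>t. t \<ge> b \<Longrightarrow> f t = 0" "\<And>t. t \<ge> 0 \<Longrightarrow> \<bar>f t\<bar> \<le> 1"
    and f1: "\<And>t. t > 0 \<Longrightarrow> (f has_real_derivative f1 t) (at t)" "continuous_on {a..b} f1"
    and f1_0: "\<And>t. t \<le> a \<Longrightarrow> f1 t = 0" "\<And>t. t \<ge> b \<Longrightarrow> f1 t = 0"
    and s: "Re s > 0"
  shows "mellin_integral f s = - integral {a..b} (\<lambda>t. of_real (f1 t) * of_real t powr s) / s"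
proof -
  have s0: "s \<noteq> 0" using s by auto
  define J where "J = integral {a..b} (\<lambda>t. of_real (f1 t) * of_real t powr s)"
  have cont_f: "continuous_on {0<..} f"
    by (rule DERIV_continuous_on[OF has_field_derivative_at_within[OF f1(1)]]) simp
  have cont_f0: "continuous_on {0..b} f"
  proof -
    have "continuous_on ({0..a} \<union> {a..b}) f"
    proof (rule continuous_on_closed_Un)
      show "continuous_on {0..a} f" using f(1) by (subst continuous_on_cong[OF refl, of _ _ "\<lambda>_. 1"]) auto
      show "continuous_on {a..b} f" using ab by (intro continuous_on_subset[OF cont_f]) auto
    qed auto
    moreover have "{0..a} \<union> {a..b} = {0..b}" using ab by auto
    ultimately show ?thesis by simp
  qed
  have "((\<lambda>t. of_real (f t) * (s * of_real t powr (s - 1)) + of_real (f1 t) * of_real t powr s) has_integral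
      (of_real (f b) * of_real b powr s - of_real (f 0) * of_real 0 powr s)) {0..b}"
  proof (rule fundamental_theorem_of_calculus_interior)
    show "continuous_on {0..b} (\<lambda>t. complex_of_real (f t) * of_real t powr s)"
    proof (intro continuous_on_mult continuous_on_of_real cont_f0)
      show "continuous_on {0..b} (\<lambda>t. complex_of_real t powr s)"
        using s by (intro continuous_on_powr_complex continuous_intros) auto
    qed
    show "((\<lambda>t. of_real (f t) * of_real t powr s) has_vector_derivative
       of_real (f t) * (s * of_real t powr (s - 1)) + of_real (f1 t) * of_real t powr s) (at t)" if "t \<in> {0<..<b}" for t
      using that f1(1) by (intro has_vector_derivative_times_powr) auto
  qed (use ab in auto)
  hence 1: "((\<lambda>t. of_real (f t) * (s * of_real t powr (s - 1)) + of_real (f1 t) * of_real t powr s) has_integral 0) {0..b}"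
    using f(2)[of b] s0 by simp
  have "((\<lambda>t. of_real (f1 t) * of_real t powr s) has_integral J) {a..b}"
    unfolding J_def using ab f1(2)
    by (intro integrable_integral integrable_continuous_interval continuous_on_mult continuous_on_of_real continuous_on_of_real_powr) auto
  hence 2: "((\<lambda>t. of_real (f1 t) * of_real t powr s) has_integral J) {0..b}"
    by (rule has_integral_on_superset) (use ab f1_0 in auto)
  have "((\<lambda>t. of_real (f t) * (s * of_real t powr (s - 1))) has_integral (0 - J)) {0..b}"
    using has_integral_diff[OF 1 2] by simp
  hence "((\<lambda>t. 1 / s * (of_real (f t) * (s * of_real t powr (s - 1)))) has_integral (1 / s * (0 - J))) {0..b}"
    by (rule has_integral_mult_right)
  hence hi: "((\<lambda>t. of_real (f t) * of_real t powr (s - 1)) has_integral (- J / s)) {0..b}"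
    using s0 by (simp add: field_simps)
  have bnd: "(\<lambda>t. t powr (Re s - 1)) integrable_on {0..b}"
    using integrable_on_powr_from_0[of "Re s - 1" b] s ab by simp
  \<comment> \<open>\<open>mellin_integral\<close> is a Lebesgue integral, whereas the computation
    so far used gauge integrals. Domination by t powr (Re s - 1) reconciles the two.\<close>
  have "(\<lambda>t. of_real (f t) * of_real t powr (s - 1)) absolutely_integrable_on {0..b}"
  proof (rule absolutely_integrable_integrable_bound[OF _ _ bnd])
    show "norm (of_real (f t) * of_real t powr (s - 1) :: complex) \<le> t powr (Re s - 1)" if "t \<in> {0..b}" for t
    proof -
      have "\<bar>f t\<bar> * t powr (Re s - 1) \<le> 1 * t powr (Re s - 1)" using f(3)[of t] that by (intro mult_right_mono) auto
      thus ?thesis using that by (simp add: norm_mult norm_powr_real_powr)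
    qed
  qed (use hi in blast)
  hence "integrable lebesgue (\<lambda>t. indicator {0..b} t *\<^sub>R (of_real (f t) * of_real t powr (s - 1) :: complex))"
    by (simp add: set_integrable_def)
  also have "(\<lambda>t. indicator {0..b} t *\<^sub>R (of_real (f t) * of_real t powr (s - 1) :: complex)) =
      (\<lambda>t. indicator {0<..} t *\<^sub>R (of_real (f t) * of_real t powr (s - 1)))"
  proof
    fix t
    show "indicator {0..b} t *\<^sub>R (of_real (f t) * of_real t powr (s - 1) :: complex) =
        indicator {0<..} t *\<^sub>R (of_real (f t) * of_real t powr (s - 1))"
      using f(2)[of t] ab by (cases "t \<le> b"; cases "t = 0") (auto simp: indicator_def)
  qed
  finally have "integrable lborel (\<lambda>t. indicator {0<..} t *\<^sub>R (of_real (f t) * of_real t powr (s - 1) :: complex))"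
  proof (subst (asm) integrable_completion)
    have "continuous_on {0<..} (\<lambda>t. of_real (f t) * of_real t powr (s - 1) :: complex)"
      by (intro continuous_on_mult continuous_on_of_real cont_f continuous_on_of_real_powr) auto
    thus "(\<lambda>t. indicator {0<..} t *\<^sub>R (of_real (f t) * of_real t powr (s - 1) :: complex)) \<in> borel_measurable lborel"
      by (simp add: borel_measurable_continuous_on_indicator)
  qed
  hence "set_integrable lborel {0<..} (\<lambda>t. of_real (f t) * of_real t powr (s - 1) :: complex)"
    by (simp add: set_integrable_def)
  hence "mellin_integral f s = integral {0<..} (\<lambda>t. of_real (f t) * of_real t powr (s - 1))"
    unfolding mellin_integral_def by (rule set_borel_integral_eq_integral(2))
  also have "((\<lambda>t. of_real (f t) * of_real t powr (s - 1)) has_integral (- J / s)) {0<..}"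
  proof -
    have "((\<lambda>t. if t \<in> {0..b} then of_real (f t) * of_real t powr (s - 1) else 0) has_integral (- J / s)) UNIV"
      using hi by (simp only: has_integral_restrict_UNIV)
    also have "(\<lambda>t. if t \<in> {0..b} then of_real (f t) * of_real t powr (s - 1) else 0) =
        (\<lambda>t. if t \<in> {0<..} then of_real (f t) * of_real t powr (s - 1) else (0 :: complex))"
    proof
      fix t
      show "(if t \<in> {0..b} then of_real (f t) * of_real t powr (s - 1) else 0) =
          (if t \<in> {0<..} then of_real (f t) * of_real t powr (s - 1) else (0 :: complex))"
        using f(2)[of t] ab by (cases "t \<le> b"; cases "t = 0") auto
    qed
    finally show ?thesis by (simp only: has_integral_restrict_UNIV)
  qed
  hence "integral {0<..} (\<lambda>t. of_real (f t) * of_real t powr (s - 1)) = - J / s" by (rule integral_unique)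
  finally show ?thesis by (simp add: J_def)
qed

text \<open>\<open>remove_sings\<close> provides the normalisation that the continuation demands at
  s = 0 and changes nothing elsewhere. Excluding s = 0 costs nothing later, since \<zeta> has no
  zero there.\<close>

lemma mellin_transform_eq:
  fixes f f1 :: "real \<Rightarrow> real"
  assumes ab: "0 < a" "a < b"
    and f: "\<And>t. 0 \<le> t \<Longrightarrow> t \<le> a \<Longrightarrow> f t = 1" "\<And>t. t \<ge> b \<Longrightarrow> f t = 0" "\<And>t. t \<ge> 0 \<Longrightarrow> \<bar>f t\<bar> \<le> 1"
    and f1: "\<And>t. t > 0 \<Longrightarrow> (f has_real_derivative f1 t) (at t)" "continuous_on {a..b} f1"
    and f1_0: "\<And>t. t \<le> a \<Longrightarrow> f1 t = 0" "\<And>t. t \<ge> b \<Longrightarrow> f1 t = 0"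
    and s: "s \<noteq> 0"
  shows "mellin_transform f s = - integral {a..b} (\<lambda>t. of_real (f1 t) * of_real t powr s) / s"
proof -
  define h where "h = (\<lambda>s::complex. - integral {a..b} (\<lambda>t. of_real (f1 t) * of_real t powr s) / s)"
  have J: "(\<lambda>s. integral {a..b} (\<lambda>t. of_real (f1 t) * of_real t powr s)) holomorphic_on A" for A
    using holomorphic_integral_powr[OF ab(1) f1(2)] by (rule holomorphic_on_subset) auto
  have h_holo: "h holomorphic_on - {0}" unfolding h_def by (intro holomorphic_intros J) auto
  have h_ana: "h analytic_on {s}" if "s \<noteq> 0" for s
    using h_holo that by (auto simp: analytic_at intro!: exI[of _ "- {0}"])
  have "(\<lambda>s. - integral {a..b} (\<lambda>t. of_real (f1 t) * of_real t powr s)) analytic_on UNIV"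
    unfolding analytic_on_open[OF open_UNIV] by (rule holomorphic_on_minus[OF J])
  hence "h meromorphic_on UNIV" unfolding h_def
    by (rule meromorphic_on_divide[OF analytic_on_imp_meromorphic_on analytic_on_imp_meromorphic_on[OF analytic_on_ident]])
  hence "remove_sings h nicely_meromorphic_on UNIV" by (rule remove_sings_nicely_meromorphic)
  moreover have eq: "remove_sings h s = h s" if "s \<noteq> 0" for s
    by (rule remove_sings_at_analytic[OF h_ana[OF that]])
  moreover have "h s = mellin_integral f s" if "Re s > 0" for s
    unfolding h_def by (rule mellin_integral_eq[OF ab f f1 f1_0 that, symmetric])
  moreover have "s \<noteq> 0" if "Re s > 0" for s using that by auto
  ultimately have "is_meromorphic_continuation (remove_sings h) (mellin_integral f) {s. 0 < Re s}"
    unfolding is_meromorphic_continuation_def by simp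
  hence "mellin_transform f = remove_sings h" unfolding mellin_transform_def
  proof (rule meromorphic_continuation_eqI)
    have "1 \<in> {s. 0 < Re s}" by simp
    thus "{s. 0 < Re s} \<noteq> {}" by blast
  qed (rule open_Re_greater)
  thus ?thesis using eq[OF s] by (simp add: h_def)
qed

text \<open>A second integration by parts. Since f2 may be discontinuous, the integrability of its
  product with the power is itself obtained from the fundamental theorem of calculus.\<close>

lemma has_integral_second_derivative_powr:
  fixes f1 f2 :: "real \<Rightarrow> real"
  assumes cd: "0 < c" "c \<le> d"
    and f1: "\<And>t. t > 0 \<Longrightarrow> (f1 has_real_derivative f2 t) (at t)" "f1 c = 0" "f1 d = 0"
  shows "((\<lambda>t. of_real (f2 t) * of_real t powr (s + 1)) has_integral
    (s + 1 :: complex) * - integral {c..d} (\<lambda>t. of_real (f1 t) * of_real t powr s)) {c..d}"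
proof -
  define J where "J = integral {c..d} (\<lambda>t. of_real (f1 t) * of_real t powr s)"
  have cont: "continuous_on {c..d} f1"
    by (rule DERIV_continuous_on[OF has_field_derivative_at_within[OF f1(1)]]) (use cd in auto)
  have "((\<lambda>t. of_real (f1 t) * ((s + 1) * of_real t powr (s + 1 - 1)) + of_real (f2 t) * of_real t powr (s + 1)) has_integral
      (of_real (f1 d) * of_real d powr (s + 1) - of_real (f1 c) * of_real c powr (s + 1))) {c..d}"
    by (rule fundamental_theorem_of_calculus[OF cd(2)], rule has_vector_derivative_times_powr) (use cd f1 in auto)
  hence 1: "((\<lambda>t. (s + 1) * (of_real (f1 t) * of_real t powr s) + of_real (f2 t) * of_real t powr (s + 1)) has_integral 0) {c..d}"
    using f1(2,3) by (simp add: mult_ac)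
  have "((\<lambda>t. of_real (f1 t) * of_real t powr s) has_integral J) {c..d}"
    unfolding J_def using cd cont
    by (intro integrable_integral integrable_continuous_interval continuous_on_mult continuous_on_of_real continuous_on_of_real_powr) auto
  hence "((\<lambda>t. (s + 1) * (of_real (f1 t) * of_real t powr s)) has_integral (s + 1) * J) {c..d}"
    by (rule has_integral_mult_right)
  from has_integral_diff[OF 1 this] show ?thesis
    by (simp only: add_diff_cancel_left' diff_0 J_def mult_minus_right)
qed

subsection \<open>The integrated explicit formula\<close>

abbreviation zeta_zeros :: "complex set" where
  "zeta_zeros \<equiv> {\<rho>. entire_zeta \<rho> = 0}"

text \<open>The lower bound for |\<rho> + 1| makes the weights 1 / (\<rho> (\<rho> + 1)) comparable
  to |\<rho>|^-2. If Re \<rho> >= 0, then already |\<rho>| <= |\<rho> + 1|; among the trivial zeros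
  the bound is attained at -2.\<close>

lemma zeta_zeros_props:
  assumes "\<rho> \<in> zeta_zeros"
  shows "Re \<rho> \<le> 1" "\<rho> \<noteq> 0" "norm \<rho> / 2 \<le> norm (\<rho> + 1)" "zorder entire_zeta \<rho> > 0"
    "Re \<rho> < 0 \<Longrightarrow> \<exists>n\<ge>1. \<rho> = - 2 * of_nat n"
proof -
  show re: "Re \<rho> \<le> 1" using assms entire_zeta_nonzero_right[of \<rho>] by force
  show "\<rho> \<noteq> 0" using assms entire_zeta_0 by auto
  show tz: "\<exists>n\<ge>1. \<rho> = - 2 * of_nat n" if "Re \<rho> < 0"
    using assms entire_zeta_eq_0_left_iff[OF that] by simp
  show "zorder entire_zeta \<rho> > 0"
    by (rule zorder_entire_pos[OF holomorphic_entire_zeta]) (use assms entire_zeta_0 in auto)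
  show "norm \<rho> / 2 \<le> norm (\<rho> + 1)"
  proof (cases "Re \<rho> < 0")
    case True
    then obtain n :: nat where n: "n \<ge> 1" "\<rho> = - 2 * of_nat n" using tz by blast
    have "\<rho> + 1 = of_real (- (2 * real n - 1))" by (simp add: n)
    hence "norm (\<rho> + 1) = \<bar>- (2 * real n - 1)\<bar>" by (simp only: norm_of_real)
    hence "norm (\<rho> + 1) = 2 * real n - 1" using n by simp
    moreover have "norm \<rho> = 2 * real n" by (simp add: n norm_mult)
    ultimately show ?thesis using n by simp
  next
    case False
    have "(norm \<rho>)\<^sup>2 \<le> (norm (\<rho> + 1))\<^sup>2" 
      unfolding cmod_power2 using False by (simp add: power2_eq_square algebra_simps)
    hence "norm \<rho> \<le> norm (\<rho> + 1)" by (rule power2_le_imp_le) simp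
    thus ?thesis using norm_ge_zero[of \<rho>] by linarith
  qed
qed

text \<open>The multiplicity is part of the weight because the sums below run over the set of
  zeros.\<close>

definition zero_weight :: "complex \<Rightarrow> complex" where
  "zero_weight \<rho> = of_int (zorder entire_zeta \<rho>) / (\<rho> * (\<rho> + 1))"

lemma zeta_zero_plus_one_nonzero: "\<rho> \<in> zeta_zeros \<Longrightarrow> \<rho> + 1 \<noteq> 0"
  using zeta_zeros_props(2,3)[of \<rho>] by auto

lemma summable_norm_zero_weight: "(\<lambda>\<rho>. norm (zero_weight \<rho>)) summable_on zeta_zeros"
proof -
  obtain C where C: "C \<ge> 0" "\<And>z. norm (entire_zeta z) \<le> exp (C * (1 + norm z) powr (3/2))"
    using entire_zeta_growth by blast
  have "(\<lambda>\<rho>. 2 * (real_of_int (zorder entire_zeta \<rho>) / (norm \<rho>)\<^sup>2)) summable_on zeta_zeros"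
    by (intro summable_on_cmult_right summable_on_inverse_zeros_squared[OF holomorphic_entire_zeta _ C])
       (simp add: entire_zeta_0)
  thus ?thesis
  proof (rule summable_on_comparison_test)
    fix \<rho> assume \<rho>: "\<rho> \<in> zeta_zeros"
    note p = zeta_zeros_props[OF \<rho>]
    have "norm (zero_weight \<rho>) = real_of_int (zorder entire_zeta \<rho>) / (norm \<rho> * norm (\<rho> + 1))"
      using p(4) by (simp add: zero_weight_def norm_divide norm_mult)
    also have "\<dots> \<le> real_of_int (zorder entire_zeta \<rho>) / (norm \<rho> * (norm \<rho> / 2))"
      using p zeta_zero_plus_one_nonzero[OF \<rho>] by (intro divide_left_mono mult_left_mono mult_pos_pos) auto
    finally show "norm (zero_weight \<rho>) \<le> 2 * (real_of_int (zorder entire_zeta \<rho>) / (norm \<rho>)\<^sup>2)"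
      by (simp add: power2_eq_square mult_ac)
  qed auto
qed

lemma log_deriv_riemann_zeta_0:
  "deriv entire_zeta 0 / entire_zeta 0 = deriv riemann_zeta 0 / riemann_zeta 0 - 1"
proof -
  have "(entire_zeta has_field_derivative deriv entire_zeta 0) (at 0)"
    by (rule holomorphic_derivI[OF holomorphic_entire_zeta]) auto
  hence "((\<lambda>s. entire_zeta s / (s - 1)) has_field_derivative - deriv entire_zeta 0 - entire_zeta 0) (at 0)"
    by (auto intro!: derivative_eq_intros)
  hence "(riemann_zeta has_field_derivative - deriv entire_zeta 0 - entire_zeta 0) (at 0)"
    by (rule has_field_derivative_transform_within_open[of _ _ _ "- {1}"]) (auto simp: riemann_zeta_eq)
  hence d: "deriv riemann_zeta 0 = - deriv entire_zeta 0 - entire_zeta 0" by (rule DERIV_imp_deriv)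
  have "riemann_zeta 0 = - 1 / 2" by (simp add: riemann_zeta_eq entire_zeta_0)
  thus ?thesis unfolding d entire_zeta_0 by (simp add: field_simps)
qed

abbreviation mangoldt_dirichlet :: "complex \<Rightarrow> complex" where
  "mangoldt_dirichlet s \<equiv> \<Sum>n. mangoldt (Suc n) / of_nat (Suc n) powr s"

text \<open>The general expansion for (s - 1) \<zeta>(s). The factor s - 1 has logarithmic
  derivative 1 / (s - 1) at s and -1 at 0, which accounts for the two elementary terms.\<close>

lemma has_sum_zeta_partial_fractions:
  assumes s: "Re s > 1"
  shows "((\<lambda>\<rho>. of_int (zorder entire_zeta \<rho>) * (1 / (s - \<rho>) + 1 / \<rho>)) has_sum
    (1 / (s - 1) - mangoldt_dirichlet s - deriv riemann_zeta 0 / riemann_zeta 0 + 1)) zeta_zeros"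
proof -
  obtain C where C: "C \<ge> 0" "\<And>z. norm (entire_zeta z) \<le> exp (C * (1 + norm z) powr (3/2))"
    using entire_zeta_growth by blast
  have Zs: "entire_zeta s \<noteq> 0" by (rule entire_zeta_nonzero_right[OF s])
  have s1: "s \<noteq> 1" using s by auto
  have eq: "entire_zeta z = (z - 1) * dirichlet_zeta z" if "z \<in> {z. Re z > 1}" for z
    using that zeta_right_eq_dirichlet_zeta[of z] by (simp add: entire_zeta_right del: of_nat_Suc)
  have d0: "dirichlet_zeta s \<noteq> 0" using Zs eq[of s] s by auto
  have "((\<lambda>z. (z - 1) * dirichlet_zeta z) has_field_derivative
      (1 - 0) * dirichlet_zeta s + - (mangoldt_dirichlet s * dirichlet_zeta s) * (s - 1)) (at s)"
    by (intro DERIV_mult DERIV_diff DERIV_ident DERIV_const has_field_derivative_dirichlet_zeta s)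
  hence "(entire_zeta has_field_derivative
      (1 - 0) * dirichlet_zeta s + - (mangoldt_dirichlet s * dirichlet_zeta s) * (s - 1)) (at s)"
    by (rule has_field_derivative_transform_within_open[OF _ open_Re_greater]) (use s eq in auto)
  hence "deriv entire_zeta s = dirichlet_zeta s * (1 - mangoldt_dirichlet s * (s - 1))"
    by (simp add: DERIV_imp_deriv algebra_simps del: of_nat_Suc)
  moreover have "entire_zeta s = (s - 1) * dirichlet_zeta s" using eq s by simp
  ultimately have "deriv entire_zeta s / entire_zeta s = (1 - mangoldt_dirichlet s * (s - 1)) / (s - 1)"
    using d0 by (simp del: of_nat_Suc)
  also have "\<dots> = 1 / (s - 1) - mangoldt_dirichlet s" using s1 by (simp add: diff_divide_distrib del: of_nat_Suc)
  finally have ld: "deriv entire_zeta s / entire_zeta s = 1 / (s - 1) - mangoldt_dirichlet s" .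
  have "((\<lambda>\<rho>. of_int (zorder entire_zeta \<rho>) * (1 / (s - \<rho>) + 1 / \<rho>)) has_sum
    (deriv entire_zeta s / entire_zeta s - deriv entire_zeta 0 / entire_zeta 0)) zeta_zeros"
    by (rule has_sum_log_deriv_zeros[OF holomorphic_entire_zeta _ C Zs]) (simp add: entire_zeta_0)
  thus ?thesis unfolding ld log_deriv_riemann_zeta_0 by (simp add: algebra_simps del: of_nat_Suc)
qed

section \<open>Moments on the unit interval\<close>

lemma has_integral_of_real_powr_unit:
  fixes z :: complex
  assumes "Re z > 0"
  shows "((\<lambda>v. of_real v powr (z - 1)) has_integral 1 / z) {0..1}"
proof -
  have z: "z \<noteq> 0" using assms by auto
  have "((\<lambda>v. of_real v powr (z - 1)) has_integral (of_real 1 powr z / z - of_real 0 powr z / z)) {0..1}"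
  proof (rule fundamental_theorem_of_calculus_interior)
    show "continuous_on {0..1} (\<lambda>v. complex_of_real v powr z / z)"
      using assms z by (intro continuous_on_divide continuous_on_powr_complex continuous_intros) auto
    show "((\<lambda>v. complex_of_real v powr z / z) has_vector_derivative of_real v powr (z - 1)) (at v)" if "v \<in> {0<..<1}" for v
      using has_vector_derivative_divide[OF has_vector_derivative_of_real_powr[of v z UNIV], of z] that z by simp
  qed simp
  thus ?thesis using z by simp
qed

lemma continuous_on_of_real_powr_unit:
  "Re z > 0 \<Longrightarrow> continuous_on {0..1} (\<lambda>v. complex_of_real v powr z)"
  by (intro continuous_on_powr_complex continuous_intros) auto

lemma of_real_powr_mult_power:
  assumes "v \<ge> 0" "Re z > 0"
  shows "complex_of_real v powr z * of_real (v ^ j) = of_real v powr (z + of_nat j)"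
proof (cases "v = 0")
  case False
  hence "of_real (v ^ j) = (complex_of_real v powr of_nat j)" by (simp add: powr_nat')
  thus ?thesis by (simp add: powr_add)
qed (use assms in simp)

text \<open>With v = 1 / y the function is v^4 max 0 (y - c). Its j-th moment is the integral of (y
  - c) y^(-k - 2) over y >= c for k = j + 4, that is c^-k / (k (k + 1)).\<close>

lemma has_integral_truncated_linear:
  fixes c :: real
  assumes c: "c \<ge> 1"
  shows "((\<lambda>v. v ^ 3 * max 0 (1 - c * v) * v ^ j) has_integral (1 / c ^ (j + 4) / ((j + 4) * (j + 5)))) {0..1}"
proof -
  define Q where "Q = (\<lambda>v. v ^ (j + 4) / real (j + 4) - c * v ^ (j + 5) / real (j + 5))"
  have "((\<lambda>v. v ^ (j + 3) - c * v ^ (j + 4)) has_integral (Q (1 / c) - Q 0)) {0..1 / c}"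
  proof (rule fundamental_theorem_of_calculus)
    show "(Q has_vector_derivative v ^ (j + 3) - c * v ^ (j + 4)) (at v within {0..1 / c})" for v
    proof -
      have "(Q has_real_derivative (real (j + 4) * v ^ (j + 3)) / real (j + 4) - c * (real (j + 5) * v ^ (j + 4)) / real (j + 5)) (at v)"
        unfolding Q_def
        by (intro DERIV_diff DERIV_cdivide DERIV_cmult) (auto intro!: derivative_eq_intros simp: add.commute)
      moreover have "(real (j + 4) * y) / real (j + 4) = y" "c * (real (j + 5) * y) / real (j + 5) = c * y" for y
        by simp_all
      ultimately have "(Q has_real_derivative v ^ (j + 3) - c * v ^ (j + 4)) (at v)" by (simp only:)
      thus ?thesis by (simp add: has_real_derivative_iff_has_vector_derivative has_vector_derivative_at_within)
    qed
  qed (use c in auto)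
  also have "Q (1 / c) - Q 0 = 1 / c ^ (j + 4) / ((j + 4) * (j + 5))"
  proof -
    have "c * (1 / c) ^ (j + 5) = (1 / c) ^ (j + 4)" using c by (simp add: power_divide eval_nat_numeral)
    hence "Q (1 / c) - Q 0 = (1 / c) ^ (j + 4) * (1 / real (j + 4) - 1 / real (j + 5))"
      by (simp add: Q_def power_0_left right_diff_distrib)
    also have "1 / real (j + 4) - 1 / real (j + 5) = 1 / ((j + 4) * (j + 5))" by (simp add: field_simps)
    finally show ?thesis by (simp add: power_divide)
  qed
  finally have 1: "((\<lambda>v. v ^ 3 * max 0 (1 - c * v) * v ^ j) has_integral (1 / c ^ (j + 4) / ((j + 4) * (j + 5)))) {0..1 / c}"
    by (rule has_integral_eq[rotated])
       (use c in \<open>auto simp: field_simps max_def power_add eval_nat_numeral\<close>)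
  have 2: "((\<lambda>v. v ^ 3 * max 0 (1 - c * v) * v ^ j) has_integral 0) {1 / c..1}"
    by (rule has_integral_is_0) (use c in \<open>auto simp: field_simps max_def\<close>)
  have "0 \<le> 1 / c" "1 / c \<le> 1" using c by auto
  from has_integral_combine[OF this 1 2] show ?thesis by simp
qed

text \<open>\<open>moments_vanish\<close> with \<sigma> = 0 shows that all tail integrals from c to
  1 vanish; by continuity W is recovered as the derivative of such integrals.\<close>

lemma continuous_zero_moments_imp_zero:
  fixes W :: "real \<Rightarrow> complex"
  assumes W: "continuous_on {0..1} W" and m: "\<And>j. integral {0..1} (\<lambda>v. W v * of_real (v ^ j)) = 0"
    and v: "0 < v" "v \<le> 1"
  shows "W v = 0"
proof -
  have tail: "integral {c..1} W = 0" if c: "0 < c" "c \<le> 1" for c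
  proof -
    let ?k = "\<lambda>v. of_real (if v > c then 1 else if v = c then 1 - exp (-1) else 0) :: complex"
    have "integral {0..1} (\<lambda>v. W v * ?k v) = 0"
      by (rule moments_vanish[OF W, of "\<lambda>v. v" 0 c 0]) (use c m in auto)
    moreover have "integral {0..1} (\<lambda>v. W v * ?k v) = integral {0..1} (\<lambda>v. if v \<in> {c..1} then W v else 0)"
      by (rule integral_spike[of "{c}"]) (use c in auto)
    moreover have "\<dots> = integral {c..1} W"
      using integral_restrict_Int[of "{0..1}" "{c..1}" W] c by (simp add: Int_absorb1)
    ultimately show ?thesis by simp
  qed
  define c where "c = v / 2"
  have c: "0 < c" "c < v" "c \<le> 1" using v by (auto simp: c_def)
  have Wc: "continuous_on {c..1} W" using c by (intro continuous_on_subset[OF W]) auto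
  have z: "integral {c..u} W = 0" if "u \<in> {c..1}" for u
  proof -
    have "integral {c..u} W + integral {u..1} W = integral {c..1} W"
      using that c by (intro Henstock_Kurzweil_Integration.integral_combine integrable_continuous_interval Wc) auto
    thus ?thesis using tail[of c] tail[of u] that c by simp
  qed
  have "((\<lambda>u. integral {c..u} W) has_vector_derivative W v) (at v within {c..1})"
    by (rule integral_has_vector_derivative[OF Wc]) (use c v in auto)
  moreover have "((\<lambda>u. integral {c..u} W) has_vector_derivative 0) (at v within {c..1})"
  proof (rule has_vector_derivative_transform[where f = "\<lambda>_. 0"])
    show "v \<in> {c..1}" using c v by auto
  qed (use z in auto)
  ultimately show ?thesis
    using vector_derivative_unique_within_closed_interval[of c 1 v "\<lambda>u. integral {c..u} W" "W v" 0] c v by auto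
qed

lemma summable_on_mangoldt_cube: "(\<lambda>n. mangoldt (Suc n) / real (Suc n) ^ 3) summable_on UNIV"
proof (rule norm_summable_imp_summable_on)
  have "summable (\<lambda>n. norm (mangoldt (Suc n) / of_nat (Suc n) powr 3 :: complex))"
    by (rule summable_norm_mangoldt_dirichlet) simp
  moreover have "norm (mangoldt (Suc n) / of_nat (Suc n) powr 3 :: complex) = norm (mangoldt (Suc n) / real (Suc n) ^ 3 :: real)" for n
    by (simp add: norm_divide norm_powr_real_powr powr_numeral norm_power mangoldt_nonneg del: of_nat_Suc)
  ultimately show "summable (\<lambda>n. norm (mangoldt (Suc n) / real (Suc n) ^ 3 :: real))" by simp
qed

text \<open>The function \<open>\<psi>\<^sub>1(y) = \<Sum>\<^sub>n\<^sub>\<le>\<^sub>y \<Lambda>(n) (y - n)\<close> and its explicit formula are studied through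
  \<open>v = 1/y\<close> and the factor \<open>v\<^sup>4\<close>, which makes every term continuous on \<open>[0,1]\<close>.\<close>

theorem integrated_chebyshev_explicit_formula:
  fixes y :: real
  assumes y: "y \<ge> 1"
  defines "L \<equiv> deriv riemann_zeta 0 / riemann_zeta 0"
  shows "(\<Sum>\<^sub>\<infinity>n. mangoldt (Suc n) * of_real (max 0 (y - real (Suc n)))) =
    (of_real y ^ 2 - 1) / 2 - L * (of_real y - 1)
      - (\<Sum>\<^sub>\<infinity>\<rho>\<in>zeta_zeros. zero_weight \<rho> * (of_real y powr (\<rho> + 1) - 1))"
proof -
  define a where "a = (\<lambda>n v. mangoldt (Suc n) * of_real (v ^ 3 * max 0 (1 - real (Suc n) * v)) :: complex)"
  define A where "A = (\<lambda>v. \<Sum>\<^sub>\<infinity>n. a n v)"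
  define r where "r = (\<lambda>\<rho> v. zero_weight \<rho> * (of_real v powr (3 - \<rho>) - of_real (v ^ 4)))"
  define B where "B = (\<lambda>v. \<Sum>\<^sub>\<infinity>\<rho>\<in>zeta_zeros. r \<rho> v)"
  define E where "E = (\<lambda>v. of_real (v ^ 2 - v ^ 4) / 2 - L * of_real (v ^ 3 - v ^ 4))"
  \<comment> \<open>This is v^4 times the left side minus the right side at y = 1 / v, so the claim
    becomes W v = 0 on 0 < v <= 1.\<close>
  define W where "W = (\<lambda>v. A v - E v + B v)"
  have a_bound: "norm (a n v) \<le> mangoldt (Suc n) / real (Suc n) ^ 3" if v: "v \<in> {0..1}" for n v
  proof -
    have "v ^ 3 * max 0 (1 - real (Suc n) * v) \<le> 1 / real (Suc n) ^ 3"
    proof (cases "real (Suc n) * v \<le> 1")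
      case True
      have "v ^ 3 * max 0 (1 - real (Suc n) * v) \<le> v ^ 3 * 1"
        using v by (intro mult_left_mono) auto
      also have "v \<le> 1 / real (Suc n)" using True by (simp add: field_simps)
      hence "v ^ 3 * 1 \<le> (1 / real (Suc n)) ^ 3" using v by (simp add: power_mono del: of_nat_Suc)
      finally show ?thesis by (simp add: power_divide del: of_nat_Suc)
    qed (simp add: max_def)
    hence "mangoldt (Suc n) * (v ^ 3 * max 0 (1 - real (Suc n) * v)) \<le> mangoldt (Suc n) * (1 / real (Suc n) ^ 3)"
      by (intro mult_left_mono mangoldt_nonneg)
    moreover have "norm (a n v) = mangoldt (Suc n) * (v ^ 3 * max 0 (1 - real (Suc n) * v))"
      using v unfolding a_def norm_mult norm_mangoldt norm_of_real by (simp del: of_nat_Suc)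
    ultimately show ?thesis by simp
  qed
  have a_cont: "continuous_on {0..1} (a n)" for n unfolding a_def by (intro continuous_intros)
  have re: "Re (3 - \<rho>) > 0" "Re (3 - \<rho>) \<ge> 2" if "\<rho> \<in> zeta_zeros" for \<rho> using zeta_zeros_props(1)[OF that] by auto
  have r_bound: "norm (r \<rho> v) \<le> 2 * norm (zero_weight \<rho>)" if \<rho>: "\<rho> \<in> zeta_zeros" and v: "v \<in> {0..1}" for \<rho> v
  proof -
    have "norm (of_real v powr (3 - \<rho>) :: complex) = v powr Re (3 - \<rho>)" using v by (simp add: norm_powr_real_powr)
    also have "\<dots> \<le> 1" using powr_mono2[of "Re (3 - \<rho>)" v 1] v re[OF \<rho>] by simp
    finally have "norm (of_real v powr (3 - \<rho>) - of_real (v ^ 4) :: complex) \<le> 1 + 1"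
      using v by (intro order.trans[OF norm_triangle_ineq4] add_mono) (auto simp: norm_power power_le_one)
    hence "norm (zero_weight \<rho>) * norm (of_real v powr (3 - \<rho>) - of_real (v ^ 4) :: complex) \<le> norm (zero_weight \<rho>) * 2"
      by (intro mult_left_mono) auto
    thus ?thesis by (simp add: r_def norm_mult mult.commute)
  qed
  have r_cont: "continuous_on {0..1} (r \<rho>)" if "\<rho> \<in> zeta_zeros" for \<rho>
    unfolding r_def using re[OF that]
    by (intro continuous_on_mult continuous_on_diff continuous_on_of_real_powr_unit continuous_intros)
  have r_summable: "(\<lambda>\<rho>. 2 * norm (zero_weight \<rho>)) summable_on zeta_zeros"
    by (intro summable_on_cmult_right summable_norm_zero_weight)
  have cont: "continuous_on {0..1} A" "continuous_on {0..1} B" "continuous_on {0..1} E"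
    unfolding A_def B_def E_def
    by (rule continuous_on_infsum[OF a_cont a_bound summable_on_mangoldt_cube], assumption)
       (rule continuous_on_infsum[OF r_cont r_bound r_summable], assumption+, intro continuous_intros, auto)
  have cont_W: "continuous_on {0..1} W" unfolding W_def by (intro continuous_intros cont)
  have moment: "integral {0..1} (\<lambda>v. W v * of_real (v ^ j)) = 0" for j
  proof -
    \<comment> \<open>The j-th moment in v is the Mellin integral in y at the integer k = j + 4,
      where the Dirichlet series and the partial fractions are available.\<close>
    define k where "k = real (j + 4)"
    have k: "k \<ge> 4" by (simp add: k_def)
    define D where "D = mangoldt_dirichlet (of_real k)"
    have vj: "norm (of_real (v ^ j) :: complex) \<le> 1" if "v \<in> {0..1}" for v
      using that by (simp add: norm_power power_le_one)
    have cj: "continuous_on {0..1} (\<lambda>v. complex_of_real (v ^ j))" by (intro continuous_intros)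
    have IA: "((\<lambda>v. of_real (v ^ j) * A v) has_integral D / of_real (k * (k + 1))) {0..1}"
    proof -
      have 1: "((\<lambda>n. integral {0..1} (\<lambda>v. of_real (v ^ j) * a n v)) has_sum integral {0..1} (\<lambda>v. of_real (v ^ j) * A v)) UNIV"
        unfolding A_def
        by (rule has_sum_integral(2)[OF _ _ a_bound summable_on_mangoldt_cube vj])
           (auto intro!: integrable_continuous_interval continuous_on_mult a_cont cj simp del: of_real_power)
      have "((\<lambda>v. of_real (v ^ j) * a n v) has_integral mangoldt (Suc n) / of_nat (Suc n) powr of_real k / of_real (k * (k + 1))) {0..1}" for n
      proof -
        have "((\<lambda>v. v ^ 3 * max 0 (1 - real (Suc n) * v) * v ^ j) has_integral 1 / real (Suc n) ^ (j + 4) / (k * (k + 1))) {0..1}"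
          using has_integral_truncated_linear[of "real (Suc n)" j] by (simp add: k_def add_ac del: of_nat_Suc)
        hence "((\<lambda>v. mangoldt (Suc n) * of_real (v ^ 3 * max 0 (1 - real (Suc n) * v) * v ^ j)) has_integral
          (mangoldt (Suc n) * of_real (1 / real (Suc n) ^ (j + 4) / (k * (k + 1))) :: complex)) {0..1}"
          by (intro has_integral_mult_right has_integral_of_real)
        moreover have "of_nat (Suc n) powr complex_of_real k = of_nat (Suc n) ^ (j + 4)"
          unfolding k_def of_real_of_nat_eq by (rule powr_nat') auto
        ultimately show ?thesis unfolding a_def
          by (simp add: mult_ac del: of_nat_Suc)
      qed
      hence "integral {0..1} (\<lambda>v. of_real (v ^ j) * a n v) = mangoldt (Suc n) / of_nat (Suc n) powr of_real k / of_real (k * (k + 1))" for n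
        by (rule integral_unique)
      with 1 have "((\<lambda>n. mangoldt (Suc n) / of_nat (Suc n) powr of_real k / of_real (k * (k + 1))) has_sum integral {0..1} (\<lambda>v. of_real (v ^ j) * A v)) UNIV"
        by (simp del: of_nat_Suc of_real_power)
      hence "(\<lambda>n. mangoldt (Suc n) / of_nat (Suc n) powr of_real k / of_real (k * (k + 1))) sums integral {0..1} (\<lambda>v. of_real (v ^ j) * A v)"
        by (rule has_sum_imp_sums)
      moreover have "(\<lambda>n. mangoldt (Suc n) / of_nat (Suc n) powr of_real k / of_real (k * (k + 1))) sums (D / of_real (k * (k + 1)))"
        unfolding D_def using k
        by (intro sums_divide summable_sums summable_norm_cancel[OF summable_norm_mangoldt_dirichlet]) auto
      ultimately have "integral {0..1} (\<lambda>v. of_real (v ^ j) * A v) = D / of_real (k * (k + 1))" by (rule sums_unique2)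
      moreover have "(\<lambda>v. of_real (v ^ j) * A v) integrable_on {0..1}"
        by (intro integrable_continuous_interval continuous_on_mult cj cont)
      ultimately show ?thesis by (metis integrable_integral)
    qed
    have IB: "((\<lambda>v. of_real (v ^ j) * B v) has_integral (1 / (of_real k - 1) - D - L + 1) / of_real (k * (k + 1))) {0..1}"
    proof -
      have 1: "((\<lambda>\<rho>. integral {0..1} (\<lambda>v. of_real (v ^ j) * r \<rho> v)) has_sum integral {0..1} (\<lambda>v. of_real (v ^ j) * B v)) zeta_zeros"
        unfolding B_def
        by (rule has_sum_integral(2)[OF _ _ r_bound r_summable vj])
           (auto intro!: integrable_continuous_interval continuous_on_mult r_cont cj simp del: of_real_power)
      have "integral {0..1} (\<lambda>v. of_real (v ^ j) * r \<rho> v) =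
        (of_int (zorder entire_zeta \<rho>) * (1 / (of_real k - \<rho>) + 1 / \<rho>)) / of_real (k * (k + 1))" if \<rho>: "\<rho> \<in> zeta_zeros" for \<rho>
      proof -
        have p: "\<rho> \<noteq> 0" "\<rho> + 1 \<noteq> 0" "of_real k - \<rho> \<noteq> 0" "Re (of_real k - \<rho>) > 0"
          using zeta_zeros_props(1,2)[OF \<rho>] zeta_zero_plus_one_nonzero[OF \<rho>] k by auto
        have k0: "complex_of_real k \<noteq> 0" "complex_of_real k + 1 \<noteq> 0"
          using k by (auto simp: complex_eq_iff)
        have "((\<lambda>v. of_real v powr (of_real k - \<rho> - 1) - of_real v powr (of_real (k + 1) - 1)) has_integral (1 / (of_real k - \<rho>) - 1 / of_real (k + 1))) {0..1}"
          using p k by (intro has_integral_diff has_integral_of_real_powr_unit) auto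
        hence "((\<lambda>v. zero_weight \<rho> * (of_real v powr (of_real k - \<rho> - 1) - of_real v powr (of_real (k + 1) - 1))) has_integral
            zero_weight \<rho> * (1 / (of_real k - \<rho>) - 1 / of_real (k + 1))) {0..1}"
          by (rule has_integral_mult_right)
        hence "((\<lambda>v. of_real (v ^ j) * r \<rho> v) has_integral zero_weight \<rho> * (1 / (of_real k - \<rho>) - 1 / of_real (k + 1))) {0..1}"
        proof (rule has_integral_eq[rotated])
          fix v :: real assume v: "v \<in> {0..1}"
          have "of_real v powr (3 - \<rho>) * of_real (v ^ j) = of_real v powr (of_real k - \<rho> - 1)"
            using v re[OF \<rho>] by (subst of_real_powr_mult_power) (auto simp: k_def algebra_simps)
          moreover have "of_real (v ^ 4) * of_real (v ^ j) = complex_of_real v powr (of_real (k + 1) - 1)"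
          proof (cases "v = 0")
            case False
            have "complex_of_real v powr (of_real (k + 1) - 1) = of_real v powr of_nat (j + 4)" by (simp add: k_def add.commute)
            also have "\<dots> = of_real v ^ (j + 4)" by (rule powr_nat') (use False in auto)
            finally show ?thesis by (simp add: power_add mult.commute)
          qed simp
          ultimately show "zero_weight \<rho> * (of_real v powr (of_real k - \<rho> - 1) - of_real v powr (of_real (k + 1) - 1)) = of_real (v ^ j) * r \<rho> v"
            unfolding r_def by (simp only: algebra_simps)
        qed
        hence "integral {0..1} (\<lambda>v. of_real (v ^ j) * r \<rho> v) = zero_weight \<rho> * (1 / (of_real k - \<rho>) - 1 / of_real (k + 1))"
          by (rule integral_unique)
        \<comment> \<open>The subtracted v^4, which is the \<open>- 1\<close> in
          \<open>of_real y powr (\<rho> + 1) - 1\<close>, produces the factor \<rho> + 1 that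
          cancels in the weight. What is left is the summand of the partial fractions at k, divided
          by k (k + 1).\<close>
        also have "1 / (of_real k - \<rho>) - 1 / of_real (k + 1) = (\<rho> + 1) / ((of_real k - \<rho>) * (of_real k + 1))"
          using p k0 by (simp add: divide_simps)
        also have "zero_weight \<rho> * \<dots> = of_int (zorder entire_zeta \<rho>) * (1 / (\<rho> * ((of_real k - \<rho>) * (of_real k + 1))))"
          using p(2) by (simp add: zero_weight_def)
        also have "1 / (\<rho> * ((of_real k - \<rho>) * (of_real k + 1))) = (1 / (of_real k - \<rho>) + 1 / \<rho>) / of_real (k * (k + 1))"
        proof -
          have "1 / (of_real k - \<rho>) + 1 / \<rho> = of_real k / (\<rho> * (of_real k - \<rho>))"
            using p by (simp add: divide_simps)
          thus ?thesis using k0 by (simp add: mult_ac)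
        qed
        finally show ?thesis by simp
      qed
      hence 2: "((\<lambda>\<rho>. (of_int (zorder entire_zeta \<rho>) * (1 / (of_real k - \<rho>) + 1 / \<rho>)) * (1 / of_real (k * (k + 1)))) has_sum integral {0..1} (\<lambda>v. of_real (v ^ j) * B v)) zeta_zeros"
        using 1 by (subst (asm) has_sum_cong) auto
      have "((\<lambda>\<rho>. (of_int (zorder entire_zeta \<rho>) * (1 / (of_real k - \<rho>) + 1 / \<rho>)) * (1 / of_real (k * (k + 1)))) has_sum
         (1 / (of_real k - 1) - D - L + 1) * (1 / of_real (k * (k + 1)))) zeta_zeros"
        unfolding D_def L_def using k by (intro has_sum_cmult_left has_sum_zeta_partial_fractions) simp
      from has_sum_unique[OF 2 this] have "integral {0..1} (\<lambda>v. of_real (v ^ j) * B v) = (1 / (of_real k - 1) - D - L + 1) / of_real (k * (k + 1))"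
        by simp
      moreover have "(\<lambda>v. of_real (v ^ j) * B v) integrable_on {0..1}"
        by (intro integrable_continuous_interval continuous_on_mult cj cont)
      ultimately show ?thesis by (metis integrable_integral)
    qed
    have pw: "((\<lambda>v. complex_of_real (v ^ n)) has_integral 1 / of_real (real n + 1)) {0..1}" for n
    proof -
      have "((\<lambda>v. v ^ n) has_integral (1 ^ Suc n / real (Suc n) - 0 ^ Suc n / real (Suc n))) {0..1 :: real}"
      proof (rule fundamental_theorem_of_calculus)
        show "((\<lambda>v. v ^ Suc n / real (Suc n)) has_vector_derivative v ^ n) (at v within {0..1})" for v :: real
        proof -
          have "((\<lambda>v. v ^ Suc n / real (Suc n)) has_real_derivative (real (Suc n) * v ^ n) / real (Suc n)) (at v within {0..1})"
            by (intro DERIV_cdivide) (auto intro!: derivative_eq_intros simp del: power_Suc)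
          thus ?thesis by (simp add: has_real_derivative_iff_has_vector_derivative del: of_nat_Suc power_Suc)
        qed
      qed simp
      hence "((\<lambda>v. v ^ n) has_integral (1 / (real n + 1))) {0..1 :: real}" by (simp add: add.commute)
      from has_integral_of_real[OF this, where 'b = complex] show ?thesis by simp
    qed
    have "((\<lambda>v. (of_real (v ^ (j + 2)) - of_real (v ^ (j + 4))) * (1/2) - L * (of_real (v ^ (j + 3)) - of_real (v ^ (j + 4)))) has_integral
       (1 / of_real (real (j + 2) + 1) - 1 / of_real (real (j + 4) + 1)) * (1/2) - L * (1 / of_real (real (j + 3) + 1) - 1 / of_real (real (j + 4) + 1))) {0..1}"
      by (intro has_integral_diff has_integral_mult_right has_integral_mult_left pw)
    also have "(\<lambda>v. (of_real (v ^ (j + 2)) - of_real (v ^ (j + 4))) * (1/2) - L * (of_real (v ^ (j + 3)) - of_real (v ^ (j + 4)))) = (\<lambda>v. of_real (v ^ j) * E v)"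
    proof
      fix v :: real
      have "(p * b - p * c) * (1/2) - L * (p * d - p * c) = p * ((b - c) / 2 - L * (d - c))" for p b c d
        by (simp add: field_simps)
      thus "(of_real (v ^ (j + 2)) - of_real (v ^ (j + 4))) * (1/2) - L * (of_real (v ^ (j + 3)) - of_real (v ^ (j + 4))) = of_real (v ^ j) * E v"
        unfolding E_def power_add of_real_mult of_real_diff .
    qed
    also have "real (j + 2) + 1 = k - 1" by (simp add: k_def)
    also have "real (j + 3) + 1 = k" by (simp add: k_def)
    also have "real (j + 4) + 1 = k + 1" by (simp add: k_def)
    finally have IE: "((\<lambda>v. of_real (v ^ j) * E v) has_integral
      (1 / of_real (k - 1) - 1 / of_real (k + 1)) * (1/2) - L * (1 / of_real k - 1 / of_real (k + 1))) {0..1}" .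
    from has_integral_add[OF has_integral_diff[OF IA IE] IB]
    have "((\<lambda>v. of_real (v ^ j) * A v - of_real (v ^ j) * E v + of_real (v ^ j) * B v) has_integral
      D / of_real (k * (k + 1)) - ((1 / of_real (k - 1) - 1 / of_real (k + 1)) * (1/2) - L * (1 / of_real k - 1 / of_real (k + 1)))
        + (1 / (of_real k - 1) - D - L + 1) / of_real (k * (k + 1))) {0..1}" .
    also have "(\<lambda>v. of_real (v ^ j) * A v - of_real (v ^ j) * E v + of_real (v ^ j) * B v) = (\<lambda>v. W v * of_real (v ^ j))"
      by (simp add: W_def algebra_simps fun_eq_iff)
    \<comment> \<open>Here D and L cancel by the partial fraction expansion at k; the rest is an
      identity between rational functions of k.\<close>
    also have "D / of_real (k * (k + 1)) - ((1 / of_real (k - 1) - 1 / of_real (k + 1)) * (1/2) - L * (1 / of_real k - 1 / of_real (k + 1)))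
        + (1 / (of_real k - 1) - D - L + 1) / of_real (k * (k + 1)) = 0"
    proof -
      have n: "complex_of_real k \<noteq> 0" "complex_of_real k + 1 \<noteq> 0" "complex_of_real k - 1 \<noteq> 0"
        using k by (auto simp: complex_eq_iff)
      have e1: "(1 / (of_real k - 1) - 1 / (of_real k + 1)) * (1/2) = 1 / ((complex_of_real k - 1) * (of_real k + 1))"
        using n by (simp add: divide_simps)
      have e2: "1 / of_real k - 1 / (of_real k + 1) = 1 / (complex_of_real k * (of_real k + 1))"
        using n by (simp add: divide_simps)
      have e3: "1 / ((complex_of_real k - 1) * (of_real k + 1)) = (1 / (of_real k - 1) + 1) / (of_real k * (of_real k + 1))"
        using n by (simp add: divide_simps)
      show ?thesis unfolding of_real_mult of_real_add of_real_diff of_real_1 e1 e2 e3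
        by (simp add: add_divide_distrib diff_divide_distrib)
    qed
    finally show ?thesis by (rule integral_unique)
  qed
  define v where "v = 1 / y"
  have v: "0 < v" "v \<le> 1" using y by (auto simp: v_def)
  have y4: "complex_of_real (v ^ 4) \<noteq> 0" using v by simp
  have yv: "y = 1 / v" using y by (simp add: v_def)
  have W0: "A v - E v + B v = 0"
    using continuous_zero_moments_imp_zero[OF cont_W moment v] by (simp add: W_def)
  have eA: "A v = of_real (v ^ 4) * (\<Sum>\<^sub>\<infinity>n. mangoldt (Suc n) * of_real (max 0 (y - real (Suc n))))"
  proof -
    have "a n v = of_real (v ^ 4) * (mangoldt (Suc n) * of_real (max 0 (y - real (Suc n))))" for n
    proof -
      have "v * max 0 (y - real (Suc n)) = max (v * 0) (v * (y - real (Suc n)))"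
        using v by (simp only: max_mult_distrib_left if_True less_imp_le)
      also have "v * (y - real (Suc n)) = 1 - real (Suc n) * v" using v by (simp add: yv right_diff_distrib del: of_nat_Suc)
      finally have "v ^ 3 * max 0 (1 - real (Suc n) * v) = v ^ 4 * max 0 (y - real (Suc n))"
        by (simp add: eval_nat_numeral mult_ac del: of_nat_Suc)
      thus ?thesis unfolding a_def by (simp only: of_real_mult mult_ac)
    qed
    thus ?thesis unfolding A_def by (simp only: infsum_cmult_right')
  qed
  have eB: "B v = of_real (v ^ 4) * (\<Sum>\<^sub>\<infinity>\<rho>\<in>zeta_zeros. zero_weight \<rho> * (of_real y powr (\<rho> + 1) - 1))"
  proof -
    have "r \<rho> v = of_real (v ^ 4) * (zero_weight \<rho> * (of_real y powr (\<rho> + 1) - 1))" for \<rho>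
    proof -
      have "of_real v powr (3 - \<rho>) = of_real v powr (of_nat 4 + (- (\<rho> + 1)))" by (simp add: algebra_simps)
      also have "\<dots> = of_real (v ^ 4) * of_real v powr (- (\<rho> + 1))"
        unfolding powr_add using v powr_nat'[of "of_real v" 4] by simp
      also have "complex_of_real v powr (- (\<rho> + 1)) = of_real y powr (\<rho> + 1)"
      proof -
        have "complex_of_real (v * y) powr (\<rho> + 1) = of_real v powr (\<rho> + 1) * of_real y powr (\<rho> + 1)"
          unfolding of_real_mult using v y by (intro powr_times_real) auto
        moreover have "v * y = 1" using y by (simp add: v_def)
        moreover have "complex_of_real v powr (\<rho> + 1) \<noteq> 0" using v by simp
        ultimately show ?thesis unfolding powr_minus_divide by (simp add: field_simps)
      qed
      finally show ?thesis by (simp add: r_def algebra_simps)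
    qed
    thus ?thesis unfolding B_def by (simp only: infsum_cmult_right')
  qed
  have eE: "E v = of_real (v ^ 4) * ((of_real y ^ 2 - 1) / 2 - L * (of_real y - 1))"
    using v by (simp add: E_def yv eval_nat_numeral algebra_simps)
  have "of_real (v ^ 4) * ((\<Sum>\<^sub>\<infinity>n. mangoldt (Suc n) * of_real (max 0 (y - real (Suc n)))) -
     ((of_real y ^ 2 - 1) / 2 - L * (of_real y - 1)) + (\<Sum>\<^sub>\<infinity>\<rho>\<in>zeta_zeros. zero_weight \<rho> * (of_real y powr (\<rho> + 1) - 1))) = 0"
    using W0 unfolding eA eB eE by (simp only: right_diff_distrib distrib_left)
  hence "(\<Sum>\<^sub>\<infinity>n. mangoldt (Suc n) * of_real (max 0 (y - real (Suc n)))) -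
     ((of_real y ^ 2 - 1) / 2 - L * (of_real y - 1)) + (\<Sum>\<^sub>\<infinity>\<rho>\<in>zeta_zeros. zero_weight \<rho> * (of_real y powr (\<rho> + 1) - 1)) = 0"
    using y4 by (simp only: mult_eq_0_iff simp_thms)
  thus ?thesis by (simp add: algebra_simps)
qed

subsection \<open>The explicit formula\<close>

lemma nontrivial_zeta_zeros_eq:
  "nontrivial_zeta_zeros = zeta_zeros - range (\<lambda>n. - 2 * of_nat (Suc n))"
proof -
  have "(\<forall>n\<ge>1. \<rho> \<noteq> - 2 * of_nat n) \<longleftrightarrow> \<rho> \<notin> range (\<lambda>n. - 2 * of_nat (Suc n))" for \<rho> :: complex
  proof
    assume "\<forall>n\<ge>1. \<rho> \<noteq> - 2 * of_nat n"
    thus "\<rho> \<notin> range (\<lambda>n. - 2 * of_nat (Suc n))" by force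
  next
    assume h: "\<rho> \<notin> range (\<lambda>n. - 2 * of_nat (Suc n))"
    show "\<forall>n\<ge>1. \<rho> \<noteq> - 2 * of_nat n"
    proof (intro allI impI notI)
      fix n :: nat assume "n \<ge> 1" "\<rho> = - 2 * of_nat n"
      hence "\<rho> = - 2 * of_nat (Suc (n - 1))" by simp
      with h show False by blast
    qed
  qed
  moreover have "riemann_zeta \<rho> = 0 \<and> \<rho> \<noteq> 1 \<longleftrightarrow> entire_zeta \<rho> = 0" for \<rho>
    using entire_zeta_1 by (auto simp: riemann_zeta_eq)
  ultimately show ?thesis unfolding nontrivial_zeta_zeros_def by auto
qed

lemma trivial_zeros_subset: "range (\<lambda>n. - 2 * of_nat (Suc n)) \<subseteq> zeta_zeros"
proof (intro image_subsetI CollectI)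
  fix n :: nat
  have "Re (- 2 * of_nat (Suc n)) < 0" by simp
  from entire_zeta_eq_0_left_iff[OF this] show "entire_zeta (- 2 * of_nat (Suc n)) = 0"
    by (metis One_nat_def Suc_le_mono le0)
qed

lemma zorder_riemann_zeta:
  assumes "\<rho> \<noteq> 1"
  shows "zorder riemann_zeta \<rho> = zorder entire_zeta \<rho>"
proof -
  have ana: "entire_zeta analytic_on {\<rho>}" using holomorphic_entire_zeta by (auto simp: analytic_on_holomorphic)
  have ana': "(\<lambda>s. 1 / (s - 1)) analytic_on {\<rho>}" using assms by (auto intro!: analytic_intros)
  have "eventually (\<lambda>s. s \<in> - {1}) (at \<rho>)" by (rule eventually_at_in_open') (use assms in auto)
  hence ev1: "eventually (\<lambda>s. s \<noteq> 1) (at \<rho>)" by simp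
  have ev: "eventually (\<lambda>s. entire_zeta s \<noteq> 0) (at \<rho>)"
    using non_zero_neighbour_alt[OF holomorphic_entire_zeta open_UNIV connected_UNIV, of \<rho> 0] entire_zeta_0 by auto
  have "zorder riemann_zeta \<rho> = zorder (\<lambda>s. entire_zeta s * (1 / (s - 1))) \<rho>"
    by (rule zorder_cong) (use ev1 in \<open>auto simp: riemann_zeta_eq elim: eventually_mono\<close>)
  also have "\<dots> = zorder entire_zeta \<rho> + zorder (\<lambda>s. 1 / (s - 1)) \<rho>"
  proof (rule zorder_times_analytic[OF ana ana'])
    show "\<forall>\<^sub>F z in at \<rho>. entire_zeta z * (1 / (z - 1)) \<noteq> 0"
      using ev ev1 by eventually_elim auto
  qed
  also have "zorder (\<lambda>s. 1 / (s - 1)) \<rho> = 0" by (rule zorder_eq_0I[OF ana']) (use assms in auto)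
  finally show ?thesis by simp
qed

lemma finite_nontrivial_zeros: "finite {\<rho>. \<rho> \<in> nontrivial_zeta_zeros \<and> \<bar>Im \<rho>\<bar> < T}"
proof (rule finite_subset)
  show "finite {\<rho>. entire_zeta \<rho> = 0 \<and> norm \<rho> \<le> 1 + \<bar>T\<bar>}"
    by (rule finite_zeros_cball[OF holomorphic_entire_zeta]) (simp add: entire_zeta_0)
  show "{\<rho>. \<rho> \<in> nontrivial_zeta_zeros \<and> \<bar>Im \<rho>\<bar> < T} \<subseteq> {\<rho>. entire_zeta \<rho> = 0 \<and> norm \<rho> \<le> 1 + \<bar>T\<bar>}"
  proof safe
    fix \<rho> assume \<rho>: "\<rho> \<in> nontrivial_zeta_zeros" "\<bar>Im \<rho>\<bar> < T"
    hence z: "\<rho> \<in> zeta_zeros" by (simp add: nontrivial_zeta_zeros_eq)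
    thus "entire_zeta \<rho> = 0" by simp
    have "Re \<rho> \<ge> 0"
    proof (rule ccontr)
      assume "\<not> 0 \<le> Re \<rho>"
      then obtain n :: nat where "n \<ge> 1" "\<rho> = - 2 * of_nat n" using zeta_zeros_props(5)[OF z] by auto
      thus False using \<rho>(1) by (auto simp: nontrivial_zeta_zeros_def)
    qed
    thus "norm \<rho> \<le> 1 + \<bar>T\<bar>" using zeta_zeros_props(1)[OF z] \<rho>(2) cmod_le[of \<rho>] by linarith
  qed
qed

lemma tendsto_zeta_zero_sum:
  assumes "((\<lambda>\<rho>. of_int (zorder riemann_zeta \<rho>) * (of_real x powr \<rho> * F \<rho>)) has_sum R) nontrivial_zeta_zeros"
  shows "(zeta_zero_sum F x \<longlongrightarrow> R) at_top"
proof -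
  define P where "P = (\<lambda>T. {\<rho>. \<rho> \<in> nontrivial_zeta_zeros \<and> \<bar>Im \<rho>\<bar> < T})"
  have "filterlim P (finite_subsets_at_top nontrivial_zeta_zeros) at_top"
  proof (rule filterlim_finite_subsets_at_topI)
    show "eventually (\<lambda>T. \<rho> \<in> P T) at_top" if "\<rho> \<in> nontrivial_zeta_zeros" for \<rho>
      using eventually_gt_at_top[of "\<bar>Im \<rho>\<bar>"] by eventually_elim (use that in \<open>auto simp: P_def\<close>)
  qed (use finite_nontrivial_zeros in \<open>auto simp: P_def\<close>)
  from filterlim_compose[OF assms[unfolded has_sum_def] this]
  show ?thesis by (simp add: zeta_zero_sum_def[abs_def] P_def)
qed

section \<open>Integration against the second derivative\<close>

text \<open>Taylor's formula with integral remainder, expanded at b, where f and f1 vanish; the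
  maximum cuts the integral off at t = c / x. If c / x exceeds b, both sides are 0.\<close>

lemma integral_second_derivative_taylor:
  fixes f f1 f2 :: "real \<Rightarrow> real"
  assumes x: "x > 0" and xb: "1 / x \<le> b" and c: "c \<ge> 1"
    and f: "\<And>t. t > 0 \<Longrightarrow> (f has_real_derivative f1 t) (at t)"
      "\<And>t. t > 0 \<Longrightarrow> (f1 has_real_derivative f2 t) (at t)"
    and b: "\<And>t. t \<ge> b \<Longrightarrow> f t = 0" "f1 b = 0"
  shows "((\<lambda>t. f2 t * max 0 (x * t - c)) has_integral x * f (c / x)) {1 / x..b}"
proof (cases "c / x \<le> b")
  case True
  have "1 / x \<le> c / x" using x c by (simp add: divide_right_mono)
  have pos: "t > 0" if "t \<ge> c / x" for t using that x c by (meson divide_pos_pos less_le_trans zero_less_one)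
  have "((\<lambda>t. f2 t * (x * t - c)) has_integral ((f1 b * (x * b - c) - x * f b) - (f1 (c / x) * (x * (c / x) - c) - x * f (c / x)))) {c / x..b}"
  proof (rule fundamental_theorem_of_calculus[OF True])
    fix t assume "t \<in> {c / x..b}"
    hence t: "t > 0" using pos by auto
    have "((\<lambda>t. f1 t * (x * t - c) - x * f t) has_real_derivative f2 t * (x * t - c)) (at t)"
      using f[OF t] by (auto intro!: derivative_eq_intros)
    thus "((\<lambda>t. f1 t * (x * t - c) - x * f t) has_vector_derivative f2 t * (x * t - c)) (at t within {c / x..b})"
      by (simp add: has_real_derivative_iff_has_vector_derivative has_vector_derivative_at_within)
  qed
  hence "((\<lambda>t. f2 t * (x * t - c)) has_integral x * f (c / x)) {c / x..b}"
    using b x by simp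
  hence 2: "((\<lambda>t. f2 t * max 0 (x * t - c)) has_integral x * f (c / x)) {c / x..b}"
    by (rule has_integral_eq[rotated]) (use x in \<open>auto simp: max_def field_simps\<close>)
  have 1: "((\<lambda>t. f2 t * max 0 (x * t - c)) has_integral 0) {1 / x..c / x}"
    by (rule has_integral_is_0) (use x in \<open>auto simp: max_def field_simps\<close>)
  from has_integral_combine[OF \<open>1 / x \<le> c / x\<close> True 1 2] show ?thesis by simp
next
  case False
  have "((\<lambda>t. f2 t * max 0 (x * t - c)) has_integral 0) {1 / x..b}"
  proof (rule has_integral_is_0)
    fix t assume "t \<in> {1 / x..b}"
    hence "t < c / x" using False by auto
    hence "x * t - c \<le> 0" using x by (simp add: field_simps)
    thus "f2 t * max 0 (x * t - c) = 0" by simp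
  qed
  thus ?thesis using b(1)[of "c / x"] False by simp
qed

text \<open>The formula for \<open>\<psi>\<^sub>1\<close> at y = x t is multiplied by f2 t and
  integrated over {1 / x..b}, where y >= 1. A kernel max 0 (x t - n) yields x f(n / x), and a power
  yields x powr (\<rho> + 1) \<rho> (\<rho> + 1) F \<rho>, whose polynomial factor cancels in the
  weight. The conditions at 1 / x remove the boundary terms. The sum over all zeros is
  unconditional, so it splits into trivial and nontrivial zeros and the latter may be summed by
  height.\<close>

theorem explicit_formula_constant_near_zero:
  fixes f f1 f2 :: "real \<Rightarrow> real" and x b :: real and F :: "complex \<Rightarrow> complex"
  assumes x: "x > 1" and xb: "1 / x < b"
    and f: "\<And>t. t > 0 \<Longrightarrow> (f has_real_derivative f1 t) (at t)"
      "\<And>t. t > 0 \<Longrightarrow> (f1 has_real_derivative f2 t) (at t)"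
    and M: "\<And>t. \<bar>f2 t\<bar> \<le> M"
    and b: "\<And>t. t \<ge> b \<Longrightarrow> f t = 0" "f1 b = 0" and start: "f (1 / x) = 1" "f1 (1 / x) = 0"
    and F: "\<And>s. s \<noteq> 0 \<Longrightarrow> F s = - integral {1 / x..b} (\<lambda>t. of_real (f1 t) * of_real t powr s) / s"
  shows "\<exists>R. summable (\<lambda>n. trivial_zero_term F x (Suc n)) \<and> (zeta_zero_sum F x \<longlongrightarrow> R) at_top \<and>
    complex_of_real (smoothed_chebyshev f x) =
      of_real x * F 1 - R - deriv riemann_zeta 0 / riemann_zeta 0 - (\<Sum>n. trivial_zero_term F x (Suc n))"
proof -
  define L where "L = deriv riemann_zeta 0 / riemann_zeta 0"
  define I where "I = {1 / x..b}"
  have x0: "x > 0" using x by simp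
  have c0: "0 < 1 / x" "1 / x \<le> b" using x xb by auto
  have M0: "M \<ge> 0" using order.trans[OF abs_ge_zero M] .
  have xt: "x * t \<ge> 1" "x * t \<le> b * x" "t > 0" if "t \<in> I" for t
  proof -
    show "x * t \<ge> 1" "x * t \<le> b * x" using that x by (auto simp: I_def field_simps)
    have "1 / x \<le> t" using that by (simp add: I_def)
    thus "t > 0" using c0(1) by linarith
  qed
  have J: "((\<lambda>t. of_real (f2 t) * of_real t powr (s + 1)) has_integral (s + 1) * (s * F s)) I" if "s \<noteq> 0" for s
    using has_integral_second_derivative_powr[OF c0 f(2) start(2) b(2), of s] F[OF that] that by (simp add: I_def)
  have Jx: "((\<lambda>t. of_real (f2 t) * of_real (x * t) powr (s + 1)) has_integral of_real x * ((s + 1) * s) * (of_real x powr s * F s)) I"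
    if "s \<noteq> 0" for s
  proof -
    have 1: "((\<lambda>t. of_real x powr (s + 1) * (of_real (f2 t) * of_real t powr (s + 1))) has_integral (of_real x powr (s + 1) * ((s + 1) * (s * F s)))) I"
      by (intro has_integral_mult_right J that)
    have 2: "of_real x powr (s + 1) * ((s + 1) * (s * F s)) = of_real x * ((s + 1) * s) * (of_real x powr s * F s)"
      using x by (simp add: powr_add mult_ac)
    have 3: "of_real x powr (s + 1) * (of_real (f2 t) * of_real t powr (s + 1)) = of_real (f2 t) * of_real (x * t) powr (s + 1)" if "t \<in> I" for t
      using xt[OF that] x by (simp add: powr_times_real mult_ac)
    show ?thesis using has_integral_eq[OF 3 1] unfolding 2 .
  qed
  \<comment> \<open>f1 vanishes at both ends, so every constant in the formula for
    \<open>\<psi>\<^sub>1\<close> integrates to 0.\<close>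
  have J0: "((\<lambda>t. complex_of_real (f2 t)) has_integral 0) I"
  proof -
    have "(f2 has_integral (f1 b - f1 (1 / x))) I" unfolding I_def
    proof (rule fundamental_theorem_of_calculus[OF c0(2)])
      fix t assume "t \<in> {1 / x..b}"
      hence "t > 0" using xt(3)[of t] by (simp add: I_def)
      from f(2)[OF this] show "(f1 has_vector_derivative f2 t) (at t within {1 / x..b})"
        unfolding has_real_derivative_iff_has_vector_derivative by (rule has_vector_derivative_at_within)
    qed
    from has_integral_of_real[OF this, where 'b = complex] show ?thesis using b start by simp
  qed
  have taylor: "((\<lambda>t. complex_of_real (f2 t) * of_real (max 0 (x * t - c))) has_integral of_real (x * f (c / x))) I" if "c \<ge> 1" for c
    using has_integral_of_real[OF integral_second_derivative_taylor[OF x0 c0(2) that f b], where 'b = complex]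
    unfolding I_def by simp
  have zp: "\<rho> \<noteq> 0" "\<rho> + 1 \<noteq> 0" "Re \<rho> \<le> 1" if "\<rho> \<in> zeta_zeros" for \<rho>
    using zeta_zeros_props(1,2)[OF that] zeta_zero_plus_one_nonzero[OF that] by auto
  define e where "e = (\<lambda>\<rho> t. zero_weight \<rho> * (of_real (x * t) powr (\<rho> + 1) - 1))"
  have e_int: "((\<lambda>t. of_real (f2 t) * e \<rho> t) has_integral of_real x * (of_int (zorder entire_zeta \<rho>) * (of_real x powr \<rho> * F \<rho>))) I"
    if \<rho>: "\<rho> \<in> zeta_zeros" for \<rho>
  proof -
    have "((\<lambda>t. zero_weight \<rho> * (of_real (f2 t) * of_real (x * t) powr (\<rho> + 1) - of_real (f2 t))) has_integral
      zero_weight \<rho> * (of_real x * ((\<rho> + 1) * \<rho>) * (of_real x powr \<rho> * F \<rho>) - 0)) I"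
      using zp[OF \<rho>] by (intro has_integral_mult_right has_integral_diff Jx J0)
    moreover have "zero_weight \<rho> * (of_real x * ((\<rho> + 1) * \<rho>) * (of_real x powr \<rho> * F \<rho>) - 0) = of_real x * (of_int (zorder entire_zeta \<rho>) * (of_real x powr \<rho> * F \<rho>))"
      using zp[OF \<rho>] by (simp add: zero_weight_def)
    moreover have "(\<lambda>t. zero_weight \<rho> * (of_real (f2 t) * of_real (x * t) powr (\<rho> + 1) - of_real (f2 t))) = (\<lambda>t. of_real (f2 t) * e \<rho> t)"
      by (simp add: e_def algebra_simps fun_eq_iff)
    ultimately show ?thesis by (simp only:)
  qed
  \<comment> \<open>As 1 <= x t <= b x and Re \<rho> <= 1, all powers are at most (b x)^2, uniformly
    even for the trivial zeros far to the left. This is where t >= 1 / x enters.\<close>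
  define B where "B = (b * x) ^ 2 + 1"
  have e_bound: "norm (e \<rho> t) \<le> norm (zero_weight \<rho>) * B" if \<rho>: "\<rho> \<in> zeta_zeros" and t: "t \<in> {1 / x..b}" for \<rho> t
  proof -
    have t': "x * t \<ge> 1" "x * t \<le> b * x" using xt[of t] t by (auto simp: I_def)
    have "norm (of_real (x * t) powr (\<rho> + 1) :: complex) = (x * t) powr (Re \<rho> + 1)"
      using t' by (subst norm_powr_real_powr) auto
    also have "\<dots> \<le> (x * t) powr 2" using t' zp[OF \<rho>] by (intro powr_mono) auto
    also have "\<dots> = (x * t) ^ 2" using t' by (simp add: powr_numeral)
    also have "\<dots> \<le> (b * x) ^ 2" using t' by (intro power_mono) auto
    finally have "norm (of_real (x * t) powr (\<rho> + 1) - 1 :: complex) \<le> B"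
      unfolding B_def by (intro order.trans[OF norm_triangle_ineq4] add_mono) auto
    thus ?thesis unfolding e_def norm_mult by (intro mult_left_mono) auto
  qed
  have B_sum: "(\<lambda>\<rho>. norm (zero_weight \<rho>) * B) summable_on zeta_zeros"
    by (intro summable_on_cmult_left summable_norm_zero_weight)
  have f2_bound: "norm (complex_of_real (f2 t)) \<le> M" for t using M[of t] by simp
  define \<Sigma> where "\<Sigma> = integral I (\<lambda>t. of_real (f2 t) * (\<Sum>\<^sub>\<infinity>\<rho>\<in>zeta_zeros. e \<rho> t))"
  have e_int': "(\<lambda>t. of_real (f2 t) * e \<rho> t) integrable_on {1 / x..b}" if "\<rho> \<in> zeta_zeros" for \<rho>
    using e_int[OF that] unfolding I_def by blast
  note hsI = has_sum_integral[OF c0(2) e_int' e_bound B_sum f2_bound, folded I_def]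
  have "((\<lambda>t. of_real (f2 t) * (\<Sum>\<^sub>\<infinity>\<rho>\<in>zeta_zeros. e \<rho> t)) has_integral \<Sigma>) I"
    unfolding \<Sigma>_def by (rule integrable_integral) (rule hsI(1))
  have hs: "((\<lambda>\<rho>. of_real x * (of_int (zorder entire_zeta \<rho>) * (of_real x powr \<rho> * F \<rho>))) has_sum \<Sigma>) zeta_zeros"
    using hsI(2) unfolding \<Sigma>_def by (subst has_sum_cong[OF integral_unique[OF e_int, symmetric]])
  define T where "T = \<Sigma> / of_real x"
  have hsT: "((\<lambda>\<rho>. of_int (zorder entire_zeta \<rho>) * (of_real x powr \<rho> * F \<rho>)) has_sum T) zeta_zeros"
    using has_sum_cmult_left[OF hs, of "1 / of_real x"] x by (simp add: T_def)
  define N where "N = nat \<lceil>b * x\<rceil>"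
  have N: "b * x \<le> real (Suc n)" if "n \<ge> N" for n
    using that by (simp add: N_def)
  have S: "of_real x * complex_of_real (smoothed_chebyshev f x) = (\<Sum>n<N. mangoldt (Suc n) * of_real (x * f (real (Suc n) / x)))"
  proof -
    have "smoothed_chebyshev f x = (\<Sum>n<N. mangoldt (Suc n) * f (real (Suc n) / x))"
      unfolding smoothed_chebyshev_def
    proof (rule suminf_finite)
      fix n assume "n \<notin> {..<N}"
      hence "b \<le> real (Suc n) / x" using N[of n] x by (simp add: field_simps)
      thus "mangoldt (Suc n) * f (real (Suc n) / x) = 0" using b(1) by simp
    qed simp
    thus ?thesis by (simp add: sum_distrib_left mult_ac del: of_nat_Suc)
  qed
  have "((\<lambda>t. \<Sum>n<N. mangoldt (Suc n) * (complex_of_real (f2 t) * of_real (max 0 (x * t - real (Suc n))))) has_integral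
      (\<Sum>n<N. mangoldt (Suc n) * of_real (x * f (real (Suc n) / x)))) I"
    by (intro has_integral_sum has_integral_mult_right taylor) auto
  hence I1: "((\<lambda>t. \<Sum>n<N. mangoldt (Suc n) * (complex_of_real (f2 t) * of_real (max 0 (x * t - real (Suc n))))) has_integral
      of_real x * complex_of_real (smoothed_chebyshev f x)) I" unfolding S .
  \<comment> \<open>The term (y^2 - 1) / 2 is the power integral at s = 1, and y - 1 = max 0 (y - 1)
    is the Taylor kernel with c = 1, whose integral is x f(1 / x) = x.\<close>
  have "((\<lambda>t. (of_real (f2 t) * of_real (x * t) powr (1 + 1) - of_real (f2 t)) * (1/2) - L * (of_real (f2 t) * of_real (max 0 (x * t - 1)))
       - of_real (f2 t) * (\<Sum>\<^sub>\<infinity>\<rho>\<in>zeta_zeros. e \<rho> t)) has_integral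
      (of_real x * ((1 + 1) * 1) * (of_real x powr 1 * F 1) - 0) * (1/2) - L * of_real (x * f (1 / x)) - \<Sigma>) I"
    using \<open>(_ has_integral \<Sigma>) I\<close> by (intro has_integral_diff has_integral_mult_left has_integral_mult_right Jx J0 taylor) auto
  moreover have "(of_real (f2 t) * of_real (x * t) powr (1 + 1) - of_real (f2 t)) * (1/2) - L * (of_real (f2 t) * of_real (max 0 (x * t - 1)))
       - of_real (f2 t) * (\<Sum>\<^sub>\<infinity>\<rho>\<in>zeta_zeros. e \<rho> t) = (\<Sum>n<N. mangoldt (Suc n) * (complex_of_real (f2 t) * of_real (max 0 (x * t - real (Suc n)))))"
    if t: "t \<in> I" for t
  proof -
    have "(\<Sum>\<^sub>\<infinity>n. mangoldt (Suc n) * complex_of_real (max 0 (x * t - real (Suc n)))) = (\<Sum>\<^sub>\<infinity>n\<in>{..<N}. mangoldt (Suc n) * of_real (max 0 (x * t - real (Suc n))))"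
    proof (rule infsum_cong_neutral)
      fix n assume "n \<in> UNIV - {..<N}"
      hence "x * t - real (Suc n) \<le> 0" using N[of n] xt(2)[OF t] by auto
      thus "mangoldt (Suc n) * complex_of_real (max 0 (x * t - real (Suc n))) = 0" by simp
    qed auto
    also have "\<dots> = (\<Sum>n<N. mangoldt (Suc n) * of_real (max 0 (x * t - real (Suc n))))" by simp
    finally have "(\<Sum>n<N. mangoldt (Suc n) * of_real (max 0 (x * t - real (Suc n)))) =
      (of_real (x * t) ^ 2 - 1) / 2 - L * (of_real (x * t) - 1) - (\<Sum>\<^sub>\<infinity>\<rho>\<in>zeta_zeros. e \<rho> t)"
      using integrated_chebyshev_explicit_formula[OF xt(1)[OF t]] unfolding L_def e_def by simp
    moreover have "(\<Sum>n<N. mangoldt (Suc n) * (complex_of_real (f2 t) * of_real (max 0 (x * t - real (Suc n))))) =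
      of_real (f2 t) * (\<Sum>n<N. mangoldt (Suc n) * of_real (max 0 (x * t - real (Suc n))))"
      by (simp add: sum_distrib_left mult_ac)
    moreover have "of_real (x * t) powr (1 + 1) = complex_of_real (x * t) ^ 2"
      using xt[OF t] x powr_nat'[of "complex_of_real (x * t)" 2] by simp
    moreover have "max 0 (x * t - 1) = x * t - 1" using xt[OF t] by simp
    moreover have "(g * p - g) * (1/2) - l * (g * q) - g * u = g * ((p - 1) / 2 - l * q - u)" for g p l q u :: complex
      by (simp add: field_simps)
    ultimately show ?thesis by (simp only: of_real_diff of_real_1)
  qed
  ultimately have "((\<lambda>t. \<Sum>n<N. mangoldt (Suc n) * (complex_of_real (f2 t) * of_real (max 0 (x * t - real (Suc n))))) has_integral
      (of_real x * ((1 + 1) * 1) * (of_real x powr 1 * F 1) - 0) * (1/2) - L * of_real (x * f (1 / x)) - \<Sigma>) I"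
    by (rule has_integral_eq[rotated])
  from has_integral_unique[OF I1 this]
  have "of_real x * complex_of_real (smoothed_chebyshev f x) = of_real x * (of_real x * F 1) - of_real x * L - of_real x * T"
    using x start by (simp add: T_def)
  hence "of_real x * complex_of_real (smoothed_chebyshev f x) = of_real x * (of_real x * F 1 - L - T)"
    by (simp only: right_diff_distrib)
  hence main: "complex_of_real (smoothed_chebyshev f x) = of_real x * F 1 - L - T" using x by simp
  \<comment> \<open>\<open>Suc n\<close> makes the enumeration start at -2. Since trivial zeros are
    simple, composing the summand with \<open>tz\<close> gives exactly
    \<open>trivial_zero_term\<close>.\<close>
  define tz where "tz = (\<lambda>n. - 2 * of_nat (Suc n) :: complex)"
  define h where "h = (\<lambda>\<rho>. of_int (zorder entire_zeta \<rho>) * (of_real x powr \<rho> * F \<rho>))"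
  have h_sum: "h summable_on zeta_zeros" using hsT unfolding h_def by (rule has_sum_imp_summable)
  have sub: "range tz \<subseteq> zeta_zeros" unfolding tz_def by (rule trivial_zeros_subset)
  have inj: "inj tz" by (rule injI) (simp add: tz_def)
  have "h summable_on range tz" using h_sum sub by (rule summable_on_subset_banach)
  hence triv: "(h has_sum infsum h (range tz)) (range tz)" by (rule has_sum_infsum)
  hence "((h \<circ> tz) has_sum infsum h (range tz)) UNIV" by (simp only: has_sum_reindex[OF inj])
  moreover have "(h \<circ> tz) n = trivial_zero_term F x (Suc n)" for n
    using zorder_entire_zeta_trivial_zero[of "Suc n"] unfolding h_def tz_def trivial_zero_term_def o_def by simp
  hence "h \<circ> tz = (\<lambda>n. trivial_zero_term F x (Suc n))" by blast
  ultimately have ts: "(\<lambda>n. trivial_zero_term F x (Suc n)) sums infsum h (range tz)"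
    using has_sum_imp_sums by metis
  have "(h has_sum (T - infsum h (range tz))) nontrivial_zeta_zeros"
    unfolding nontrivial_zeta_zeros_eq tz_def[symmetric]
    using hsT triv sub unfolding h_def[symmetric] by (intro has_sum_Diff)
  moreover have "h \<rho> = of_int (zorder riemann_zeta \<rho>) * (of_real x powr \<rho> * F \<rho>)" if "\<rho> \<in> nontrivial_zeta_zeros" for \<rho>
    using that zorder_riemann_zeta[of \<rho>] by (simp add: h_def nontrivial_zeta_zeros_def)
  ultimately have "((\<lambda>\<rho>. of_int (zorder riemann_zeta \<rho>) * (of_real x powr \<rho> * F \<rho>)) has_sum (T - infsum h (range tz))) nontrivial_zeta_zeros"
    using has_sum_cong by (metis (no_types, lifting))
  hence "(zeta_zero_sum F x \<longlongrightarrow> T - infsum h (range tz)) at_top" by (rule tendsto_zeta_zero_sum)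
  moreover have "summable (\<lambda>n. trivial_zero_term F x (Suc n))" "(\<Sum>n. trivial_zero_term F x (Suc n)) = infsum h (range tz)"
    using ts by (simp_all add: sums_iff)
  ultimately show ?thesis using main by (intro exI[of _ "T - infsum h (range tz)"]) (simp add: L_def)
qed

section \<open>The case a x < 1\<close>

lemma eq_limit_from_left:
  fixes h :: "real \<Rightarrow> real"
  assumes "isCont h m" "a < m" "\<And>t. a < t \<Longrightarrow> t < m \<Longrightarrow> h t = c"
  shows "h m = c"
proof (rule tendsto_unique[of "at_left m"])
  show "(h \<longlongrightarrow> h m) (at_left m)"
    using assms(1) unfolding isCont_def by (rule tendsto_within_subset) simp
  have "eventually (\<lambda>t. t \<in> {a<..<m}) (at_left m)"
    using assms(2) by (rule eventually_at_left_real)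
  hence "eventually (\<lambda>t. h t = c) (at_left m)" by eventually_elim (use assms(3) in auto)
  thus "(h \<longlongrightarrow> c) (at_left m)" by (rule tendsto_eventually)
qed simp

text \<open>If \<open>a x < 1\<close>, the trivial zeros contribute moments \<open>\<integral> f'(t) (x t) powr (-2n) dt\<close>; their boundedness
  forces \<open>f'\<close> to vanish wherever \<open>x t < 1\<close>.\<close>

lemma constant_of_bounded_trivial_terms:
  fixes f f1 :: "real \<Rightarrow> real"
  assumes a: "0 < a" "a < b" and x: "x > 0"
    and f: "\<And>t. t > 0 \<Longrightarrow> (f has_real_derivative f1 t) (at t)" and f1: "continuous_on {a..b} f1"
    and F: "\<And>s. s \<noteq> 0 \<Longrightarrow> F s = - integral {a..b} (\<lambda>t. of_real (f1 t) * of_real t powr s) / s"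
    and K: "\<And>n. n \<ge> 1 \<Longrightarrow> norm (trivial_zero_term F x n) \<le> K"
    and \<tau>: "a < \<tau>" "\<tau> \<le> b" "\<tau> < 1 / x"
  shows "f \<tau> = f a"
proof -
  define v where "v = (\<lambda>t. 1 / (x * t)\<^sup>2)"
  define w where "w = (\<lambda>t. complex_of_real (f1 t))"
  have w: "continuous_on {a..b} w" unfolding w_def by (intro continuous_intros f1)
  \<comment> \<open>Multiplying F (-2n) by its denominator turns bounded terms into moments of size
    O(n); hence the linear factor in the hypothesis of \<open>moments_vanish\<close>.\<close>
  have mom: "norm (integral {a..b} (\<lambda>t. w t * of_real (v t ^ n))) \<le> (2 * K) * n * 1 ^ n" if n: "n \<ge> 1" for n
  proof -
    define s where "s = (- 2 * of_nat n :: complex)"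
    have s0: "s \<noteq> 0" using n by (simp add: s_def)
    have p: "complex_of_real y powr s = of_real (1 / y ^ (2 * n))" if "y > 0" for y
    proof -
      have "s = - of_nat (2 * n)" by (simp add: s_def)
      moreover have "complex_of_real y powr of_nat (2 * n) = of_real y ^ (2 * n)" by (rule powr_nat') (use that in auto)
      ultimately show ?thesis by (simp add: powr_minus_divide)
    qed
    have "integral {a..b} (\<lambda>t. w t * of_real (v t ^ n)) = integral {a..b} (\<lambda>t. of_real x powr s * (of_real (f1 t) * of_real t powr s))"
    proof (rule integral_cong)
      fix t assume "t \<in> {a..b}"
      hence t: "t > 0" using a by auto
      show "w t * of_real (v t ^ n) = of_real x powr s * (of_real (f1 t) * of_real t powr s)"
        unfolding p[OF x] p[OF t] w_def v_def
        by (simp add: power_divide power_mult power_mult_distrib)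
    qed
    also have "\<dots> = of_real x powr s * integral {a..b} (\<lambda>t. of_real (f1 t) * of_real t powr s)"
      by (rule integral_mult_right)
    also have "integral {a..b} (\<lambda>t. of_real (f1 t) * of_real t powr s) = 2 * of_nat n * F s"
      using F[OF s0] s0 n by (simp add: s_def field_simps)
    also have "of_real x powr s * (2 * of_nat n * F s) = 2 * of_nat n * trivial_zero_term F x n"
      by (simp add: trivial_zero_term_def s_def)
    also have "norm \<dots> = 2 * n * norm (trivial_zero_term F x n)" by (simp add: norm_mult)
    also have "\<dots> \<le> 2 * n * K" by (intro mult_left_mono K n) auto
    finally show ?thesis by (simp add: mult_ac)
  qed
  \<comment> \<open>The value of v at \<tau>. It exceeds 1 because x * \<tau> < 1, and as v
    decreases, v t > c means t < \<tau>; what \<open>moments_vanish\<close> annihilates is thus the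
    integral of f' over {a..\<tau>}.\<close>
  define c where "c = 1 / (x * \<tau>)\<^sup>2"
  have x\<tau>: "0 < x * \<tau>" "x * \<tau> < 1" using x \<tau> a by (auto simp: field_simps)
  have "(x * \<tau>)\<^sup>2 < 1" using x\<tau> by (simp add: power_less_one_iff)
  moreover have "0 < (x * \<tau>)\<^sup>2" using x\<tau>(1) by (rule zero_less_power)
  ultimately have c: "c > 1" by (simp add: c_def less_divide_eq)
  have vc: "v t > c \<longleftrightarrow> t < \<tau>" "v t = c \<longleftrightarrow> t = \<tau>" if "t > 0" for t
  proof -
    have pos: "0 < (x * t)\<^sup>2" "0 < (x * \<tau>)\<^sup>2" using that x x\<tau> by auto
    have inv: "1 / q < 1 / p \<longleftrightarrow> p < q" "1 / p = 1 / q \<longleftrightarrow> p = q" if "p > 0" "q > 0" for p q :: real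
      using that by (auto simp: divide_simps)
    have "v t > c \<longleftrightarrow> (x * t)\<^sup>2 < (x * \<tau>)\<^sup>2" unfolding v_def c_def by (rule inv[OF pos])
    also have "\<dots> \<longleftrightarrow> x * t < x * \<tau>" unfolding not_le[symmetric]
      by (subst power_mono_iff) (use that x x\<tau> in auto)
    finally show "v t > c \<longleftrightarrow> t < \<tau>" using x by simp
    have "v t = c \<longleftrightarrow> (x * t)\<^sup>2 = (x * \<tau>)\<^sup>2" unfolding v_def c_def by (rule inv[OF pos])
    also have "\<dots> \<longleftrightarrow> x * t = x * \<tau>" using that x x\<tau> by (intro power2_eq_iff_nonneg) auto
    finally show "v t = c \<longleftrightarrow> t = \<tau>" using x by simp
  qed
  let ?k = "\<lambda>t. of_real (if v t > c then 1 else if v t = c then 1 - exp (-1) else 0) :: complex"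
  have "integral {a..b} (\<lambda>t. w t * ?k t) = 0"
    by (rule moments_vanish[OF w _ _ _ c mom]) (use a x in \<open>auto simp: v_def intro!: continuous_intros\<close>)
  moreover have "integral {a..b} (\<lambda>t. w t * ?k t) = integral {a..b} (\<lambda>t. if t \<in> {a..\<tau>} then w t else 0)"
  proof (rule integral_spike[of "{\<tau>}"])
    fix t assume t: "t \<in> {a..b} - {\<tau>}"
    hence "t > 0" using a by auto
    thus "(if t \<in> {a..\<tau>} then w t else 0) = w t * ?k t" using vc[of t] t by auto
  qed auto
  moreover have "\<dots> = integral {a..\<tau>} w"
    using integral_restrict_Int[of "{a..b}" "{a..\<tau>}" w] \<tau> by (simp add: Int_absorb1)
  moreover have "(w has_integral of_real (f \<tau> - f a)) {a..\<tau>}" unfolding w_def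
  proof (rule has_integral_of_real, rule fundamental_theorem_of_calculus)
    fix t assume "t \<in> {a..\<tau>}"
    hence "t > 0" using a by auto
    from f[OF this] show "(f has_vector_derivative f1 t) (at t within {a..\<tau>})"
      unfolding has_real_derivative_iff_has_vector_derivative by (rule has_vector_derivative_at_within)
  qed (use \<tau> in simp)
  ultimately have "complex_of_real (f \<tau> - f a) = 0" by (simp only: integral_unique)
  thus ?thesis by (simp only: of_real_eq_0_iff right_minus_eq)
qed

text \<open>If a x < 1, the series over the trivial zeros can diverge: by
  \<open>constant_of_bounded_trivial_terms\<close> its terms are unbounded unless f stays equal to 1
  on the part of {a..b} below 1 / x. Hence the form of the conclusion: convergence is asserted for a
  x >= 1, and the identity, including the limit over the nontrivial zeros, whenever that series
  converges.\<close>

theorem theorem2p3: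
  fixes a b x :: real and m :: nat
    and g f :: "real \<Rightarrow> real" and G :: "nat \<Rightarrow> real \<Rightarrow> real" and A :: "nat \<Rightarrow> real"
    and F :: "complex \<Rightarrow> complex"
  assumes "0 < a" and "a < b" and "2 \<le> m"
    and "\<And>y. 0 \<le> y \<Longrightarrow> y \<le> 1 \<Longrightarrow> 0 \<le> g y \<and> g y \<le> 1"
    and "derivatives_upto m g G"
    and "\<And>k. 1 \<le> k \<Longrightarrow> k \<le> m \<Longrightarrow> G k 0 = 0 \<and> G k 1 = 0"
    and "\<And>k. 1 \<le> k \<Longrightarrow> k \<le> m \<Longrightarrow> 0 < A k"
    and "\<And>k y. 1 \<le> k \<Longrightarrow> k \<le> m \<Longrightarrow> 0 < y \<Longrightarrow> y < 1 \<Longrightarrow> \<bar>G k y\<bar> \<le> A k"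
    and "\<And>t. 0 \<le> t \<Longrightarrow> t \<le> a \<Longrightarrow> f t = 1"
    and "\<And>t. b \<le> t \<Longrightarrow> f t = 0"
    and "\<And>t. a \<le> t \<Longrightarrow> t \<le> b \<Longrightarrow> f t = g ((t - a) / (b - a))"
    and "F = mellin_transform f"
    and "1 < x"
  shows "(1 \<le> a * x \<longrightarrow> summable (\<lambda>n. trivial_zero_term F x (Suc n))) \<and>
    (summable (\<lambda>n. trivial_zero_term F x (Suc n)) \<longrightarrow>
      (\<exists>R. (zeta_zero_sum F x \<longlongrightarrow> R) at_top \<and>
        complex_of_real (smoothed_chebyshev f x) =
          of_real x * F 1 - R - deriv riemann_zeta 0 / riemann_zeta 0
            - (\<Sum>n. trivial_zero_term F x (Suc n))))"
proof -
  note a = \<open>0 < a\<close> and ab = \<open>a < b\<close> and x = \<open>1 < x\<close>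
  note f_left = assms(9) and f_right = assms(10) and f_mid = assms(11)
  define f1 where "f1 = (\<lambda>t. if a \<le> t \<and> t \<le> b then G 1 ((t - a) / (b - a)) / (b - a) else 0)"
  define f2 where "f2 = (\<lambda>t. if a \<le> t \<and> t \<le> b then G 2 ((t - a) / (b - a)) / (b - a) / (b - a) else 0)"
  have G0: "G 0 = g" and Gd: "\<And>k y. k < m \<Longrightarrow> y \<in> {0..1} \<Longrightarrow> (G k has_real_derivative G (Suc k) y) (at y within {0..1})"
    using assms(5) unfolding derivatives_upto_def by auto
  have G1: "G 1 0 = 0" "G 1 1 = 0" and G2: "G 2 0 = 0" "G 2 1 = 0"
    using assms(6)[of 1] assms(6)[of 2] \<open>2 \<le> m\<close> by auto
  have g0: "g 0 = 1" "g 1 = 0" using f_mid[of a] f_mid[of b] f_left[of a] f_right[of b] a ab by auto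
  have d1: "(f has_real_derivative f1 t) (at t)" if "t > 0" for t
    unfolding f1_def
    by (rule has_real_derivative_glued[where H = g and H' = "G 1", OF a ab _ G1])
       (use Gd[of 0] G0 \<open>2 \<le> m\<close> g0 f_left f_right f_mid that in auto)
  have d2: "(f1 has_real_derivative f2 t) (at t)" if "t > 0" for t
    unfolding f2_def
  proof (rule has_real_derivative_glued[where H = "\<lambda>y. G 1 y / (b - a)" and H' = "\<lambda>y. G 2 y / (b - a)", OF a ab])
    show "((\<lambda>y. G 1 y / (b - a)) has_real_derivative G 2 y / (b - a)) (at y within {0..1})" if "y \<in> {0..1}" for y
      using Gd[of 1 y] \<open>2 \<le> m\<close> that by (intro DERIV_cdivide) (auto simp: numeral_2_eq_2)
  qed (use that G1 G2 ab in \<open>auto simp: f1_def\<close>)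
  have f1_0: "f1 t = 0" if "t \<le> a \<or> t \<ge> b" for t
    using that G1 ab by (auto simp: f1_def)
  define M where "M = A 2 / (b - a) / (b - a)"
  have f2_le: "\<bar>f2 t\<bar> \<le> M" for t
  proof (cases "a < t \<and> t < b")
    case True
    hence "\<bar>G 2 ((t - a) / (b - a))\<bar> \<le> A 2" using ab \<open>2 \<le> m\<close> by (intro assms(8)) auto
    thus ?thesis using True ab by (simp add: f2_def M_def divide_right_mono)
  next
    case False
    hence "f2 t = 0" using G2 ab by (auto simp: f2_def)
    moreover have "M \<ge> 0" using assms(7)[of 2] \<open>2 \<le> m\<close> ab by (simp add: M_def)
    ultimately show ?thesis by simp
  qed
  have f_le: "\<bar>f t\<bar> \<le> 1" if "t \<ge> 0" for t
  proof -
    consider "t \<le> a" | "a \<le> t" "t \<le> b" | "t \<ge> b" by linarith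
    thus ?thesis
    proof cases
      case 2
      hence "0 \<le> (t - a) / (b - a)" "(t - a) / (b - a) \<le> 1" using ab by auto
      thus ?thesis using assms(4)[of "(t - a) / (b - a)"] f_mid[OF 2] by auto
    qed (use f_left f_right that in auto)
  qed
  have f1_cont: "continuous_on {c..d} f1" if "c > 0" for c d
    by (rule DERIV_continuous_on[OF has_field_derivative_at_within[OF d2]]) (use that in auto)
  have F_eq: "F s = - integral {a..b} (\<lambda>t. of_real (f1 t) * of_real t powr s) / s" if "s \<noteq> 0" for s
    unfolding assms(12) 
    by (rule mellin_transform_eq[OF a ab f_left f_right f_le d1 f1_cont[OF a]]) (use f1_0 that in auto)
  have core: "\<exists>R. summable (\<lambda>n. trivial_zero_term F x (Suc n)) \<and> (zeta_zero_sum F x \<longlongrightarrow> R) at_top \<and>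
      complex_of_real (smoothed_chebyshev f x) =
        of_real x * F 1 - R - deriv riemann_zeta 0 / riemann_zeta 0 - (\<Sum>n. trivial_zero_term F x (Suc n))"
    if xb: "1 / x < b" and start: "f (1 / x) = 1" and z: "\<And>t. t \<le> 1 / x \<Longrightarrow> f1 t = 0"
  proof (rule explicit_formula_constant_near_zero[OF x xb d1 d2 f2_le])
    show "f t = 0" if "t \<ge> b" for t using f_right that by simp
    show "f1 b = 0" "f1 (1 / x) = 0" using f1_0 z by auto
    show "f (1 / x) = 1" by (rule start)
    show "F s = - integral {1 / x..b} (\<lambda>t. of_real (f1 t) * of_real t powr s) / s" if "s \<noteq> 0" for s
    proof -
      \<comment> \<open>1 / x may lie on either side of a; in both cases f1 vanishes on the interval
        between them.\<close>
      have "(if t \<in> {a..b} then of_real (f1 t) * of_real t powr s else 0) =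
          (if t \<in> {1 / x..b} then of_real (f1 t) * of_real t powr s else 0)" for t
        using f1_0[of t] z[of t] by auto
      hence "integral {a..b} (\<lambda>t. of_real (f1 t) * of_real t powr s) = integral {1 / x..b} (\<lambda>t. of_real (f1 t) * of_real t powr s)"
        unfolding integral_restrict_UNIV[of "{a..b}", symmetric] integral_restrict_UNIV[of "{1 / x..b}", symmetric] by presburger
      thus ?thesis using F_eq[OF that] by simp
    qed
  qed
  show ?thesis
  proof (cases "1 \<le> a * x")
    case True
    hence "1 / x \<le> a" using x by (simp add: field_simps)
    with core f1_0 f_left[of "1 / x"] ab x show ?thesis by auto
  next
    case False
    hence ax: "a < 1 / x" using x by (simp add: field_simps)
    show ?thesis
    proof (intro conjI impI)
      assume sm: "summable (\<lambda>n. trivial_zero_term F x (Suc n))"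
      obtain K where K: "\<And>n. norm (trivial_zero_term F x (Suc n)) \<le> K"
        using summable_imp_Bseq[OF sm] by (auto simp: Bseq_def)
      have K': "norm (trivial_zero_term F x n) \<le> K" if "n \<ge> 1" for n
        using K[of "n - 1"] that by simp
      have f_const: "f t = 1" if "a < t" "t \<le> b" "t < 1 / x" for t
        using constant_of_bounded_trivial_terms[OF a ab _ d1 f1_cont[OF a] F_eq K' that] x f_left[of a] a by simp
      \<comment> \<open>The moment argument reaches only t < 1 / x; continuity adds the endpoint,
        where f (1 / x) = 1 is required.\<close>
      have limit: "f t = 1" if "a < t" "t \<le> b" "t \<le> 1 / x" for t
        by (rule eq_limit_from_left[OF DERIV_isCont[OF d1]]) (use that a f_const in auto)
      \<comment> \<open>Otherwise f would equal 1 up to b, where it is 0.\<close>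
      have xb: "1 / x < b"
      proof (rule ccontr)
        assume "\<not> 1 / x < b"
        hence "f b = 1" using limit[of b] ab by simp
        thus False using f_right[of b] by simp
      qed
      have f1_z: "f1 t = 0" if "t < 1 / x" for t
      proof (cases "t \<le> a")
        case False
        have "((\<lambda>_. 1) has_real_derivative 0) (at t)" by simp
        hence "(f has_real_derivative 0) (at t)"
          by (rule has_field_derivative_transform_within_open[of _ _ _ "{a<..<1 / x}"])
             (use False that f_const xb in auto)
        thus ?thesis using DERIV_unique d1[of t] False a by auto
      qed (use f1_0 in auto)
      have "f1 (1 / x) = 0"
        by (rule eq_limit_from_left[OF DERIV_isCont[OF d2], of _ a]) (use ax f1_z x in auto)
      with f1_z have "f1 t = 0" if "t \<le> 1 / x" for t using that by (cases "t = 1 / x") auto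
      from core[OF xb limit this] ax xb show "\<exists>R. (zeta_zero_sum F x \<longlongrightarrow> R) at_top \<and>
        complex_of_real (smoothed_chebyshev f x) =
          of_real x * F 1 - R - deriv riemann_zeta 0 / riemann_zeta 0
            - (\<Sum>n. trivial_zero_term F x (Suc n))" by auto
    qed (use False in simp)
  qed
qed

end
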